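(* Let $\mathfrak A$ have a convergent scaling limit, with subalgebra $\underline{\mathfrak A}_{\mathrm{conv}}\subset\underline{\mathfrak A}$, and let $\underline\omega_{\mathsf u}$ be a multiplicative limit state with separable representation space $\mathcal H_{\mathsf u}$ (with associated $\pi_{\mathsf u}$, $\Omega_{\mathsf u}$, and Poincaré group representation $U_{\mathsf u}$). Then the Poincaré group representation $U_{\mathsf u}$ on $\mathcal H_{\mathsf u}$ extends to a representation (again denoted $U_{\mathsf u}$) of the extended symmetry group $\underline{\mathcal G}$. For any invariant limit state $\underline\omega_0$ with associated representation $U_0$ of $\underline{\mathcal G}$, one has $$VU_0(\mu)V^*=(U_0(\mu)\restriction\mathcal H_{\mathfrak Z})\otimes U_{\mathsf u}(\mu)\quad\text{for all }\mu\in\mathbb R_+,$$ where $V:\mathcal H_0\to\mathcal H_{\mathfrak Z}\otimes\mathcal H_{\mathsf u}$ is the unitary determined by $V\pi_0(\underline A\,\underline C)\Omega_0=\pi_0(\underline C)\Omega_{\mathfrak Z}\otimes\pi_{\mathsf u}(\underline A)\Omega_{\mathsf u}$ for all $\underline A\in\underline{\mathfrak A}_{\mathrm{conv}}$, $\underline C\in\mathfrak Z(\underline{\mathfrak A})$.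
   Context: Nets. Minkowski space is $\mathbb R^{s+1}$. A net of algebras assigns to each open bounded region $\mathcal O\subset\mathbb R^{s+1}$ a C*-algebra $\mathfrak A(\mathcal O)$ with $\mathfrak A(\mathcal O_1)\subset\mathfrak A(\mathcal O_2)$ if $\mathcal O_1\subset\mathcal O_2$; $\mathfrak A$ also denotes the quasilocal algebra (C*-inductive limit). A local net with symmetry group $\mathcal G$ (a Lie group of point transformations of Minkowski space containing the translations) is a net with a representation $g\mapsto\alpha_g$ of $\mathcal G$ by automorphisms such that (i) $[A_1,A_2]=0$ if $A_i\in\mathfrak A(\mathcal O_i)$ with $\mathcal O_1,\mathcal O_2$ spacelike separated, (ii) $\alpha_g\mathfrak A(\mathcal O)=\mathfrak A(g.\mathcal O)$. It is in a positive energy representation if moreover the $\mathfrak A(\mathcal O)$ are W*-algebras on a common Hilbert space $\mathcal H$, $\alpha_g=\mathrm{ad}\,U(g)$ for a strongly continuous unitary representation $U$ of $\mathcal G$, the joint spectrum of the generators of the translations lies in the closed forward light cone, and there is a vector $\Omega\in\mathcal H$ invariant under all $U(g)$ and cyclic for $\mathfrak A$. It is in the vacuum sector if moreover $\Omega$ is unique up to scalars as a translation-invariant vector. Standing assumption: $\mathfrak A$ is a fixed local net in the vacuum sector with symmetry group the Poincaré group $\mathcal P_+^\uparrow$; $\omega=(\Omega|\,\cdot\,\Omega)$. Scaling algebra. $\underline{\mathfrak B}$ is the C*-algebra of bounded functions $\underline B:\mathbb R_+\to\mathcal B(\mathcal H)$, $\lambda\mapsto\underline B_\lambda$, with pointwise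 operations and norm $\sup_\lambda\|\underline B_\lambda\|$. $\underline{\mathcal G}$ is the (extended symmetry) group generated by Poincaré transformations and dilations, with elements $g=(\mu,x,\Lambda)$, $\mu\in\mathbb R_+$; it acts by $(\underline\alpha_g\underline B)_\lambda=\alpha_{\lambda\mu x,\Lambda}(\underline B_{\lambda\mu})$; in particular dilations act by $\underline\delta_\mu(\underline B)_\lambda=\underline B_{\mu\lambda}$. Put $\underline{\mathfrak A}(\mathcal O)=\{\underline A\in\underline{\mathfrak B}\,|\,\underline A_\lambda\in\mathfrak A(\lambda\mathcal O)\ \forall\lambda>0,\ g\mapsto\underline\alpha_g(\underline A)\text{ norm continuous}\}$; $\underline{\mathfrak A}$ is the associated quasilocal C*-algebra. Its center $\mathfrak Z(\underline{\mathfrak A})$ consists of the functions $\lambda\mapsto f(\lambda)\mathbf 1$ with $f:\mathbb R_+\to\mathbb C$ bounded and uniformly continuous with respect to the multiplicative group structure. Limit states. A mean $\mathsf m$ is a state on $\mathfrak Z(\underline{\mathfrak A})$; it is asymptotic if $\mathsf m(f)=0$ whenever $f(\lambda)=0$ for small $\lambda$ (equivalently $\mathsf m(f)=\lim_{\lambda\to0}f(\lambda)$ whenever the limit exists), multiplicative if $\mathsf m(fg)=\mathsf m(f)\mathsf m(g)$, and invariant if $\mathsf m(f(\mu\,\cdot))=\mathsf m(f)$ for all $\mu>0$. Let $\omega:\underline{\mathfrak A}\to\mathfrak Z(\underline{\mathfrak A})$, $(\omega(\underline A))_\lambda=\omega(\underline A_\lambda)\mathbf 1$. A limit state is a state $\underline\omega_0=\mathsf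 m\circ\omega$ on $\underline{\mathfrak A}$ with $\mathsf m$ an asymptotic mean; it is called multiplicative or invariant if $\mathsf m$ is. For a limit state, $(\mathcal H_0,\pi_0,\Omega_0)$ is its GNS triple, $\mathfrak A_0(\mathcal O)=\pi_0(\underline{\mathfrak A}(\mathcal O))''$, and $U_0(g)\pi_0(\underline A)\Omega_0=\pi_0(\underline\alpha_g\underline A)\Omega_0$ for $g$ in the subgroup of $\underline{\mathcal G}$ leaving $\underline\omega_0$ invariant; this always contains $\mathcal P_+^\uparrow$, and equals $\underline{\mathcal G}$ if $\underline\omega_0$ is invariant. For the fixed multiplicative state $\underline\omega_{\mathsf u}$ the subscript $0$ is replaced by $\mathsf u$. $\mathcal H_{\mathfrak Z}=\overline{\pi_0(\mathfrak Z(\underline{\mathfrak A}))\Omega_0}\subset\mathcal H_0$, and $\Omega_{\mathfrak Z}=\Omega_0$ regarded as a vector of $\mathcal H_{\mathfrak Z}$. Convergent scaling limit: there is an $\underline\alpha$-invariant (under all of $\underline{\mathcal G}$) C*-subalgebra $\underline{\mathfrak A}_{\mathrm{conv}}\subset\underline{\mathfrak A}$ such that (i) for each $\underline A\in\underline{\mathfrak A}_{\mathrm{conv}}$, $\lambda\mapsto\omega(\underline A_\lambda)$ converges as $\lambda\to0$; (ii) if $\underline\omega_0$ is a multiplicative limit state, then $\pi_0(\underline{\mathfrak A}(\mathcal O)\cap\underline{\mathfrak A}_{\mathrm{conv}})$ is weakly dense in $\mathfrak A_0(\mathcal O)$ for every open bounded region $\mathcal O$. Under the hypotheses of the claim, it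 is known that the unitary $V$ with the stated property exists for every limit state $\underline\omega_0$. *)

theory Defs
  imports "HOL-Analysis.Analysis" "HOL-Library.Function_Algebras"
begin

text \<open>
  Inner products are antilinear in the first argument, as in \<open>\<omega> = (\<Omega>|\<cdot>\<Omega>)\<close>. Positive
  definiteness is contained in the last axiom, because \<open>sqrt\<close> is negative on negative reals.
\<close>

class complex_inner = real_normed_vector +
  fixes scaleC :: "complex \<Rightarrow> 'a \<Rightarrow> 'a"  (infixr \<open>*\<^sub>C\<close> 75)
    and cinner :: "'a \<Rightarrow> 'a \<Rightarrow> complex"  (infix \<open>\<bullet>\<^sub>C\<close> 70)
  assumes scaleC_of_real: "complex_of_real r *\<^sub>C x = r *\<^sub>R x"
    and scaleC_add_right: "a *\<^sub>C (x + y) = a *\<^sub>C x + a *\<^sub>C y"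
    and scaleC_add_left: "(a + b) *\<^sub>C x = a *\<^sub>C x + b *\<^sub>C x"
    and scaleC_scaleC: "a *\<^sub>C (b *\<^sub>C x) = (a * b) *\<^sub>C x"
    and cinner_commute: "x \<bullet>\<^sub>C y = cnj (y \<bullet>\<^sub>C x)"
    and cinner_add_right: "x \<bullet>\<^sub>C (y + z) = x \<bullet>\<^sub>C y + x \<bullet>\<^sub>C z"
    and cinner_scaleC_right: "x \<bullet>\<^sub>C (a *\<^sub>C y) = a * (x \<bullet>\<^sub>C y)"
    and norm_eq_sqrt_cinner: "norm x = sqrt (Re (x \<bullet>\<^sub>C x))"

class chilbert_space = complex_inner + complete_space

text \<open>
  GNS spaces have to be quantified over inside a formula, where types cannot vary. They are
  therefore taken to be closed subspaces of one sufficiently large Hilbert space of the form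
  \<open>\<ell>\<^sup>2(X)\<close>; see \<open>is_gns\<close> below.
\<close>

typedef 'a ell2 = "{f :: 'a \<Rightarrow> complex. (\<lambda>x. (cmod (f x))\<^sup>2) summable_on UNIV}"
  by (rule exI[of _ "\<lambda>_. 0"]) simp

setup_lifting type_definition_ell2

lemma ell2_memI:
  fixes f :: "'a \<Rightarrow> complex"
  assumes "\<And>F. finite F \<Longrightarrow> L2_set (\<lambda>x. cmod (f x)) F \<le> C"
  shows "(\<lambda>x. (cmod (f x))\<^sup>2) summable_on UNIV"
    and "sqrt (\<Sum>\<^sub>\<infinity>x. (cmod (f x))\<^sup>2) \<le> C"
proof -
  have C: "0 \<le> C" using assms[of "{}"] by simp
  have le: "(\<Sum>x\<in>F. (cmod (f x))\<^sup>2) \<le> C\<^sup>2" if "finite F" for F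
    using assms[OF that] C unfolding L2_set_def by (simp add: real_sqrt_le_iff' sum_nonneg)
  show s: "(\<lambda>x. (cmod (f x))\<^sup>2) summable_on UNIV"
    by (rule nonneg_bdd_above_summable_on) (auto intro!: bdd_aboveI[of _ "C\<^sup>2"] le)
  have "(\<Sum>\<^sub>\<infinity>x. (cmod (f x))\<^sup>2) \<le> C\<^sup>2"
    by (rule infsum_le_finite_sums[OF s]) (rule le)
  thus "sqrt (\<Sum>\<^sub>\<infinity>x. (cmod (f x))\<^sup>2) \<le> C"
    using C real_le_lsqrt by blast
qed

lemma ell2_L2_set_le:
  fixes f :: "'a \<Rightarrow> complex"
  assumes "(\<lambda>x. (cmod (f x))\<^sup>2) summable_on UNIV" "finite F"
  shows "L2_set (\<lambda>x. cmod (f x)) F \<le> sqrt (\<Sum>\<^sub>\<infinity>x. (cmod (f x))\<^sup>2)"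
  unfolding L2_set_def using finite_sum_le_infsum[OF assms] by simp

lemma ell2_add:
  fixes f g :: "'a \<Rightarrow> complex"
  assumes f: "(\<lambda>x. (cmod (f x))\<^sup>2) summable_on UNIV"
    and g: "(\<lambda>x. (cmod (g x))\<^sup>2) summable_on UNIV"
  shows "(\<lambda>x. (cmod (f x + g x))\<^sup>2) summable_on UNIV" 
    and "sqrt (\<Sum>\<^sub>\<infinity>x. (cmod (f x + g x))\<^sup>2)
      \<le> sqrt (\<Sum>\<^sub>\<infinity>x. (cmod (f x))\<^sup>2) + sqrt (\<Sum>\<^sub>\<infinity>x. (cmod (g x))\<^sup>2)"
proof -
  have *: "L2_set (\<lambda>x. cmod (f x + g x)) F
      \<le> sqrt (\<Sum>\<^sub>\<infinity>x. (cmod (f x))\<^sup>2) + sqrt (\<Sum>\<^sub>\<infinity>x. (cmod (g x))\<^sup>2)"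
    if F: "finite F" for F
  proof -
    have "L2_set (\<lambda>x. cmod (f x + g x)) F \<le> L2_set (\<lambda>x. cmod (f x) + cmod (g x)) F"
      by (rule L2_set_mono) (auto intro: norm_triangle_ineq)
    also have "\<dots> \<le> L2_set (\<lambda>x. cmod (f x)) F + L2_set (\<lambda>x. cmod (g x)) F"
      by (rule L2_set_triangle_ineq)
    finally show ?thesis
      using ell2_L2_set_le[OF f F] ell2_L2_set_le[OF g F] by linarith
  qed
  from ell2_memI[OF *] show "(\<lambda>x. (cmod (f x + g x))\<^sup>2) summable_on UNIV" 
    and "sqrt (\<Sum>\<^sub>\<infinity>x. (cmod (f x + g x))\<^sup>2)
      \<le> sqrt (\<Sum>\<^sub>\<infinity>x. (cmod (f x))\<^sup>2) + sqrt (\<Sum>\<^sub>\<infinity>x. (cmod (g x))\<^sup>2)" by blast+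
qed

lemma ell2_scale:
  fixes f :: "'a \<Rightarrow> complex"
  assumes f: "(\<lambda>x. (cmod (f x))\<^sup>2) summable_on UNIV"
  shows "(\<lambda>x. (cmod (c * f x))\<^sup>2) summable_on UNIV" 
  using summable_on_cmult_right[OF f, of "(cmod c)\<^sup>2"]
  by (simp add: norm_mult power_mult_distrib)

lemma ell2_inner:
  fixes f g :: "'a \<Rightarrow> complex"
  assumes f: "(\<lambda>x. (cmod (f x))\<^sup>2) summable_on UNIV"
    and g: "(\<lambda>x. (cmod (g x))\<^sup>2) summable_on UNIV"
  shows "(\<lambda>x. cnj (f x) * g x) summable_on UNIV"
proof -
  have "(\<lambda>x. cmod (cnj (f x) * g x)) summable_on UNIV"
  proof (rule summable_on_comparison_test[OF summable_on_add[OF f g]])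
    fix x
    have "2 * (cmod (f x) * cmod (g x)) \<le> (cmod (f x))\<^sup>2 + (cmod (g x))\<^sup>2"
      using sum_squares_bound[of "cmod (f x)" "cmod (g x)"] by simp
    moreover have "0 \<le> cmod (f x) * cmod (g x)" by simp
    ultimately have "cmod (f x) * cmod (g x) \<le> (cmod (f x))\<^sup>2 + (cmod (g x))\<^sup>2"
      by linarith
    thus "cmod (cnj (f x) * g x) \<le> (cmod (f x))\<^sup>2 + (cmod (g x))\<^sup>2"
      by (simp add: norm_mult)
  qed simp
  thus ?thesis by (rule abs_summable_summable)
qed

instantiation ell2 :: (type) complex_inner
begin

lift_definition zero_ell2 :: "'a ell2" is "\<lambda>_. 0" by simp
lift_definition plus_ell2 :: "'a ell2 \<Rightarrow> 'a ell2 \<Rightarrow> 'a ell2" is "\<lambda>f g x. f x + g x"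
  by (rule ell2_add)
lift_definition uminus_ell2 :: "'a ell2 \<Rightarrow> 'a ell2" is "\<lambda>f x. - f x" by simp
lift_definition minus_ell2 :: "'a ell2 \<Rightarrow> 'a ell2 \<Rightarrow> 'a ell2" is "\<lambda>f g x. f x - g x"
proof -
  fix f g :: "'a \<Rightarrow> complex"
  assume "(\<lambda>x. (cmod (f x))\<^sup>2) summable_on UNIV" "(\<lambda>x. (cmod (g x))\<^sup>2) summable_on UNIV"
  thus "(\<lambda>x. (cmod (f x - g x))\<^sup>2) summable_on UNIV"
    using ell2_add(1)[of f "\<lambda>x. - g x"] by simp
qed
lift_definition scaleC_ell2 :: "complex \<Rightarrow> 'a ell2 \<Rightarrow> 'a ell2" is "\<lambda>c f x. c * f x"
  by (rule ell2_scale)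
definition scaleR_ell2 :: "real \<Rightarrow> 'a ell2 \<Rightarrow> 'a ell2"
  where "scaleR_ell2 r f = complex_of_real r *\<^sub>C f"
lift_definition norm_ell2 :: "'a ell2 \<Rightarrow> real" is "\<lambda>f. sqrt (\<Sum>\<^sub>\<infinity>x. (cmod (f x))\<^sup>2)" .
lift_definition cinner_ell2 :: "'a ell2 \<Rightarrow> 'a ell2 \<Rightarrow> complex"
  is "\<lambda>f g. \<Sum>\<^sub>\<infinity>x. cnj (f x) * g x" .
definition dist_ell2 :: "'a ell2 \<Rightarrow> 'a ell2 \<Rightarrow> real"
  where "dist_ell2 f g = norm (f - g)"
definition sgn_ell2 :: "'a ell2 \<Rightarrow> 'a ell2" where "sgn_ell2 f = inverse (norm f) *\<^sub>R f"
definition uniformity_ell2 :: "('a ell2 \<times> 'a ell2) filter"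
  where "uniformity_ell2 = (INF e\<in>{0<..}. principal {(x, y). dist x y < e})"
definition open_ell2 :: "'a ell2 set \<Rightarrow> bool"
  where "open_ell2 U = (\<forall>x\<in>U. \<forall>\<^sub>F (x', y) in uniformity. x' = x \<longrightarrow> y \<in> U)"

instance
proof
  fix a b c :: complex and r s :: real and f g h :: "'a ell2" and U :: "'a ell2 set"
  show "f + g + h = f + (g + h)" by transfer (simp add: algebra_simps)
  show "f + g = g + f" by transfer (simp add: algebra_simps)
  show "0 + f = f" by transfer simp
  show "- f + f = 0" by transfer simp
  show "f - g = f + - g" by transfer simp
  show C1: "a *\<^sub>C (f + g) = a *\<^sub>C f + a *\<^sub>C g" for a and f g :: "'a ell2"
    by transfer (simp add: algebra_simps)
  show C2: "(a + b) *\<^sub>C f = a *\<^sub>C f + b *\<^sub>C f" for a b and f :: "'a ell2"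
    by transfer (simp add: algebra_simps)
  show C3: "a *\<^sub>C b *\<^sub>C f = (a * b) *\<^sub>C f" for a b and f :: "'a ell2"
    by transfer (simp add: algebra_simps)
  show "complex_of_real r *\<^sub>C f = r *\<^sub>R f" by (simp add: scaleR_ell2_def)
  show "r *\<^sub>R (f + g) = r *\<^sub>R f + r *\<^sub>R g" by (simp add: scaleR_ell2_def C1)
  show "(r + s) *\<^sub>R f = r *\<^sub>R f + s *\<^sub>R f" by (simp add: scaleR_ell2_def C2)
  show "r *\<^sub>R s *\<^sub>R f = (r * s) *\<^sub>R f" by (simp add: scaleR_ell2_def C3)
  show "1 *\<^sub>R f = f" unfolding scaleR_ell2_def by transfer simp
  show "dist f g = norm (f - g)" by (rule dist_ell2_def)
  show "sgn f = inverse (norm f) *\<^sub>R f" by (rule sgn_ell2_def)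
  show "uniformity = (INF e\<in>{0<..}. principal {(x, y :: 'a ell2). dist x y < e})"
    by (rule uniformity_ell2_def)
  show "open U = (\<forall>x\<in>U. \<forall>\<^sub>F (x', y) in uniformity. x' = x \<longrightarrow> y \<in> U)"
    by (rule open_ell2_def)
  show "norm (f + g) \<le> norm f + norm g"
    by transfer (rule ell2_add(2))
  show "norm f = 0 \<longleftrightarrow> f = 0"
  proof transfer
    fix f :: "'a \<Rightarrow> complex"
    assume f: "(\<lambda>x. (cmod (f x))\<^sup>2) summable_on UNIV"
    show "sqrt (\<Sum>\<^sub>\<infinity>x. (cmod (f x))\<^sup>2) = 0 \<longleftrightarrow> f = (\<lambda>_. 0)"
    proof
      assume z: "sqrt (\<Sum>\<^sub>\<infinity>x. (cmod (f x))\<^sup>2) = 0"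
      show "f = (\<lambda>_. 0)"
      proof
        fix x show "f x = 0"
          using ell2_L2_set_le[OF f, of "{x}"] z by simp
      qed
    qed simp
  qed
  show "norm (r *\<^sub>R f) = \<bar>r\<bar> * norm f"
    unfolding scaleR_ell2_def
  proof transfer
    fix r :: real and f :: "'a \<Rightarrow> complex"
    assume f: "(\<lambda>x. (cmod (f x))\<^sup>2) summable_on UNIV"
    have "(\<Sum>\<^sub>\<infinity>x. (cmod (complex_of_real r * f x))\<^sup>2) = r\<^sup>2 * (\<Sum>\<^sub>\<infinity>x. (cmod (f x))\<^sup>2)"
      by (simp add: norm_mult power_mult_distrib infsum_cmult_right')
    thus "sqrt (\<Sum>\<^sub>\<infinity>x. (cmod (complex_of_real r * f x))\<^sup>2) = \<bar>r\<bar> * sqrt (\<Sum>\<^sub>\<infinity>x. (cmod (f x))\<^sup>2)"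
      by (simp add: real_sqrt_mult)
  qed
  show "f \<bullet>\<^sub>C g = cnj (g \<bullet>\<^sub>C f)"
    by transfer (simp flip: infsum_cnj add: mult.commute)
  show "f \<bullet>\<^sub>C (g + h) = f \<bullet>\<^sub>C g + f \<bullet>\<^sub>C h"
    by transfer (simp add: distrib_left infsum_add ell2_inner)
  show "f \<bullet>\<^sub>C (a *\<^sub>C g) = a * (f \<bullet>\<^sub>C g)"
    by transfer (simp add: mult.left_commute infsum_cmult_right')
  show "norm f = sqrt (Re (f \<bullet>\<^sub>C f))"
  proof transfer
    fix f :: "'a \<Rightarrow> complex"
    assume f: "(\<lambda>x. (cmod (f x))\<^sup>2) summable_on UNIV"
    have "cnj (f x) * f x = complex_of_real ((cmod (f x))\<^sup>2)" for x
      by (metis complex_norm_square mult.commute)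
    hence "((\<lambda>x. cnj (f x) * f x) has_sum complex_of_real (\<Sum>\<^sub>\<infinity>x. (cmod (f x))\<^sup>2)) UNIV"
      using has_sum_of_real[OF has_sum_infsum[OF f]] by simp
    thus "sqrt (\<Sum>\<^sub>\<infinity>x. (cmod (f x))\<^sup>2) = sqrt (Re (\<Sum>\<^sub>\<infinity>x. cnj (f x) * f x))"
      by (simp add: infsumI)
  qed
qed

end

instance ell2 :: (type) chilbert_space
proof
  fix X :: "nat \<Rightarrow> 'a ell2"
  assume X: "Cauchy X"
  have le: "L2_set (\<lambda>x. cmod (Rep_ell2 f x)) F \<le> norm f" if "finite F" for f :: "'a ell2" and F
    using ell2_L2_set_le[OF _ that, of "Rep_ell2 f"] Rep_ell2[of f] by (simp add: norm_ell2.rep_eq)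
  have "Cauchy (\<lambda>n. Rep_ell2 (X n) x)" for x
  proof (rule metric_CauchyI)
    fix e :: real assume "0 < e"
    then obtain M where M: "\<And>m n. m \<ge> M \<Longrightarrow> n \<ge> M \<Longrightarrow> dist (X m) (X n) < e"
      using metric_CauchyD[OF X] by blast
    have "dist (Rep_ell2 (X m) x) (Rep_ell2 (X n) x) < e" if "m \<ge> M" "n \<ge> M" for m n
      using le[of "{x}" "X m - X n"] M[OF that]
      by (simp add: minus_ell2.rep_eq dist_norm)
    thus "\<exists>M. \<forall>m\<ge>M. \<forall>n\<ge>M. dist (Rep_ell2 (X m) x) (Rep_ell2 (X n) x) < e" by blast
  qed
  hence "\<exists>l. (\<lambda>n. Rep_ell2 (X n) x) \<longlonglongrightarrow> l" for x
    using Cauchy_convergent_iff convergent_def by blast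
  then obtain f where f: "\<And>x. (\<lambda>n. Rep_ell2 (X n) x) \<longlonglongrightarrow> f x" by metis
  have key: "L2_set (\<lambda>x. cmod (Rep_ell2 (X m) x - f x)) F \<le> e"
    if "finite F" "\<And>m n. m \<ge> M \<Longrightarrow> n \<ge> M \<Longrightarrow> dist (X m) (X n) < e" "m \<ge> M" for F M m e
  proof (rule tendsto_upperbound)
    show "(\<lambda>n. L2_set (\<lambda>x. cmod (Rep_ell2 (X m) x - Rep_ell2 (X n) x)) F)
        \<longlonglongrightarrow> L2_set (\<lambda>x. cmod (Rep_ell2 (X m) x - f x)) F"
      unfolding L2_set_def by (intro tendsto_intros f)
    have "L2_set (\<lambda>x. cmod (Rep_ell2 (X m) x - Rep_ell2 (X n) x)) F \<le> e" if "n \<ge> M" for n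
      using le[OF \<open>finite F\<close>, of "X m - X n"] \<open>m \<ge> M\<close> that \<open>\<And>m n. m \<ge> M \<Longrightarrow> n \<ge> M \<Longrightarrow> dist (X m) (X n) < e\<close>[of m n]
      by (simp add: minus_ell2.rep_eq dist_norm)
    thus "\<forall>\<^sub>F n in sequentially. L2_set (\<lambda>x. cmod (Rep_ell2 (X m) x - Rep_ell2 (X n) x)) F \<le> e"
      using eventually_sequentially by blast
  qed simp
  obtain M1 where M1: "\<And>m n. m \<ge> M1 \<Longrightarrow> n \<ge> M1 \<Longrightarrow> dist (X m) (X n) < 1"
    using metric_CauchyD[OF X, of 1] by auto
  have "(\<lambda>x. (cmod (Rep_ell2 (X M1) x - f x))\<^sup>2) summable_on UNIV"
    by (rule ell2_memI(1)[of _ 1], rule key[where M = M1]) (auto intro: M1)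
  from ell2_add(1)[OF ell2_scale[OF this, of "-1"], of "Rep_ell2 (X M1)"]
  have fin: "(\<lambda>x. (cmod (f x))\<^sup>2) summable_on UNIV"
    using Rep_ell2[of "X M1"] by (simp add: algebra_simps)
  hence Rf: "Rep_ell2 (Abs_ell2 f) = f" by (simp add: Abs_ell2_inverse)
  have "X \<longlonglongrightarrow> Abs_ell2 f"
  proof (rule metric_LIMSEQ_I)
    fix e :: real assume "0 < e"
    then obtain M where M: "\<And>m n. m \<ge> M \<Longrightarrow> n \<ge> M \<Longrightarrow> dist (X m) (X n) < e / 2"
      using metric_CauchyD[OF X, of "e / 2"] by auto
    have "dist (X m) (Abs_ell2 f) < e" if "m \<ge> M" for m
    proof -
      have "norm (X m - Abs_ell2 f) \<le> e / 2"
        unfolding norm_ell2.rep_eq minus_ell2.rep_eq Rf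
        by (rule ell2_memI(2), rule key[where M = M]) (assumption | rule M that)+
      thus ?thesis using \<open>0 < e\<close> by (simp add: dist_norm)
    qed
    thus "\<exists>M. \<forall>m\<ge>M. dist (X m) (Abs_ell2 f) < e" by blast
  qed
  thus "convergent X" by (auto simp: convergent_def)
qed

lift_definition tensor_ell2 :: "'a ell2 \<Rightarrow> 'b ell2 \<Rightarrow> ('a \<times> 'b) ell2"  (infixr \<open>\<otimes>\<^sub>2\<close> 70)
  is "\<lambda>f g (x, y). f x * g y"
proof -
  fix f :: "'a \<Rightarrow> complex" and g :: "'b \<Rightarrow> complex"
  assume f: "(\<lambda>x. (cmod (f x))\<^sup>2) summable_on UNIV" and g: "(\<lambda>x. (cmod (g x))\<^sup>2) summable_on UNIV"
  have "(\<lambda>(x, y). (cmod (f x))\<^sup>2 * (cmod (g y))\<^sup>2) summable_on UNIV \<times> UNIV"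
    by (rule summable_on_SigmaI[where g = "\<lambda>x. (cmod (f x))\<^sup>2 * (\<Sum>\<^sub>\<infinity>y. (cmod (g y))\<^sup>2)"])
      (auto intro!: has_sum_cmult_right has_sum_infsum summable_on_cmult_left f g)
  thus "(\<lambda>p. (cmod (case p of (x, y) \<Rightarrow> f x * g y))\<^sup>2) summable_on UNIV"
    by (simp add: case_prod_unfold norm_mult power_mult_distrib)
qed


section \<open>Operators on closed subspaces\<close>

text \<open>
  Hilbert spaces are closed subspaces \<open>S\<close> of types of class \<open>chilbert_space\<close>, with \<open>S = UNIV\<close> for
  the vacuum Hilbert space. An operator on \<open>S\<close> is a function on the ambient type whose values
  outside \<open>S\<close> are irrelevant.
\<close>

definition closed_csubspace :: "'a::complex_inner set \<Rightarrow> bool" where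
  "closed_csubspace S \<longleftrightarrow> closed S \<and> 0 \<in> S \<and>
     (\<forall>x\<in>S. \<forall>y\<in>S. x + y \<in> S) \<and> (\<forall>c. \<forall>x\<in>S. c *\<^sub>C x \<in> S)"

definition clinear_on :: "'a::complex_inner set \<Rightarrow> ('a \<Rightarrow> 'b::complex_inner) \<Rightarrow> bool" where
  "clinear_on S T \<longleftrightarrow>
     (\<forall>x\<in>S. \<forall>y\<in>S. T (x + y) = T x + T y) \<and> (\<forall>c. \<forall>x\<in>S. T (c *\<^sub>C x) = c *\<^sub>C T x)"

definition bop_on :: "'a::complex_inner set \<Rightarrow> ('a \<Rightarrow> 'a) set" where
  "bop_on S = {T. T ` S \<subseteq> S \<and> clinear_on S T \<and> (\<exists>K. \<forall>x\<in>S. norm (T x) \<le> K * norm x)}"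

definition unitary_between ::
  "'a::complex_inner set \<Rightarrow> 'b::complex_inner set \<Rightarrow> ('a \<Rightarrow> 'b) \<Rightarrow> bool" where
  "unitary_between S S' V \<longleftrightarrow>
     clinear_on S V \<and> (\<forall>x\<in>S. \<forall>y\<in>S. V x \<bullet>\<^sub>C V y = x \<bullet>\<^sub>C y) \<and> V ` S = S'"

definition cadjoint_on ::
  "'a::complex_inner set \<Rightarrow> ('a \<Rightarrow> 'b::complex_inner) \<Rightarrow> 'b \<Rightarrow> 'a" where
  "cadjoint_on S T y = (THE x. x \<in> S \<and> (\<forall>z\<in>S. z \<bullet>\<^sub>C x = T z \<bullet>\<^sub>C y))"

abbreviation cadj :: "('a::complex_inner \<Rightarrow> 'a) \<Rightarrow> 'a \<Rightarrow> 'a" where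
  "cadj \<equiv> cadjoint_on UNIV"

definition commutant_on ::
  "'a::complex_inner set \<Rightarrow> ('a \<Rightarrow> 'a) set \<Rightarrow> ('a \<Rightarrow> 'a) set" where
  "commutant_on S M = {T \<in> bop_on S. \<forall>T'\<in>M. \<forall>x\<in>S. T (T' x) = T' (T x)}"

definition weak_closure_on ::
  "'a::complex_inner set \<Rightarrow> ('a \<Rightarrow> 'a) set \<Rightarrow> ('a \<Rightarrow> 'a) set" where
  "weak_closure_on S M = {T \<in> bop_on S. \<forall>F \<epsilon>. finite F \<and> F \<subseteq> S \<times> S \<and> \<epsilon> > 0 \<longrightarrow>
     (\<exists>T'\<in>M. \<forall>(x, y)\<in>F. cmod (x \<bullet>\<^sub>C (T y - T' y)) < \<epsilon>)}"

definition von_neumann_algebra :: "('a::complex_inner \<Rightarrow> 'a) set \<Rightarrow> bool" where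
  "von_neumann_algebra M \<longleftrightarrow> M \<subseteq> bop_on UNIV \<and> (\<forall>T\<in>M. cadj T \<in> M) \<and>
     commutant_on UNIV (commutant_on UNIV M) = M"

definition tensor_space :: "'a ell2 set \<Rightarrow> 'b ell2 set \<Rightarrow> ('a \<times> 'b) ell2 set" where
  "tensor_space S S' = closed_csubspace hull {x \<otimes>\<^sub>2 y |x y. x \<in> S \<and> y \<in> S'}"

text \<open>The value \<open>0\<close> off the tensor product space only serves to make the operator unique.\<close>

definition tensor_op ::
  "'a ell2 set \<Rightarrow> 'b ell2 set \<Rightarrow> ('a ell2 \<Rightarrow> 'a ell2) \<Rightarrow> ('b ell2 \<Rightarrow> 'b ell2)
    \<Rightarrow> ('a \<times> 'b) ell2 \<Rightarrow> ('a \<times> 'b) ell2" where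
  "tensor_op S S' T T' = (THE R. R \<in> bop_on (tensor_space S S') \<and>
     (\<forall>z. z \<notin> tensor_space S S' \<longrightarrow> R z = 0) \<and>
     (\<forall>x\<in>S. \<forall>y\<in>S'. R (x \<otimes>\<^sub>2 y) = T x \<otimes>\<^sub>2 T' y))"


section \<open>Minkowski space and symmetry groups\<close>

text \<open>Coordinate \<open>None\<close> is time and \<open>Some i\<close> are the \<open>s = CARD('s)\<close> space directions.\<close>

type_synonym 's minkowski = "real ^ 's option"

definition mink_form :: "'s::finite minkowski \<Rightarrow> 's minkowski \<Rightarrow> real" where
  "mink_form x y = x $ None * y $ None - (\<Sum>i\<in>UNIV. x $ Some i * y $ Some i)"

definition forward_cone :: "'s::finite minkowski set" where
  "forward_cone = {p. mink_form p p \<ge> 0 \<and> p $ None \<ge> 0}"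

definition region :: "'s::finite minkowski set \<Rightarrow> bool" where
  "region \<O> \<longleftrightarrow> open \<O> \<and> bounded \<O> \<and> \<O> \<noteq> {}"

definition spacelike_separated :: "'s::finite minkowski set \<Rightarrow> 's minkowski set \<Rightarrow> bool" where
  "spacelike_separated \<O>1 \<O>2 \<longleftrightarrow> (\<forall>x\<in>\<O>1. \<forall>y\<in>\<O>2. mink_form (x - y) (x - y) < 0)"

definition lorentz_group :: "(real ^ 's::finite option ^ 's option) set" where
  "lorentz_group = {\<Lambda>. (\<forall>x y. mink_form (\<Lambda> *v x) (\<Lambda> *v y) = mink_form x y) \<and>
     det \<Lambda> = 1 \<and> \<Lambda> $ None $ None > 0}"

text \<open>
  The triple \<open>(\<mu>, x, \<Lambda>)\<close> is the point transformation \<open>z \<mapsto> \<mu> (\<Lambda> z + x)\<close>: the Poincare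
  transformation \<open>(x, \<Lambda>)\<close> followed by the dilation \<open>\<mu>\<close>. With this order of the factors,
  \<open>sc_act\<close> below is an action of the group.
\<close>

type_synonym 's symm = "real \<times> 's minkowski \<times> (real ^ 's option ^ 's option)"

fun symm_mult :: "'s::finite symm \<Rightarrow> 's symm \<Rightarrow> 's symm" where
  "symm_mult (\<mu>, x, \<Lambda>) (\<mu>', x', \<Lambda>') = (\<mu> * \<mu>', x /\<^sub>R \<mu>' + \<Lambda> *v x', \<Lambda> ** \<Lambda>')"

fun symm_apply :: "'s::finite symm \<Rightarrow> 's minkowski \<Rightarrow> 's minkowski" where
  "symm_apply (\<mu>, x, \<Lambda>) z = \<mu> *\<^sub>R (\<Lambda> *v z + x)"

definition extended_group :: "'s::finite symm set" where
  "extended_group = {0<..} \<times> UNIV \<times> lorentz_group"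

definition poincare_group :: "'s::finite symm set" where
  "poincare_group = {1} \<times> UNIV \<times> lorentz_group"

definition translation :: "'s::finite minkowski \<Rightarrow> 's symm" where
  "translation x = (1, x, mat 1)"

definition dilation :: "real \<Rightarrow> 's::finite symm" where
  "dilation \<mu> = (\<mu>, 0, mat 1)"

lemma symm_apply_mult:
  assumes "g \<in> extended_group" "h \<in> extended_group"
  shows "symm_apply (symm_mult g h) z = symm_apply g (symm_apply h z)"
  using assms
  by (cases g; cases h)
    (auto simp: extended_group_def algebra_simps matrix_vector_mul_assoc
      matrix_vector_right_distrib matrix_vector_mult_scaleR)

definition unitary_rep :: "'s::finite symm set \<Rightarrow> 'a::complex_inner set \<Rightarrow> ('s symm \<Rightarrow> 'a \<Rightarrow> 'a) \<Rightarrow> bool" where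
  "unitary_rep G S U \<longleftrightarrow>
     (\<forall>g\<in>G. unitary_between S S (U g)) \<and>
     (\<forall>g\<in>G. \<forall>h\<in>G. \<forall>x\<in>S. U (symm_mult g h) x = U g (U h x)) \<and>
     (\<forall>x\<in>S. continuous_on G (\<lambda>g. U g x))"


section \<open>Local nets in the vacuum sector\<close>

text \<open>
  The spectral measure \<open>E\<close> of the translations is determined by
  \<open>U(x) = \<integral> exp(i p\<cdot>x) dE(p)\<close>, in matrix elements, with the Minkowski product \<open>p\<cdot>x\<close>;
  the joint spectrum of the generators is the support of \<open>E\<close>.
\<close>

definition projection_valued_measure ::
  "('s::finite minkowski set \<Rightarrow> 'h::chilbert_space \<Rightarrow> 'h) \<Rightarrow> bool" where
  "projection_valued_measure E \<longleftrightarrow>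
     (\<forall>B\<in>sets borel. E B \<in> bop_on UNIV \<and> E B \<circ> E B = E B \<and> cadj (E B) = E B) \<and>
     E UNIV = id \<and>
     (\<forall>B :: nat \<Rightarrow> _. range B \<subseteq> sets borel \<and> disjoint_family B \<longrightarrow>
        (\<forall>\<psi>. (\<lambda>n. E (B n) \<psi>) sums E (\<Union>n. B n) \<psi>))"

definition translation_spectral_measure ::
  "('s::finite symm \<Rightarrow> 'h::chilbert_space \<Rightarrow> 'h) \<Rightarrow> ('s minkowski set \<Rightarrow> 'h \<Rightarrow> 'h) \<Rightarrow> bool" where
  "translation_spectral_measure U E \<longleftrightarrow> projection_valued_measure E \<and>
     (\<forall>x \<psi>. \<psi> \<bullet>\<^sub>C U (translation x) \<psi> =
        (LINT p|measure_of UNIV (sets borel) (\<lambda>B. ennreal (Re (\<psi> \<bullet>\<^sub>C E B \<psi>))). cis (mink_form p x)))"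

definition joint_spectrum ::
  "('s::finite minkowski set \<Rightarrow> 'h::chilbert_space \<Rightarrow> 'h) \<Rightarrow> 's minkowski set" where
  "joint_spectrum E = {p. \<forall>N. open N \<and> p \<in> N \<longrightarrow> E N \<noteq> (\<lambda>_. 0)}"

definition ad :: "('h::chilbert_space \<Rightarrow> 'h) \<Rightarrow> ('h \<Rightarrow> 'h) \<Rightarrow> 'h \<Rightarrow> 'h" where
  "ad V T = V \<circ> T \<circ> cadj V"

definition quasilocal_algebra ::
  "('s::finite minkowski set \<Rightarrow> ('h::chilbert_space \<Rightarrow> 'h) set) \<Rightarrow> ('h \<Rightarrow> 'h) set" where
  "quasilocal_algebra \<AA> = {T \<in> bop_on UNIV. \<forall>\<epsilon>>0. \<exists>\<O> T'. region \<O> \<and> T' \<in> \<AA> \<O> \<and> onorm (T - T') < \<epsilon>}"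

definition vacuum_sector_net ::
  "('s::finite minkowski set \<Rightarrow> ('h::chilbert_space \<Rightarrow> 'h) set) \<Rightarrow> ('s symm \<Rightarrow> 'h \<Rightarrow> 'h) \<Rightarrow> 'h \<Rightarrow> bool" where
  "vacuum_sector_net \<AA> U \<Omega> \<longleftrightarrow>
     (\<forall>\<O>. region \<O> \<longrightarrow> von_neumann_algebra (\<AA> \<O>)) \<and>
     (\<forall>\<O>1 \<O>2. region \<O>1 \<and> region \<O>2 \<and> \<O>1 \<subseteq> \<O>2 \<longrightarrow> \<AA> \<O>1 \<subseteq> \<AA> \<O>2) \<and>
     (\<forall>\<O>1 \<O>2. region \<O>1 \<and> region \<O>2 \<and> spacelike_separated \<O>1 \<O>2 \<longrightarrow>
        (\<forall>T1\<in>\<AA> \<O>1. \<forall>T2\<in>\<AA> \<O>2. T1 \<circ> T2 = T2 \<circ> T1)) \<and>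
     unitary_rep poincare_group UNIV U \<and>
     (\<forall>g\<in>poincare_group. \<forall>\<O>. region \<O> \<longrightarrow> ad (U g) ` \<AA> \<O> = \<AA> (symm_apply g ` \<O>)) \<and>
     (\<exists>E. translation_spectral_measure U E \<and> joint_spectrum E \<subseteq> forward_cone) \<and>
     norm \<Omega> = 1 \<and>
     (\<forall>g\<in>poincare_group. U g \<Omega> = \<Omega>) \<and>
     closure {T \<Omega> |T. T \<in> quasilocal_algebra \<AA>} = UNIV \<and>
     (\<forall>\<psi>. (\<forall>x. U (translation x) \<psi> = \<psi>) \<longrightarrow> (\<exists>c. \<psi> = c *\<^sub>C \<Omega>))"


section \<open>The scaling algebra\<close>

text \<open>
  A function on the positive reals is extended by \<open>0\<close> to \<open>real\<close>, so that equality of elements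
  is equality of functions. Addition and subtraction are those of \<open>Function_Algebras\<close>.
\<close>

type_synonym 'h sc = "real \<Rightarrow> 'h \<Rightarrow> 'h"

definition sc_bounded :: "'h::chilbert_space sc set" where
  "sc_bounded = {B. (\<forall>l>0. B l \<in> bop_on UNIV) \<and> (\<forall>l\<le>0. B l = 0) \<and>
     bdd_above ((\<lambda>l. onorm (B l)) ` {0<..})}"

definition sc_norm :: "'h::chilbert_space sc \<Rightarrow> real" where
  "sc_norm B = (SUP l\<in>{0<..}. onorm (B l))"

definition sc_scale :: "complex \<Rightarrow> 'h::chilbert_space sc \<Rightarrow> 'h sc" where
  "sc_scale c B = (\<lambda>l x. c *\<^sub>C B l x)"

definition sc_mult :: "'h::chilbert_space sc \<Rightarrow> 'h sc \<Rightarrow> 'h sc" where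
  "sc_mult A B = (\<lambda>l. A l \<circ> B l)"

definition sc_star :: "'h::chilbert_space sc \<Rightarrow> 'h sc" where
  "sc_star B = (\<lambda>l. cadj (B l))"

definition sc_one :: "'h::chilbert_space sc" where
  "sc_one = (\<lambda>l. if l > 0 then id else 0)"

fun sc_act :: "('s::finite symm \<Rightarrow> 'h::chilbert_space \<Rightarrow> 'h) \<Rightarrow> 's symm \<Rightarrow> 'h sc \<Rightarrow> 'h sc" where
  "sc_act U (\<mu>, x, \<Lambda>) B = (\<lambda>l. ad (U (1, (l * \<mu>) *\<^sub>R x, \<Lambda>)) (B (l * \<mu>)))"

definition scaling_local ::
  "('s::finite minkowski set \<Rightarrow> ('h::chilbert_space \<Rightarrow> 'h) set) \<Rightarrow> ('s symm \<Rightarrow> 'h \<Rightarrow> 'h)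
    \<Rightarrow> 's minkowski set \<Rightarrow> 'h sc set" where
  "scaling_local \<AA> U \<O> = {A \<in> sc_bounded. (\<forall>l>0. A l \<in> \<AA> ((*\<^sub>R) l ` \<O>)) \<and>
     (\<forall>g\<in>extended_group.
        ((\<lambda>h. sc_norm (sc_act U h A - sc_act U g A)) \<longlongrightarrow> 0) (at g within extended_group))}"

definition scaling_algebra ::
  "('s::finite minkowski set \<Rightarrow> ('h::chilbert_space \<Rightarrow> 'h) set) \<Rightarrow> ('s symm \<Rightarrow> 'h \<Rightarrow> 'h) \<Rightarrow> 'h sc set" where
  "scaling_algebra \<AA> U = {A \<in> sc_bounded. \<forall>\<epsilon>>0. \<exists>\<O> A'.
     region \<O> \<and> A' \<in> scaling_local \<AA> U \<O> \<and> sc_norm (A - A') < \<epsilon>}"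

text \<open>
  The center is taken literally. For a net in the vacuum sector its elements are known to be the
  functions \<open>\<lambda> \<mapsto> f(\<lambda>) 1\<close> with \<open>f\<close> bounded and uniformly continuous for the multiplicative
  group structure of the positive reals.
\<close>

definition scaling_center ::
  "('s::finite minkowski set \<Rightarrow> ('h::chilbert_space \<Rightarrow> 'h) set) \<Rightarrow> ('s symm \<Rightarrow> 'h \<Rightarrow> 'h) \<Rightarrow> 'h sc set" where
  "scaling_center \<AA> U =
     {C \<in> scaling_algebra \<AA> U. \<forall>A\<in>scaling_algebra \<AA> U. sc_mult C A = sc_mult A C}"

definition cstar_subalgebra :: "'h::chilbert_space sc set \<Rightarrow> bool" where
  "cstar_subalgebra \<BB> \<longleftrightarrow> \<BB> \<subseteq> sc_bounded \<and> 0 \<in> \<BB> \<and>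
     (\<forall>A\<in>\<BB>. \<forall>B\<in>\<BB>. A + B \<in> \<BB> \<and> sc_mult A B \<in> \<BB>) \<and>
     (\<forall>c. \<forall>A\<in>\<BB>. sc_scale c A \<in> \<BB>) \<and> (\<forall>A\<in>\<BB>. sc_star A \<in> \<BB>) \<and>
     (\<forall>B\<in>sc_bounded. (\<forall>\<epsilon>>0. \<exists>A\<in>\<BB>. sc_norm (B - A) < \<epsilon>) \<longrightarrow> B \<in> \<BB>)"


section \<open>Limit states and their GNS representations\<close>

definition is_state :: "'h::chilbert_space sc set \<Rightarrow> ('h sc \<Rightarrow> complex) \<Rightarrow> bool" where
  "is_state \<BB> \<phi> \<longleftrightarrow>
     (\<forall>A\<in>\<BB>. \<forall>B\<in>\<BB>. \<phi> (A + B) = \<phi> A + \<phi> B) \<and> (\<forall>c. \<forall>A\<in>\<BB>. \<phi> (sc_scale c A) = c * \<phi> A) \<and>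
     (\<forall>A\<in>\<BB>. \<phi> (sc_mult (sc_star A) A) \<in> \<real>\<^sub>\<ge>\<^sub>0) \<and> \<phi> sc_one = 1"

definition asymptotic_mean ::
  "('s::finite minkowski set \<Rightarrow> ('h::chilbert_space \<Rightarrow> 'h) set) \<Rightarrow> ('s symm \<Rightarrow> 'h \<Rightarrow> 'h)
    \<Rightarrow> ('h sc \<Rightarrow> complex) \<Rightarrow> bool" where
  "asymptotic_mean \<AA> U m \<longleftrightarrow> is_state (scaling_center \<AA> U) m \<and>
     (\<forall>C\<in>scaling_center \<AA> U. (\<forall>\<^sub>F l in at_right 0. C l = 0) \<longrightarrow> m C = 0)"

definition multiplicative_mean ::
  "('s::finite minkowski set \<Rightarrow> ('h::chilbert_space \<Rightarrow> 'h) set) \<Rightarrow> ('s symm \<Rightarrow> 'h \<Rightarrow> 'h)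
    \<Rightarrow> ('h sc \<Rightarrow> complex) \<Rightarrow> bool" where
  "multiplicative_mean \<AA> U m \<longleftrightarrow>
     (\<forall>C\<in>scaling_center \<AA> U. \<forall>D\<in>scaling_center \<AA> U. m (sc_mult C D) = m C * m D)"

definition invariant_mean ::
  "('s::finite minkowski set \<Rightarrow> ('h::chilbert_space \<Rightarrow> 'h) set) \<Rightarrow> ('s symm \<Rightarrow> 'h \<Rightarrow> 'h)
    \<Rightarrow> ('h sc \<Rightarrow> complex) \<Rightarrow> bool" where
  "invariant_mean \<AA> U m \<longleftrightarrow> (\<forall>C\<in>scaling_center \<AA> U. \<forall>\<mu>>0. m (\<lambda>l. C (\<mu> * l)) = m C)"

definition sc_expect :: "'h::chilbert_space \<Rightarrow> 'h sc \<Rightarrow> 'h sc" where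
  "sc_expect \<Omega> A = (\<lambda>l x. (\<Omega> \<bullet>\<^sub>C A l \<Omega>) *\<^sub>C x)"

definition limit_state :: "'h::chilbert_space \<Rightarrow> ('h sc \<Rightarrow> complex) \<Rightarrow> 'h sc \<Rightarrow> complex" where
  "limit_state \<Omega> m = m \<circ> sc_expect \<Omega>"

text \<open>
  The GNS triple is unique up to unitary equivalence. Since a cyclic representation space of an
  algebra contained in \<open>'h sc\<close> has dimension at most the cardinality of \<open>'h sc\<close>, every state
  has a GNS triple on a closed subspace of \<open>\<ell>\<^sup>2('h sc)\<close>.
\<close>

type_synonym 'h gns = "'h sc ell2"

definition is_gns ::
  "'h::chilbert_space sc set \<Rightarrow> ('h sc \<Rightarrow> complex) \<Rightarrow>
    'h gns set \<Rightarrow> ('h sc \<Rightarrow> 'h gns \<Rightarrow> 'h gns) \<Rightarrow> 'h gns \<Rightarrow> bool" where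
  "is_gns \<BB> \<phi> S \<pi> \<xi> \<longleftrightarrow> closed_csubspace S \<and>
     (\<forall>A\<in>\<BB>. \<pi> A \<in> bop_on S) \<and>
     (\<forall>A\<in>\<BB>. \<forall>B\<in>\<BB>. \<forall>x\<in>S. \<pi> (A + B) x = \<pi> A x + \<pi> B x \<and> \<pi> (sc_mult A B) x = \<pi> A (\<pi> B x)) \<and>
     (\<forall>c. \<forall>A\<in>\<BB>. \<forall>x\<in>S. \<pi> (sc_scale c A) x = c *\<^sub>C \<pi> A x) \<and>
     (\<forall>A\<in>\<BB>. \<forall>x\<in>S. \<forall>y\<in>S. \<pi> (sc_star A) x \<bullet>\<^sub>C y = x \<bullet>\<^sub>C \<pi> A y) \<and>
     \<xi> \<in> S \<and> closure {\<pi> A \<xi> |A. A \<in> \<BB>} = S \<and>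
     (\<forall>A\<in>\<BB>. \<xi> \<bullet>\<^sub>C \<pi> A \<xi> = \<phi> A)"

definition gns_local_algebra ::
  "('s::finite minkowski set \<Rightarrow> ('h::chilbert_space \<Rightarrow> 'h) set) \<Rightarrow> ('s symm \<Rightarrow> 'h \<Rightarrow> 'h) \<Rightarrow>
    'h gns set \<Rightarrow> ('h sc \<Rightarrow> 'h gns \<Rightarrow> 'h gns) \<Rightarrow> 's minkowski set \<Rightarrow> ('h gns \<Rightarrow> 'h gns) set" where
  "gns_local_algebra \<AA> U S \<pi> \<O> = commutant_on S (commutant_on S (\<pi> ` scaling_local \<AA> U \<O>))"

definition state_stabilizer ::
  "('s::finite minkowski set \<Rightarrow> ('h::chilbert_space \<Rightarrow> 'h) set) \<Rightarrow> ('s symm \<Rightarrow> 'h \<Rightarrow> 'h) \<Rightarrow>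
    ('h sc \<Rightarrow> complex) \<Rightarrow> 's symm set" where
  "state_stabilizer \<AA> U \<phi> =
     {g \<in> extended_group. \<forall>A\<in>scaling_algebra \<AA> U. \<phi> (sc_act U g A) = \<phi> A}"

definition is_gns_symmetry_rep ::
  "('s::finite minkowski set \<Rightarrow> ('h::chilbert_space \<Rightarrow> 'h) set) \<Rightarrow> ('s symm \<Rightarrow> 'h \<Rightarrow> 'h) \<Rightarrow>
    ('h sc \<Rightarrow> complex) \<Rightarrow> 'h gns set \<Rightarrow> ('h sc \<Rightarrow> 'h gns \<Rightarrow> 'h gns) \<Rightarrow> 'h gns \<Rightarrow>
    ('s symm \<Rightarrow> 'h gns \<Rightarrow> 'h gns) \<Rightarrow> bool" where
  "is_gns_symmetry_rep \<AA> U \<phi> S \<pi> \<xi> U' \<longleftrightarrow>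
     (\<forall>g\<in>state_stabilizer \<AA> U \<phi>. U' g \<in> bop_on S \<and>
        (\<forall>A\<in>scaling_algebra \<AA> U. U' g (\<pi> A \<xi>) = \<pi> (sc_act U g A) \<xi>))"

definition center_space ::
  "('s::finite minkowski set \<Rightarrow> ('h::chilbert_space \<Rightarrow> 'h) set) \<Rightarrow> ('s symm \<Rightarrow> 'h \<Rightarrow> 'h) \<Rightarrow>
    ('h sc \<Rightarrow> 'h gns \<Rightarrow> 'h gns) \<Rightarrow> 'h gns \<Rightarrow> 'h gns set" where
  "center_space \<AA> U \<pi> \<xi> = closure {\<pi> C \<xi> |C. C \<in> scaling_center \<AA> U}"

definition convergent_scaling_limit ::
  "('s::finite minkowski set \<Rightarrow> ('h::chilbert_space \<Rightarrow> 'h) set) \<Rightarrow> ('s symm \<Rightarrow> 'h \<Rightarrow> 'h) \<Rightarrow> 'h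
    \<Rightarrow> 'h sc set \<Rightarrow> bool" where
  "convergent_scaling_limit \<AA> U \<Omega> \<AA>conv \<longleftrightarrow>
     cstar_subalgebra \<AA>conv \<and> \<AA>conv \<subseteq> scaling_algebra \<AA> U \<and>
     (\<forall>g\<in>extended_group. \<forall>A\<in>\<AA>conv. sc_act U g A \<in> \<AA>conv) \<and>
     (\<forall>A\<in>\<AA>conv. \<exists>L. ((\<lambda>l. \<Omega> \<bullet>\<^sub>C A l \<Omega>) \<longlongrightarrow> L) (at_right 0)) \<and>
     (\<forall>m S \<pi> \<xi>. asymptotic_mean \<AA> U m \<and> multiplicative_mean \<AA> U m \<and>
        is_gns (scaling_algebra \<AA> U) (limit_state \<Omega> m) S \<pi> \<xi> \<longrightarrow>
        (\<forall>\<O>. region \<O> \<longrightarrow>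
           gns_local_algebra \<AA> U S \<pi> \<O> \<subseteq> weak_closure_on S (\<pi> ` (scaling_local \<AA> U \<O> \<inter> \<AA>conv))))"

end

theory Submission
  imports Defs
begin

text \<open>
  For \<open>A\<close> in the convergent subalgebra, \<open>\<lambda> \<mapsto> \<omega>(A\<^sub>\<lambda>)\<close> has a limit at \<open>0\<close>, which a dilation does
  not change; since means vanish on null functions, every limit state is invariant under the
  whole extended group on this subalgebra. Hence \<open>\<pi>\<^sub>u(A)\<Omega>\<^sub>u \<mapsto> \<pi>\<^sub>u(\<alpha>\<^sub>g A)\<Omega>\<^sub>u\<close> is isometric. For a
  multiplicative state these vectors are dense, because a weakly dense subspace is norm dense, so
  the isometries extend to unitaries \<open>W(g)\<close>. The tensor formula is checked on
  \<open>\<pi>\<^sub>0(C)\<Omega>\<^sub>0 \<otimes> \<pi>\<^sub>u(A)\<Omega>\<^sub>u = V \<pi>\<^sub>0(A C)\<Omega>\<^sub>0\<close>, where both sides give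
  \<open>\<pi>\<^sub>0(\<alpha>\<^sub>\<mu> C)\<Omega>\<^sub>0 \<otimes> \<pi>\<^sub>u(\<alpha>\<^sub>\<mu> A)\<Omega>\<^sub>u\<close>; the operator \<open>V U\<^sub>0(\<mu>) V\<^sup>*\<close> itself witnesses that the tensor
  product operator exists.
\<close>

section \<open>Complex inner product spaces\<close>

text \<open>The means are states on a center that is defined by commutation, and neither their norm
  continuity nor their vanishing on null functions belongs to the definition:
  \<open>asymptotic_mean\<close> speaks only of elements that are zero near scale 0. Both facts are
  extracted from positivity. To do so, square roots and truncations of functions of the scale must
  again be central before a mean may be applied to them, and this is why bounded functions that are
  uniformly continuous in ln \<lambda> are shown to be stable under all continuous operations. The
  density hypothesis concerns local algebras, whereas cyclicity concerns the quasilocal one. The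
  contraction property \<open>norm_gns_le\<close>, again a consequence of positivity, bridges the
  two, and it also yields the strong continuity of \<open>W\<close>. The convergent subalgebra need
  not contain the identity, so the cyclic vector need not be one of the vectors on which
  \<open>W\<close> is prescribed. All identities are therefore verified on the dense orbit of the
  subalgebra and continued from there.\<close>

lemma scaleC_zero_left [simp]: "0 *\<^sub>C x = (0::'a::complex_inner)"
  using scaleC_of_real[of 0 x] by simp

lemma scaleC_one [simp]: "1 *\<^sub>C x = (x::'a::complex_inner)"
  using scaleC_of_real[of 1 x] by simp

lemma scaleC_zero_right [simp]: "c *\<^sub>C 0 = (0::'a::complex_inner)"
  using scaleC_add_right[of c 0 "0::'a"] by simp

lemma scaleC_minus_one: "(-1) *\<^sub>C x = - (x::'a::complex_inner)"
  using scaleC_of_real[of "-1" x] by simp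

lemma scaleC_minus_right [simp]: "c *\<^sub>C (- x) = - (c *\<^sub>C (x::'a::complex_inner))"
  using scaleC_add_right[of c x "-x"] by (simp add: eq_neg_iff_add_eq_0 add.commute)

lemma scaleC_diff_right: "c *\<^sub>C (x - y) = c *\<^sub>C x - c *\<^sub>C (y::'a::complex_inner)"
  using scaleC_add_right[of c x "-y"] by simp

lemma scaleC_diff_left: "(c - d) *\<^sub>C x = c *\<^sub>C x - d *\<^sub>C (x::'a::complex_inner)"
  using scaleC_add_left[of "c - d" d x] by simp

lemma cinner_add_left: "(x + y) \<bullet>\<^sub>C z = x \<bullet>\<^sub>C z + y \<bullet>\<^sub>C (z::'a::complex_inner)"
  by (metis cinner_add_right cinner_commute complex_cnj_add)

lemma cinner_scaleC_left: "(c *\<^sub>C x) \<bullet>\<^sub>C y = cnj c * (x \<bullet>\<^sub>C (y::'a::complex_inner))"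
  by (metis cinner_scaleC_right cinner_commute complex_cnj_mult)

lemma cinner_zero_right [simp]: "x \<bullet>\<^sub>C 0 = (0::complex)" for x :: "'a::complex_inner"
  using cinner_add_right[of x 0 0] by simp

lemma cinner_zero_left [simp]: "0 \<bullet>\<^sub>C x = (0::complex)" for x :: "'a::complex_inner"
  using cinner_add_left[of 0 0 x] by simp

lemma cinner_minus_right [simp]: "x \<bullet>\<^sub>C (- y) = - (x \<bullet>\<^sub>C (y::'a::complex_inner))"
  using cinner_add_right[of x y "- y"] by (simp add: eq_neg_iff_add_eq_0 add.commute)

lemma cinner_minus_left [simp]: "(- x) \<bullet>\<^sub>C y = - (x \<bullet>\<^sub>C (y::'a::complex_inner))"
  using cinner_add_left[of x "- x" y] by (simp add: eq_neg_iff_add_eq_0 add.commute)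

lemma cinner_diff_right: "x \<bullet>\<^sub>C (y - z) = x \<bullet>\<^sub>C y - x \<bullet>\<^sub>C (z::'a::complex_inner)"
  using cinner_add_right[of x y "- z"] by simp

lemma cinner_diff_left: "(x - y) \<bullet>\<^sub>C z = x \<bullet>\<^sub>C z - y \<bullet>\<^sub>C (z::'a::complex_inner)"
  using cinner_add_left[of x "- y" z] by simp

text \<open>Hermitian symmetry kills the imaginary part. The real part is nonnegative because
  \<open>sqrt\<close> is negative on negative reals while a norm is not; only then can the square
  root in the norm axiom be undone.\<close>

lemma cinner_self: "x \<bullet>\<^sub>C x = complex_of_real ((norm (x::'a::complex_inner))\<^sup>2)"
proof (rule complex_eqI)
  have "Im (x \<bullet>\<^sub>C x) = - Im (x \<bullet>\<^sub>C x)"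
    using arg_cong[OF cinner_commute[of x x], of Im] by simp
  thus "Im (x \<bullet>\<^sub>C x) = Im (complex_of_real ((norm x)\<^sup>2))" by simp
  have "0 \<le> Re (x \<bullet>\<^sub>C x)"
    using norm_ge_zero[of x] unfolding norm_eq_sqrt_cinner by simp
  thus "Re (x \<bullet>\<^sub>C x) = Re (complex_of_real ((norm x)\<^sup>2))"
    by (simp add: norm_eq_sqrt_cinner)
qed

lemma cinner_self_eq_0 [simp]: "x \<bullet>\<^sub>C x = 0 \<longleftrightarrow> x = (0::'a::complex_inner)"
  by (simp add: cinner_self)

lemma power2_norm_cinner: "(norm (x::'a::complex_inner))\<^sup>2 = Re (x \<bullet>\<^sub>C x)"
  by (simp add: cinner_self)

lemma norm_scaleC: "norm (c *\<^sub>C (x::'a::complex_inner)) = cmod c * norm x"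
proof -
  have "complex_of_real ((norm (c *\<^sub>C x))\<^sup>2) = (c * cnj c) * (x \<bullet>\<^sub>C x)"
    unfolding cinner_self[symmetric] by (simp add: cinner_scaleC_left cinner_scaleC_right)
  also have "\<dots> = complex_of_real ((cmod c * norm x)\<^sup>2)"
    by (simp only: cinner_self complex_norm_square[symmetric] of_real_mult[symmetric]
        power_mult_distrib)
  finally have "(norm (c *\<^sub>C x))\<^sup>2 = (cmod c * norm x)\<^sup>2"
    by (simp only: of_real_eq_iff)
  thus ?thesis by simp
qed

lemma cinner_cauchy_schwarz: "cmod (x \<bullet>\<^sub>C y) \<le> norm x * norm (y::'a::complex_inner)"
proof (cases "y = 0")
  case False
  let ?c = "(y \<bullet>\<^sub>C x) / (y \<bullet>\<^sub>C y)"
  have "(y \<bullet>\<^sub>C y) \<noteq> 0" using False by simp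
  hence "(x - ?c *\<^sub>C y) \<bullet>\<^sub>C (x - ?c *\<^sub>C y) = x \<bullet>\<^sub>C x - (y \<bullet>\<^sub>C x) * (x \<bullet>\<^sub>C y) / (y \<bullet>\<^sub>C y)"
    by (simp add: cinner_diff_left cinner_diff_right cinner_scaleC_left cinner_scaleC_right field_simps)
  also have "(y \<bullet>\<^sub>C x) * (x \<bullet>\<^sub>C y) = complex_of_real ((cmod (x \<bullet>\<^sub>C y))\<^sup>2)"
    by (metis cinner_commute complex_norm_square mult.commute)
  finally have "complex_of_real ((norm (x - ?c *\<^sub>C y))\<^sup>2)
      = complex_of_real ((norm x)\<^sup>2 - (cmod (x \<bullet>\<^sub>C y))\<^sup>2 / (norm y)\<^sup>2)"
    by (simp add: cinner_self)
  hence "(norm (x - ?c *\<^sub>C y))\<^sup>2 = (norm x)\<^sup>2 - (cmod (x \<bullet>\<^sub>C y))\<^sup>2 / (norm y)\<^sup>2"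
    by (simp only: of_real_eq_iff)
  hence "(cmod (x \<bullet>\<^sub>C y))\<^sup>2 / (norm y)\<^sup>2 \<le> (norm x)\<^sup>2"
    using zero_le_power2[of "norm (x - ?c *\<^sub>C y)"] by linarith
  hence "(cmod (x \<bullet>\<^sub>C y))\<^sup>2 \<le> (norm x * norm y)\<^sup>2"
    using False by (simp add: divide_le_eq power_mult_distrib)
  thus ?thesis by (rule power2_le_imp_le) simp
qed simp

lemma bounded_bilinear_cinner: "bounded_bilinear (\<lambda>x y::'a::complex_inner. x \<bullet>\<^sub>C y)"
proof
  show "\<exists>K. \<forall>a b::'a. norm (a \<bullet>\<^sub>C b) \<le> norm a * norm b * K"
    by (intro exI[of _ 1]) (simp add: cinner_cauchy_schwarz)
qed (simp_all add: cinner_add_left cinner_add_right cinner_scaleC_left cinner_scaleC_right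
      scaleC_of_real[symmetric] scaleR_conv_of_real)

lemmas continuous_on_cinner [continuous_intros] =
  bounded_bilinear.continuous_on[OF bounded_bilinear_cinner]

lemma bounded_linear_scaleC: "bounded_linear (\<lambda>x::'a::complex_inner. c *\<^sub>C x)"
proof
  show "\<exists>K. \<forall>x::'a. norm (c *\<^sub>C x) \<le> norm x * K"
    by (intro exI[of _ "cmod c"]) (simp add: norm_scaleC)
  show "c *\<^sub>C (r *\<^sub>R x) = r *\<^sub>R (c *\<^sub>C x)" for r and x :: 'a
    by (simp add: scaleC_of_real[symmetric] scaleC_scaleC mult.commute)
qed (simp add: scaleC_add_right)

lemmas tendsto_scaleC [tendsto_intros] = bounded_linear.tendsto[OF bounded_linear_scaleC]

lemma parallelogram:
  "(norm (x + y))\<^sup>2 + (norm (x - y))\<^sup>2 = 2 * (norm x)\<^sup>2 + 2 * (norm (y::'a::complex_inner))\<^sup>2"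
  by (simp add: power2_norm_cinner cinner_add_left cinner_add_right cinner_diff_left cinner_diff_right)

text \<open>A distance depends only on the Gram matrix of the two vectors. This makes the assignment
  in \<open>isometric_extension\<close> well defined and isometric.\<close>

lemma norm_diff_eq_of_cinner:
  fixes x y :: "'a::complex_inner" and x' y' :: "'b::complex_inner"
  assumes "x \<bullet>\<^sub>C x = x' \<bullet>\<^sub>C x'" "x \<bullet>\<^sub>C y = x' \<bullet>\<^sub>C y'" "y \<bullet>\<^sub>C x = y' \<bullet>\<^sub>C x'" "y \<bullet>\<^sub>C y = y' \<bullet>\<^sub>C y'"
  shows "norm (x - y) = norm (x' - y')"
  using assms by (simp add: norm_eq_sqrt_cinner cinner_diff_left cinner_diff_right)

lemma cinner_eqI:
  assumes "\<And>z. z \<bullet>\<^sub>C x = z \<bullet>\<^sub>C (y::'a::complex_inner)"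
  shows "x = y"
proof -
  have "(x - y) \<bullet>\<^sub>C (x - y) = 0" using assms[of "x - y"] by (simp add: cinner_diff_right)
  thus ?thesis by simp
qed


section \<open>Closed subspaces and projections\<close>

lemma closed_csubspaceD:
  assumes "closed_csubspace S"
  shows "closed S" "0 \<in> S" "\<And>x y. x \<in> S \<Longrightarrow> y \<in> S \<Longrightarrow> x + y \<in> S"
    "\<And>c x. x \<in> S \<Longrightarrow> c *\<^sub>C x \<in> S" "\<And>x y. x \<in> S \<Longrightarrow> y \<in> S \<Longrightarrow> x - y \<in> S"
proof -
  show *: "closed S" "0 \<in> S" "\<And>x y. x \<in> S \<Longrightarrow> y \<in> S \<Longrightarrow> x + y \<in> S"
      "\<And>c x. x \<in> S \<Longrightarrow> c *\<^sub>C x \<in> S"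
    using assms by (auto simp: closed_csubspace_def)
  show "x - y \<in> S" if "x \<in> S" "y \<in> S" for x y
    using *(3)[OF that(1) *(4)[OF that(2), of "-1"]] by (simp add: scaleC_minus_one)
qed

lemma closed_csubspace_UNIV: "closed_csubspace UNIV"
  by (simp add: closed_csubspace_def)

lemma closed_csubspace_closure:
  fixes D :: "'a::complex_inner set"
  assumes "0 \<in> D" "\<And>x y. x \<in> D \<Longrightarrow> y \<in> D \<Longrightarrow> x + y \<in> D" "\<And>c x. x \<in> D \<Longrightarrow> c *\<^sub>C x \<in> D"
  shows "closed_csubspace (closure D)"
  unfolding closed_csubspace_def
proof (intro conjI ballI allI)
  show "0 \<in> closure D" using assms(1) closure_subset by blast
  fix x assume x: "x \<in> closure D"
  then obtain f where f: "\<And>n. f n \<in> D" "f \<longlonglongrightarrow> x" by (auto simp: closure_sequential)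
  show "x + y \<in> closure D" if "y \<in> closure D" for y
  proof -
    obtain g where g: "\<And>n. g n \<in> D" "g \<longlonglongrightarrow> y" using \<open>y \<in> closure D\<close> by (auto simp: closure_sequential)
    show ?thesis unfolding closure_sequential
      by (rule exI[of _ "\<lambda>n. f n + g n"]) (auto intro!: tendsto_intros assms f g)
  qed
  show "c *\<^sub>C x \<in> closure D" for c
    unfolding closure_sequential
    by (rule exI[of _ "\<lambda>n. c *\<^sub>C f n"]) (auto intro!: tendsto_intros assms f)
qed simp

lemma closed_csubspace_Inter:
  assumes "\<And>S. S \<in> \<S> \<Longrightarrow> closed_csubspace S"
  shows "closed_csubspace (\<Inter>\<S>)"
  using assms by (auto simp: closed_csubspace_def)

lemma orthogonal_projection:
  fixes S :: "'a::chilbert_space set"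
  assumes S: "closed_csubspace S"
  shows "\<exists>p\<in>S. \<forall>y\<in>S. y \<bullet>\<^sub>C (x - p) = 0"
proof -
  note Sd = closed_csubspaceD[OF S]
  define d where "d = infdist x S"
  have ne: "S \<noteq> {}" using Sd(2) by auto
  have d_le: "d \<le> norm (x - y)" if "y \<in> S" for y
    using infdist_le[OF that, of x] by (simp add: d_def dist_norm)
  have "\<exists>y\<in>S. norm (x - y) < d + 1 / real (Suc n)" for n
  proof (rule ccontr)
    assume "\<not> ?thesis"
    hence "d + 1 / real (Suc n) \<le> infdist x S"
      unfolding infdist_notempty[OF ne] using ne by (intro cINF_greatest) (auto simp: dist_norm not_less)
    thus False unfolding d_def by simp
  qed
  then obtain y where y: "\<And>n. y n \<in> S" "\<And>n. norm (x - y n) < d + 1 / real (Suc n)" by metis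
  have d0: "0 \<le> d" unfolding d_def by (rule infdist_nonneg)
  have lim: "(\<lambda>n. norm (x - y n)) \<longlonglongrightarrow> d"
  proof (rule tendsto_sandwich[where f = "\<lambda>_. d"])
    show "(\<lambda>n. d + 1 / real (Suc n)) \<longlonglongrightarrow> d"
      using tendsto_add[OF tendsto_const[of d] LIMSEQ_Suc[OF lim_1_over_n]] by simp
    show "\<forall>\<^sub>F n in sequentially. norm (x - y n) \<le> d + 1 / real (Suc n)"
      using y(2) by (intro always_eventually allI less_imp_le)
  qed (simp_all add: d_le y(1))
  have est: "(norm (y m - y n))\<^sup>2 \<le> 2 * (norm (x - y m))\<^sup>2 + 2 * (norm (x - y n))\<^sup>2 - 4 * d\<^sup>2" for m n
  proof -
    \<comment> \<open>The midpoint of two near-minimizers lies in \<open>S\<close>, so its distance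
      from \<open>x\<close> is at least \<open>d\<close>; fed into the parallelogram law this bounds
      the difference of the two.\<close>
    let ?h = "(1/2) *\<^sub>C (y m + y n)"
    have "?h \<in> S" by (intro Sd y)
    have "(x - y m) + (x - y n) = 2 *\<^sub>R (x - ?h)"
      using scaleC_of_real[of "1/2" "y m + y n"] by (simp add: algebra_simps scaleR_2)
    hence "(norm ((x - y m) + (x - y n)))\<^sup>2 = 4 * (norm (x - ?h))\<^sup>2"
      by (simp add: power_mult_distrib)
    also have "\<dots> \<ge> 4 * d\<^sup>2" using power_mono[OF d_le[OF \<open>?h \<in> S\<close>] d0, of 2] by simp
    finally show ?thesis
      using parallelogram[of "x - y m" "x - y n"] by (simp add: norm_minus_commute)
  qed
  have "Cauchy y"
  proof (rule metric_CauchyI)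
    fix e :: real assume "0 < e"
    have "(\<lambda>n. (norm (x - y n))\<^sup>2) \<longlonglongrightarrow> d\<^sup>2" by (intro tendsto_intros lim)
    \<comment> \<open>The slack e^2 / 4 is what \<open>est\<close> turns into e^2: twice 2 * (d^2 +
      e^2 / 4), minus 4 * d^2.\<close>
    from order_tendstoD(2)[OF this, of "d\<^sup>2 + e\<^sup>2 / 4"] \<open>0 < e\<close>
    obtain M where M: "\<And>n. n \<ge> M \<Longrightarrow> (norm (x - y n))\<^sup>2 < d\<^sup>2 + e\<^sup>2 / 4"
      by (auto simp: eventually_sequentially)
    have "dist (y m) (y n) < e" if "m \<ge> M" "n \<ge> M" for m n
    proof -
      have "(norm (y m - y n))\<^sup>2 < e\<^sup>2" using est[of m n] M[OF that(1)] M[OF that(2)] by linarith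
      thus ?thesis using \<open>0 < e\<close> power_less_imp_less_base by (fastforce simp: dist_norm)
    qed
    thus "\<exists>M. \<forall>m\<ge>M. \<forall>n\<ge>M. dist (y m) (y n) < e" by blast
  qed
  then obtain p where p: "y \<longlonglongrightarrow> p" by (auto simp: Cauchy_convergent_iff convergent_def)
  have pS: "p \<in> S" using closed_sequentially[OF Sd(1) y(1) p] .
  have np: "norm (x - p) = d"
    using LIMSEQ_unique[OF lim tendsto_norm[OF tendsto_diff[OF tendsto_const p]]] by simp
  have "z \<bullet>\<^sub>C (x - p) = 0" if z: "z \<in> S" for z
  proof (cases "z = 0")
    case False
    \<comment> \<open>With this coefficient \<open>p + c *\<^sub>C z\<close> is the point nearest to
      \<open>x\<close> on the complex line through \<open>p\<close> in direction \<open>z\<close>;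
      minimality of \<open>p\<close> then leaves no room for a nonzero inner product.\<close>
    define c where "c = (z \<bullet>\<^sub>C (x - p)) / (z \<bullet>\<^sub>C z)"
    have zz: "z \<bullet>\<^sub>C z \<noteq> 0" using False by simp
    let ?w = "z \<bullet>\<^sub>C (x - p)"
    have "p + c *\<^sub>C z \<in> S" by (intro Sd pS z)
    hence "(norm (x - p))\<^sup>2 \<le> (norm (x - p - c *\<^sub>C z))\<^sup>2"
      using d_le[of "p + c *\<^sub>C z"] d0 np by (intro power_mono) (simp_all add: algebra_simps)
    also have "(x - p - c *\<^sub>C z) \<bullet>\<^sub>C (x - p - c *\<^sub>C z)
        = (x - p) \<bullet>\<^sub>C (x - p) - ?w * ((x - p) \<bullet>\<^sub>C z) / (z \<bullet>\<^sub>C z)"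
      using zz unfolding c_def cinner_diff_left[of "x - p"] cinner_diff_right[of _ "x - p"]
      by (simp add: cinner_scaleC_left cinner_scaleC_right)
    hence "complex_of_real ((norm (x - p - c *\<^sub>C z))\<^sup>2)
        = complex_of_real ((norm (x - p))\<^sup>2 - (cmod ?w)\<^sup>2 / (norm z)\<^sup>2)"
      by (simp add: cinner_self cinner_commute[of "x - p" z] complex_norm_square[symmetric])
    hence "(norm (x - p - c *\<^sub>C z))\<^sup>2 = (norm (x - p))\<^sup>2 - (cmod ?w)\<^sup>2 / (norm z)\<^sup>2"
      by (simp only: of_real_eq_iff)
    finally have "(cmod ?w)\<^sup>2 / (norm z)\<^sup>2 \<le> 0" by simp
    thus ?thesis using False by (simp add: divide_le_0_iff)
  qed simp
  with pS show ?thesis by blast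
qed

text \<open>The test vector that decides membership is the residual itself: \<open>x - p\<close> is
  orthogonal to \<open>S\<close>, so its inner product with \<open>x - z\<close> is the squared norm
  of \<open>x - p\<close> for every \<open>z\<close> in \<open>S\<close>. This is how weak
  approximation becomes norm approximation.\<close>

lemma closed_csubspace_weak_limit:
  fixes S :: "'a::chilbert_space set"
  assumes S: "closed_csubspace S"
    and weak: "\<And>y \<epsilon>. 0 < \<epsilon> \<Longrightarrow> \<exists>z\<in>S. cmod (y \<bullet>\<^sub>C (x - z)) < \<epsilon>"
  shows "x \<in> S"
proof -
  obtain p where p: "p \<in> S" "\<And>y. y \<in> S \<Longrightarrow> y \<bullet>\<^sub>C (x - p) = 0"
    using orthogonal_projection[OF S, of x] by auto
  have "cmod ((x - p) \<bullet>\<^sub>C (x - p)) < \<epsilon>" if \<epsilon>: "0 < \<epsilon>" for \<epsilon>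
  proof -
    obtain z where z: "z \<in> S" "cmod ((x - p) \<bullet>\<^sub>C (x - z)) < \<epsilon>" using weak[OF \<epsilon>] by blast
    have "(z - p) \<bullet>\<^sub>C (x - p) = 0" using p z closed_csubspaceD(5)[OF S] by blast
    hence "(x - p) \<bullet>\<^sub>C (z - p) = 0" using cinner_commute[of "x - p" "z - p"] by simp
    hence "(x - p) \<bullet>\<^sub>C (x - p) = (x - p) \<bullet>\<^sub>C (x - z)" by (simp add: cinner_diff_right)
    thus ?thesis using z by simp
  qed
  hence "(x - p) \<bullet>\<^sub>C (x - p) = 0" by (metis less_irrefl zero_less_norm_iff)
  thus ?thesis using p(1) by simp
qed

text \<open>Adjoints depend on this: \<open>cadjoint_on\<close> is a definite description, and
  without a representing vector nothing would be known about \<open>cadj T y\<close>.\<close>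

lemma riesz_representation:
  fixes \<phi> :: "'a::chilbert_space \<Rightarrow> complex"
  assumes add: "\<And>x y. \<phi> (x + y) = \<phi> x + \<phi> y" and scale: "\<And>c x. \<phi> (c *\<^sub>C x) = c * \<phi> x"
    and bound: "\<And>x. cmod (\<phi> x) \<le> K * norm x"
  obtains y where "\<And>x. \<phi> x = y \<bullet>\<^sub>C x"
proof (cases "\<forall>x. \<phi> x = 0")
  case True thus thesis using that[of 0] by simp
next
  case False
  then obtain v where v: "\<phi> v \<noteq> 0" by blast
  have bl: "bounded_linear \<phi>"
  proof
    show "\<phi> (r *\<^sub>R x) = r *\<^sub>R \<phi> x" for r x
      by (simp add: scale scaleC_of_real[symmetric] scaleR_conv_of_real)
    show "\<exists>K. \<forall>x. norm (\<phi> x) \<le> norm x * K"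
      using bound by (intro exI[of _ K]) (simp add: mult.commute)
  qed (rule add)
  have diff: "\<phi> (x - y) = \<phi> x - \<phi> y" for x y
    using bounded_linear.linear[OF bl] by (rule linear_diff)
  let ?N = "{x. \<phi> x = 0}"
  have "closed_csubspace ?N"
    using scale[of 0 0] unfolding closed_csubspace_def
    by (auto simp: add scale intro!: closed_Collect_eq continuous_on_const
        linear_continuous_on bl)
  from orthogonal_projection[OF this, of v]
  obtain p where p: "\<phi> p = 0" "\<And>y. \<phi> y = 0 \<Longrightarrow> y \<bullet>\<^sub>C (v - p) = 0" by auto
  \<comment> \<open>\<open>w\<close> is orthogonal to the kernel, and every vector is a multiple of
    \<open>w\<close> modulo the kernel. The conjugate in the representing vector comes from
    antilinearity in the first argument.\<close>
  define w where "w = v - p"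
  have w: "\<phi> w = \<phi> v" by (simp add: w_def diff p)
  have ww: "w \<bullet>\<^sub>C w \<noteq> 0" using w v scale[of 0 0] by auto
  have "\<phi> x = (cnj (\<phi> w / (w \<bullet>\<^sub>C w)) *\<^sub>C w) \<bullet>\<^sub>C x" for x
  proof -
    have "\<phi> (x - (\<phi> x / \<phi> w) *\<^sub>C w) = 0" using v w by (simp add: diff scale)
    from p(2)[OF this] have "w \<bullet>\<^sub>C (x - (\<phi> x / \<phi> w) *\<^sub>C w) = 0"
      by (metis w_def cinner_commute complex_cnj_zero_iff)
    thus ?thesis using ww v w by (simp add: cinner_diff_right cinner_scaleC_right cinner_scaleC_left)
  qed
  thus thesis using that by blast
qed


section \<open>Operators\<close>

lemma clinear_onD:
  assumes "clinear_on S T"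
  shows "\<And>x y. x \<in> S \<Longrightarrow> y \<in> S \<Longrightarrow> T (x + y) = T x + T y"
    and "\<And>c x. x \<in> S \<Longrightarrow> T (c *\<^sub>C x) = c *\<^sub>C T x"
  using assms by (auto simp: clinear_on_def)

lemma clinear_on_diff:
  assumes "clinear_on S T" "closed_csubspace S" "x \<in> S" "y \<in> S"
  shows "T (x - y) = T x - T y"
  using clinear_onD(1)[OF assms(1) closed_csubspaceD(5)[OF assms(2,3,4)] assms(4)] by simp

lemma clinear_on_zero:
  assumes "clinear_on S T" "closed_csubspace S"
  shows "T 0 = 0"
  using clinear_on_diff[OF assms closed_csubspaceD(2,2)[OF assms(2)]] by simp

lemma clinear_on_bounded_imp_continuous_on:
  fixes T :: "'a::complex_inner \<Rightarrow> 'b::complex_inner"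
  assumes T: "clinear_on S T" and S: "closed_csubspace S" and K: "\<And>x. x \<in> S \<Longrightarrow> norm (T x) \<le> K * norm x"
  shows "continuous_on S T"
proof -
  \<comment> \<open>A Lipschitz constant must be nonnegative, while \<open>K\<close> can be negative
    when \<open>S\<close> is trivial.\<close>
  have "(max K 0)-lipschitz_on S T"
  proof (rule lipschitz_onI)
    fix x y assume xy: "x \<in> S" "y \<in> S"
    have "norm (T x - T y) = norm (T (x - y))" by (simp add: clinear_on_diff[OF T S xy])
    also have "\<dots> \<le> K * norm (x - y)" using closed_csubspaceD(5)[OF S xy] by (rule K)
    also have "\<dots> \<le> max K 0 * norm (x - y)" by (intro mult_right_mono) auto
    finally show "dist (T x) (T y) \<le> max K 0 * dist x y" by (simp add: dist_norm)
  qed simp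
  thus ?thesis by (rule lipschitz_on_continuous_on)
qed

lemma bop_onD:
  assumes "T \<in> bop_on S"
  shows "\<And>x. x \<in> S \<Longrightarrow> T x \<in> S" "clinear_on S T" "\<exists>K. \<forall>x\<in>S. norm (T x) \<le> K * norm x"
  using assms by (auto simp: bop_on_def)

lemma bop_on_continuous_on: "T \<in> bop_on S \<Longrightarrow> closed_csubspace S \<Longrightarrow> continuous_on S T"
  using clinear_on_bounded_imp_continuous_on bop_onD(2,3) by metis

lemma continuous_on_closure_eqI:
  fixes f g :: "'a::topological_space \<Rightarrow> 'b::real_normed_vector"
  assumes "continuous_on (closure D) f" "continuous_on (closure D) g"
    and "\<And>x. x \<in> D \<Longrightarrow> f x = g x" and "x \<in> closure D"
  shows "f x = g x"
  using continuous_constant_on_closure[of D "\<lambda>x. f x - g x" 0 x] assms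
  by (simp add: continuous_on_diff)

lemma bop_on_eqI:
  assumes S: "closed_csubspace (closure D)" and "T \<in> bop_on (closure D)" "T' \<in> bop_on (closure D)"
    and eq: "\<And>x. x \<in> D \<Longrightarrow> T x = T' x" and x: "x \<in> closure D"
  shows "T x = T' x"
  by (rule continuous_on_closure_eqI[OF bop_on_continuous_on[OF assms(2) S]
        bop_on_continuous_on[OF assms(3) S] eq x])

lemma bop_UNIV_bounded_linear:
  assumes "T \<in> bop_on (UNIV :: 'a::complex_inner set)"
  shows "bounded_linear T"
proof
  show "T (x + y) = T x + T y" for x y using assms by (simp add: bop_on_def clinear_on_def)
  show "T (r *\<^sub>R x) = r *\<^sub>R T x" for r x
    using assms by (simp add: bop_on_def clinear_on_def scaleC_of_real[symmetric])
  show "\<exists>K. \<forall>x. norm (T x) \<le> norm x * K"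
    using bop_onD(3)[OF assms] by (auto simp: mult.commute)
qed

lemma bop_UNIVI:
  assumes "\<And>x y. T (x + y) = T x + T y" "\<And>c x. T (c *\<^sub>C x) = c *\<^sub>C T x"
    and "\<And>x. norm (T x) \<le> K * norm x"
  shows "T \<in> bop_on (UNIV :: 'a::complex_inner set)"
  using assms by (auto simp: bop_on_def clinear_on_def)

lemma bop_UNIV_add: "T \<in> bop_on UNIV \<Longrightarrow> T (x + y) = T x + T y"
  and bop_UNIV_scale: "T \<in> bop_on UNIV \<Longrightarrow> T (c *\<^sub>C x) = c *\<^sub>C T x"
  by (simp_all add: bop_on_def clinear_on_def)

lemma bop_UNIV_zero: "T \<in> bop_on UNIV \<Longrightarrow> T 0 = 0"
  using bop_UNIV_scale[of T 0 0] by simp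

lemma bop_UNIV_diff: "T \<in> bop_on UNIV \<Longrightarrow> T (x - y) = T x - T y"
  using bop_UNIV_add[of T "x - y" y] by simp

lemma bop_UNIV_comp:
  assumes "S \<in> bop_on UNIV" "T \<in> bop_on (UNIV :: 'a::complex_inner set)"
  shows "S \<circ> T \<in> bop_on UNIV"
proof -
  obtain K where K: "\<And>x. norm (S x) \<le> K * norm x" using bop_onD(3)[OF assms(1)] by auto
  obtain L where L: "\<And>x. norm (T x) \<le> L * norm x" using bop_onD(3)[OF assms(2)] by auto
  have "norm ((S \<circ> T) x) \<le> (\<bar>K\<bar> * L) * norm x" for x
  proof -
    have "norm (S (T x)) \<le> \<bar>K\<bar> * norm (T x)"
      using K[of "T x"] by (meson abs_ge_self mult_right_mono norm_ge_zero order_trans)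
    also have "\<dots> \<le> \<bar>K\<bar> * (L * norm x)" using L by (intro mult_left_mono) auto
    finally show ?thesis by (simp add: mult.assoc)
  qed
  thus ?thesis using assms by (intro bop_UNIVI) (simp_all add: bop_UNIV_add bop_UNIV_scale)
qed

lemma cadjoint_on_eqI:
  assumes "x \<in> S" "\<And>z. z \<in> S \<Longrightarrow> z \<bullet>\<^sub>C x = T z \<bullet>\<^sub>C y" and S: "closed_csubspace S"
  shows "cadjoint_on S T y = x"
  unfolding cadjoint_on_def
proof (rule the_equality)
  fix x' assume x': "x' \<in> S \<and> (\<forall>z\<in>S. z \<bullet>\<^sub>C x' = T z \<bullet>\<^sub>C y)"
  have "x' - x \<in> S" using x' assms(1) closed_csubspaceD(5)[OF S] by blast
  hence "(x' - x) \<bullet>\<^sub>C (x' - x) = 0" using x' assms(2) by (simp add: cinner_diff_right)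
  thus "x' = x" by simp
qed (use assms in blast)

lemma cinner_cadj:
  fixes T :: "'a::chilbert_space \<Rightarrow> 'a"
  assumes T: "T \<in> bop_on UNIV"
  shows "z \<bullet>\<^sub>C cadj T y = T z \<bullet>\<^sub>C y"
proof -
  obtain K where K: "\<And>x. norm (T x) \<le> K * norm x" using bop_onD(3)[OF T] by auto
  obtain x where x: "\<And>z. y \<bullet>\<^sub>C T z = x \<bullet>\<^sub>C z"
  proof (rule riesz_representation[of "\<lambda>z. y \<bullet>\<^sub>C T z" "norm y * K"])
    show "cmod (y \<bullet>\<^sub>C T z) \<le> norm y * K * norm z" for z
      using order_trans[OF cinner_cauchy_schwarz mult_left_mono[OF K[of z] norm_ge_zero]]
      by (simp add: mult.assoc)
  qed (simp_all add: bop_UNIV_add[OF T] bop_UNIV_scale[OF T] cinner_add_right cinner_scaleC_right)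
  have "z \<bullet>\<^sub>C x = T z \<bullet>\<^sub>C y" for z using x[of z] by (metis cinner_commute)
  hence "cadj T y = x" by (intro cadjoint_on_eqI closed_csubspace_UNIV) auto
  with \<open>\<And>z. z \<bullet>\<^sub>C x = T z \<bullet>\<^sub>C y\<close> show ?thesis by simp
qed

lemma cinner_cadj_left:
  fixes T :: "'a::chilbert_space \<Rightarrow> 'a"
  assumes T: "T \<in> bop_on UNIV"
  shows "cadj T y \<bullet>\<^sub>C z = y \<bullet>\<^sub>C T z"
  by (metis cinner_cadj[OF T] cinner_commute)

lemma cadj_eqI:
  fixes T :: "'a::chilbert_space \<Rightarrow> 'a"
  assumes "\<And>z y. z \<bullet>\<^sub>C T' y = T z \<bullet>\<^sub>C y"
  shows "cadj T = T'"
  by (rule ext, rule cadjoint_on_eqI) (simp_all add: assms closed_csubspace_UNIV)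

text \<open>Formulated with an explicit bound \<open>K\<close> instead of \<open>onorm\<close>, so
  that the scale-independent bound \<open>sc_norm\<close> can be passed through it. The squared norm
  of \<open>cadj T y\<close> is an inner product of \<open>T (cadj T y)\<close> with
  \<open>y\<close>; Cauchy-Schwarz and cancelling one factor do the rest.\<close>

lemma norm_cadj_le:
  fixes T :: "'a::chilbert_space \<Rightarrow> 'a"
  assumes T: "T \<in> bop_on UNIV" and K: "\<And>x. norm (T x) \<le> K * norm x"
  shows "norm (cadj T y) \<le> K * norm y"
proof (cases "cadj T y = 0")
  case True
  have "0 \<le> K * norm y" using order_trans[OF norm_ge_zero K] .
  thus ?thesis using True by simp
next
  case False
  have "complex_of_real ((norm (cadj T y))\<^sup>2) = T (cadj T y) \<bullet>\<^sub>C y"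
    by (simp only: cinner_self[symmetric] cinner_cadj[OF T])
  hence "(norm (cadj T y))\<^sup>2 = cmod (T (cadj T y) \<bullet>\<^sub>C y)"
    by (metis norm_of_real abs_of_nonneg zero_le_power2)
  also have "\<dots> \<le> norm (T (cadj T y)) * norm y" by (rule cinner_cauchy_schwarz)
  also have "\<dots> \<le> (K * norm (cadj T y)) * norm y" by (intro mult_right_mono K) simp
  finally have "norm (cadj T y) * norm (cadj T y) \<le> norm (cadj T y) * (K * norm y)"
    by (simp add: power2_eq_square ac_simps)
  thus ?thesis using False by (simp add: mult_le_cancel_left)
qed

lemma bop_UNIV_cadj:
  fixes T :: "'a::chilbert_space \<Rightarrow> 'a"
  assumes T: "T \<in> bop_on UNIV"
  shows "cadj T \<in> bop_on UNIV"
proof -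
  obtain K where K: "\<And>x. norm (T x) \<le> K * norm x" using bop_onD(3)[OF T] by auto
  show ?thesis
  proof (rule bop_UNIVI)
    show "norm (cadj T y) \<le> K * norm y" for y by (rule norm_cadj_le[OF T K])
    show "cadj T (x + y) = cadj T x + cadj T y" for x y
      by (rule cinner_eqI) (simp add: cinner_cadj[OF T] cinner_add_right)
    show "cadj T (c *\<^sub>C x) = c *\<^sub>C cadj T x" for c x
      by (rule cinner_eqI) (simp add: cinner_cadj[OF T] cinner_scaleC_right)
  qed
qed

lemma cadj_diff:
  fixes S T :: "'a::chilbert_space \<Rightarrow> 'a"
  assumes "S \<in> bop_on UNIV" "T \<in> bop_on UNIV"
  shows "cadj (S - T) = cadj S - cadj T"
  by (rule cadj_eqI) (simp add: cinner_cadj assms cinner_diff_left cinner_diff_right)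

lemma cadj_comp:
  fixes S T :: "'a::chilbert_space \<Rightarrow> 'a"
  assumes "S \<in> bop_on UNIV" "T \<in> bop_on UNIV"
  shows "cadj (S \<circ> T) = cadj T \<circ> cadj S"
  by (rule cadj_eqI) (simp add: cinner_cadj assms)

lemma cadj_cadj:
  fixes T :: "'a::chilbert_space \<Rightarrow> 'a"
  assumes T: "T \<in> bop_on UNIV"
  shows "cadj (cadj T) = T"
  by (rule cadj_eqI) (simp add: cinner_cadj_left[OF T])

lemma cadj_zero: "cadj (0 :: 'a::chilbert_space \<Rightarrow> 'a) = 0"
  by (rule cadj_eqI) simp

section \<open>Unitary operators and conjugation by them\<close>

lemma unitary_UNIV_bop:
  assumes "unitary_between UNIV UNIV (V :: 'a::complex_inner \<Rightarrow> 'a)"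
  shows "V \<in> bop_on UNIV" "norm (V x) = norm x"
proof -
  show n: "norm (V x) = norm x" for x
    using assms by (simp add: unitary_between_def norm_eq_sqrt_cinner)
  show "V \<in> bop_on UNIV"
    using assms n by (auto simp: bop_on_def unitary_between_def intro!: exI[of _ 1])
qed

lemma unitary_UNIV_cadj:
  fixes V :: "'a::chilbert_space \<Rightarrow> 'a"
  assumes V: "unitary_between UNIV UNIV V"
  shows "V (cadj V x) = x" "cadj V (V x) = x" "norm (cadj V x) = norm x"
proof -
  show *: "cadj V (V x) = x" for x
    using V by (intro cadjoint_on_eqI closed_csubspace_UNIV) (auto simp: unitary_between_def)
  show **: "V (cadj V x) = x" for x
  proof -
    have "surj V" using V by (simp add: unitary_between_def)
    then obtain y where "x = V y" by (rule surjE)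
    thus ?thesis by (simp add: *)
  qed
  show "norm (cadj V x) = norm x" by (metis ** unitary_UNIV_bop(2)[OF V])
qed

lemma cadjoint_on_unitary:
  assumes "unitary_between S S' V" "closed_csubspace S" "x \<in> S"
  shows "cadjoint_on S V (V x) = x"
  using assms by (intro cadjoint_on_eqI) (auto simp: unitary_between_def)

lemma ad_bop:
  fixes V :: "'a::chilbert_space \<Rightarrow> 'a"
  assumes "V \<in> bop_on UNIV" "T \<in> bop_on UNIV"
  shows "ad V T \<in> bop_on UNIV"
  unfolding ad_def by (intro bop_UNIV_comp bop_UNIV_cadj assms)

lemma norm_ad_le:
  fixes V :: "'a::chilbert_space \<Rightarrow> 'a"
  assumes V: "unitary_between UNIV UNIV V" and K: "\<And>x. norm (T x) \<le> K * norm x"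
  shows "norm (ad V T x) \<le> K * norm x"
  using K[of "cadj V x"] by (simp add: ad_def unitary_UNIV_bop[OF V] unitary_UNIV_cadj[OF V])

lemma ad_comp:
  fixes V :: "'a::chilbert_space \<Rightarrow> 'a"
  assumes V: "unitary_between UNIV UNIV V"
  shows "ad V S \<circ> ad V T = ad V (S \<circ> T)"
  by (auto simp: ad_def unitary_UNIV_cadj[OF V])

lemma ad_diff:
  fixes V :: "'a::chilbert_space \<Rightarrow> 'a"
  assumes V: "V \<in> bop_on UNIV"
  shows "ad V (S - T) = ad V S - ad V T"
  by (rule ext) (simp add: ad_def bop_UNIV_diff[OF V])

lemma ad_cadj:
  fixes V :: "'a::chilbert_space \<Rightarrow> 'a"
  assumes V: "V \<in> bop_on UNIV" and T: "T \<in> bop_on UNIV"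
  shows "ad V (cadj T) = cadj (ad V T)"
  unfolding ad_def
  by (simp add: cadj_comp bop_UNIV_comp bop_UNIV_cadj cadj_cadj V T comp_assoc)

text \<open>The definition of a von Neumann algebra lists only the adjoint and the bicommutant
  property, so scalars, products and differences all have to be drawn from the latter. Scalars lie
  in every bicommutant because a commutant consists of complex linear operators.\<close>

lemma von_neumann_algebra_scalar: "von_neumann_algebra M \<Longrightarrow> (\<lambda>x. c *\<^sub>C x) \<in> M"
proof -
  assume M: "von_neumann_algebra M"
  have "(\<lambda>x. c *\<^sub>C x) \<in> commutant_on UNIV (commutant_on UNIV M)"
    unfolding commutant_on_def
    by (auto simp: bop_UNIV_scale intro!: bop_UNIVI[where K = "cmod c"])
      (simp_all add: scaleC_add_right norm_scaleC scaleC_scaleC mult.commute)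
  thus ?thesis using M by (simp add: von_neumann_algebra_def)
qed

lemma von_neumann_algebra_bop: "von_neumann_algebra M \<Longrightarrow> T \<in> M \<Longrightarrow> T \<in> bop_on UNIV"
  by (auto simp: von_neumann_algebra_def)

lemma von_neumann_algebra_comp:
  assumes M: "von_neumann_algebra M" and "S \<in> M" "T \<in> M"
  shows "S \<circ> T \<in> M"
proof -
  have eq: "commutant_on UNIV (commutant_on UNIV M) = M"
    using M by (simp add: von_neumann_algebra_def)
  have "S \<in> commutant_on UNIV (commutant_on UNIV M)" "T \<in> commutant_on UNIV (commutant_on UNIV M)"
    using assms(2,3) by (simp_all only: eq)
  \<comment> \<open>Only the outer commutant is unfolded; the inner one stays opaque, as the set
    with which the product has to commute.\<close>
  hence "S \<circ> T \<in> commutant_on UNIV (commutant_on UNIV M)"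
    unfolding commutant_on_def[of UNIV "commutant_on UNIV M"] by (simp add: bop_UNIV_comp)
  thus ?thesis unfolding eq .
qed

lemma von_neumann_algebra_cadj: "von_neumann_algebra M \<Longrightarrow> T \<in> M \<Longrightarrow> cadj T \<in> M"
  by (auto simp: von_neumann_algebra_def)

lemma von_neumann_algebra_diff:
  assumes M: "von_neumann_algebra M" and "S \<in> M" "T \<in> M"
  shows "S - T \<in> M"
proof -
  have eq: "commutant_on UNIV (commutant_on UNIV M) = M"
    using M by (simp add: von_neumann_algebra_def)
  have ST: "S \<in> commutant_on UNIV (commutant_on UNIV M)" "T \<in> commutant_on UNIV (commutant_on UNIV M)"
    using assms(2,3) by (simp_all only: eq)
  have b: "bounded_linear S" "bounded_linear T"
    using assms von_neumann_algebra_bop bop_UNIV_bounded_linear by blast+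
  have "S - T \<in> bop_on UNIV"
  proof (rule bop_UNIVI)
    show "norm ((S - T) x) \<le> onorm (\<lambda>x. S x - T x) * norm x" for x
      using onorm[OF bounded_linear_sub[OF b], of x] by simp
  qed (use assms in \<open>simp_all add: von_neumann_algebra_bop[OF M] bop_UNIV_add bop_UNIV_scale
        scaleC_diff_right\<close>)
  hence "S - T \<in> commutant_on UNIV (commutant_on UNIV M)"
    using ST unfolding commutant_on_def[of UNIV "commutant_on UNIV M"]
    by (auto simp: commutant_on_def[of UNIV M] bop_UNIV_diff)
  thus ?thesis unfolding eq .
qed


section \<open>Extension of inner product preserving maps\<close>

text \<open>The vectors are indexed because different algebra elements may give the same vector;
  equal Gram matrices make the assignment from \<open>v i\<close> to \<open>w i\<close> a
  well-defined isometry all the same. Linearity comes afterwards: the squared norm of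
  \<open>T (x + y) - (T x + T y)\<close> expands into inner products, all of which \<open>T\<close>
  preserves.\<close>

lemma isometric_extension:
  fixes v w :: "'i \<Rightarrow> 'a::chilbert_space"
  assumes S: "closed_csubspace S" and dense: "closure (v ` I) = S" and w: "\<And>i. i \<in> I \<Longrightarrow> w i \<in> S"
    and iso: "\<And>i j. i \<in> I \<Longrightarrow> j \<in> I \<Longrightarrow> w i \<bullet>\<^sub>C w j = v i \<bullet>\<^sub>C v j"
  shows "\<exists>T. T ` S \<subseteq> S \<and> clinear_on S T \<and> (\<forall>x\<in>S. \<forall>y\<in>S. T x \<bullet>\<^sub>C T y = x \<bullet>\<^sub>C y) \<and>
    (\<forall>i\<in>I. T (v i) = w i)"
proof -
  have dist: "norm (w i - w j) = norm (v i - v j)" if "i \<in> I" "j \<in> I" for i j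
    using that by (intro norm_diff_eq_of_cinner iso)
  define f where "f x = w (SOME i. i \<in> I \<and> v i = x)" for x
  have f: "f (v i) = w i" if "i \<in> I" for i
  proof -
    \<comment> \<open>The chosen index need not be \<open>i\<close>, but it carries the same vector,
      so \<open>dist\<close> forces the same image.\<close>
    have "(SOME j. j \<in> I \<and> v j = v i) \<in> I \<and> v (SOME j. j \<in> I \<and> v j = v i) = v i"
      using that by (intro someI[of "\<lambda>j. j \<in> I \<and> v j = v i"]) simp
    from dist[OF conjunct1[OF this] that] conjunct2[OF this] show ?thesis by (simp add: f_def)
  qed
  have "uniformly_continuous_on (v ` I) f"
    unfolding uniformly_continuous_on_def
    by (auto simp: f dist_norm dist intro!: exI)
  then obtain T where T: "uniformly_continuous_on (closure (v ` I)) T" "\<And>x. x \<in> v ` I \<Longrightarrow> f x = T x"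
    by (rule uniformly_continuous_on_extension_on_closure) auto
  have cT: "continuous_on S T" using T(1) dense by (simp add: uniformly_continuous_imp_continuous)
  have Tv: "T (v i) = w i" if "i \<in> I" for i using T(2)[of "v i"] f[OF that] that by simp
  have "T ` v ` I \<subseteq> S" using Tv w by auto
  hence TS: "T ` S \<subseteq> S"
    using image_closure_subset[of "v ` I" T S] cT closed_csubspaceD(1)[OF S] by (simp add: dense)
  \<comment> \<open>Preservation of inner products is continued to the closure in one argument at a
    time, first the right one, then the left one.\<close>
  have ip1: "T (v i) \<bullet>\<^sub>C T y = v i \<bullet>\<^sub>C y" if "i \<in> I" "y \<in> S" for i y
    by (rule continuous_on_closure_eqI[of "v ` I" "\<lambda>y. T (v i) \<bullet>\<^sub>C T y" "\<lambda>y. v i \<bullet>\<^sub>C y"])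
      (use that in \<open>auto simp: dense Tv iso intro!: continuous_intros cT\<close>)
  have ip: "T x \<bullet>\<^sub>C T y = x \<bullet>\<^sub>C y" if "x \<in> S" "y \<in> S" for x y
    by (rule continuous_on_closure_eqI[of "v ` I" "\<lambda>x. T x \<bullet>\<^sub>C T y" "\<lambda>x. x \<bullet>\<^sub>C y"])
      (use that in \<open>auto simp: dense ip1 intro!: continuous_intros cT\<close>)
  have "clinear_on S T"
    unfolding clinear_on_def
  proof (intro conjI ballI allI)
    note Sd = closed_csubspaceD[OF S]
    fix x assume x: "x \<in> S"
    show "T (x + y) = T x + T y" if y: "y \<in> S" for y
    proof -
      have "(T (x + y) - (T x + T y)) \<bullet>\<^sub>C (T (x + y) - (T x + T y)) = 0"
        using x y Sd(3)[OF x y]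
        by (simp add: cinner_diff_left cinner_diff_right cinner_add_left cinner_add_right ip)
      thus ?thesis by simp
    qed
    show "T (c *\<^sub>C x) = c *\<^sub>C T x" for c
    proof -
      have "(T (c *\<^sub>C x) - c *\<^sub>C T x) \<bullet>\<^sub>C (T (c *\<^sub>C x) - c *\<^sub>C T x) = 0"
        using x Sd(4)[OF x, of c]
        by (simp add: cinner_diff_left cinner_diff_right cinner_scaleC_left cinner_scaleC_right ip)
      thus ?thesis by simp
    qed
  qed
  with TS ip Tv show ?thesis by blast
qed


section \<open>Tensor products\<close>

lemma tensor_ell2_add_left: "(x + x') \<otimes>\<^sub>2 y = x \<otimes>\<^sub>2 y + x' \<otimes>\<^sub>2 y"
  by transfer (auto simp: distrib_right)

lemma tensor_ell2_add_right: "x \<otimes>\<^sub>2 (y + y') = x \<otimes>\<^sub>2 y + x \<otimes>\<^sub>2 y'"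
  by transfer (auto simp: distrib_left)

lemma tensor_ell2_scaleR_left: "(r *\<^sub>R x) \<otimes>\<^sub>2 y = r *\<^sub>R (x \<otimes>\<^sub>2 y)"
  unfolding scaleR_ell2_def by transfer (auto simp: mult.assoc)

lemma tensor_ell2_scaleR_right: "x \<otimes>\<^sub>2 (r *\<^sub>R y) = r *\<^sub>R (x \<otimes>\<^sub>2 y)"
  unfolding scaleR_ell2_def by transfer (auto simp: mult.left_commute)

lemma norm_tensor_ell2: "norm (x \<otimes>\<^sub>2 y) = norm x * norm y"
proof transfer
  fix f :: "'a \<Rightarrow> complex" and g :: "'b \<Rightarrow> complex"
  assume f: "(\<lambda>x. (cmod (f x))\<^sup>2) summable_on UNIV" and g: "(\<lambda>x. (cmod (g x))\<^sup>2) summable_on UNIV"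
  have sm: "(\<lambda>(x, y). (cmod (f x))\<^sup>2 * (cmod (g y))\<^sup>2) summable_on UNIV \<times> UNIV"
    by (rule summable_on_SigmaI[where g = "\<lambda>x. (cmod (f x))\<^sup>2 * (\<Sum>\<^sub>\<infinity>y. (cmod (g y))\<^sup>2)"])
      (auto intro!: has_sum_cmult_right has_sum_infsum summable_on_cmult_left f g)
  have "((\<lambda>(x, y). (cmod (f x))\<^sup>2 * (cmod (g y))\<^sup>2) has_sum
      (\<Sum>\<^sub>\<infinity>x. (cmod (f x))\<^sup>2) * (\<Sum>\<^sub>\<infinity>x. (cmod (g x))\<^sup>2)) (UNIV \<times> UNIV)"
    by (rule has_sum_SigmaI[where g = "\<lambda>x. (cmod (f x))\<^sup>2 * (\<Sum>\<^sub>\<infinity>y. (cmod (g y))\<^sup>2)"])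
      (auto intro!: has_sum_cmult_right has_sum_cmult_left has_sum_infsum f g sm
        simp del: UNIV_Times_UNIV)
  moreover have "(cmod (case p of (x, y) \<Rightarrow> f x * g y))\<^sup>2 = (case p of (x, y) \<Rightarrow> (cmod (f x))\<^sup>2 * (cmod (g y))\<^sup>2)" for p
    by (cases p) (simp add: norm_mult power_mult_distrib)
  ultimately have "(\<Sum>\<^sub>\<infinity>p. (cmod (case p of (x, y) \<Rightarrow> f x * g y))\<^sup>2)
      = (\<Sum>\<^sub>\<infinity>x. (cmod (f x))\<^sup>2) * (\<Sum>\<^sub>\<infinity>x. (cmod (g x))\<^sup>2)"
    by (simp add: infsumI)
  thus "sqrt (\<Sum>\<^sub>\<infinity>p. (cmod (case p of (x, y) \<Rightarrow> f x * g y))\<^sup>2)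
      = sqrt (\<Sum>\<^sub>\<infinity>x. (cmod (f x))\<^sup>2) * sqrt (\<Sum>\<^sub>\<infinity>x. (cmod (g x))\<^sup>2)"
    by (simp add: real_sqrt_mult)
qed

lemma bounded_bilinear_tensor_ell2: "bounded_bilinear (\<lambda>x y. x \<otimes>\<^sub>2 y)"
proof
  show "\<exists>K. \<forall>a b. norm (a \<otimes>\<^sub>2 b) \<le> norm a * norm b * K"
    by (intro exI[of _ 1]) (simp add: norm_tensor_ell2)
qed (rule tensor_ell2_add_left tensor_ell2_add_right tensor_ell2_scaleR_left tensor_ell2_scaleR_right)+

lemmas continuous_on_tensor_ell2 [continuous_intros] =
  bounded_bilinear.continuous_on[OF bounded_bilinear_tensor_ell2]

lemma closed_csubspace_tensor_space: "closed_csubspace (tensor_space S S')"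
  unfolding tensor_space_def by (rule hull_in) (blast intro: closed_csubspace_Inter)

lemma tensor_in_tensor_space: "x \<in> S \<Longrightarrow> y \<in> S' \<Longrightarrow> x \<otimes>\<^sub>2 y \<in> tensor_space S S'"
  unfolding tensor_space_def by (rule hull_subset[THEN subsetD]) blast

text \<open>The vectors on which both operators agree form a closed subspace containing the
  elementary tensors, hence the whole hull; no expansion into sums of tensors is involved.\<close>

lemma bop_on_tensor_space_eqI:
  assumes R: "R \<in> bop_on (tensor_space S S')" and R': "R' \<in> bop_on (tensor_space S S')"
    and eq: "\<And>x y. x \<in> S \<Longrightarrow> y \<in> S' \<Longrightarrow> R (x \<otimes>\<^sub>2 y) = R' (x \<otimes>\<^sub>2 y)"
    and z: "z \<in> tensor_space S S'"
  shows "R z = R' z"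
proof -
  let ?T = "tensor_space S S'" and ?E = "{z \<in> tensor_space S S'. R z = R' z}"
  note T = closed_csubspace_tensor_space[of S S']
  have "closed ?E"
  proof -
    have "continuous_on ?T (\<lambda>z. R z - R' z)"
      by (intro continuous_intros bop_on_continuous_on R R' T)
    from continuous_closed_preimage[OF this closed_csubspaceD(1)[OF T] closed_singleton[of 0]]
    show ?thesis by (simp add: vimage_def Int_def)
  qed
  hence "closed_csubspace ?E"
    using closed_csubspaceD[OF T] clinear_onD[OF bop_onD(2)[OF R]] clinear_onD[OF bop_onD(2)[OF R']]
      clinear_on_zero[OF bop_onD(2)[OF R] T] clinear_on_zero[OF bop_onD(2)[OF R'] T]
    by (auto simp: closed_csubspace_def)
  moreover have "{x \<otimes>\<^sub>2 y |x y. x \<in> S \<and> y \<in> S'} \<subseteq> ?E" using eq tensor_in_tensor_space by auto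
  ultimately have "?T \<subseteq> ?E" unfolding tensor_space_def[of S S'] by (intro hull_minimal) auto
  thus ?thesis using z by blast
qed

text \<open>\<open>tensor_op\<close> is a definite description, so it can be evaluated only with the
  help of an operator already known to have the right values on elementary tensors. Cutting
  \<open>R\<close> off to 0 outside \<open>tensor_space\<close> turns it into the unique operator
  described.\<close>

lemma tensor_op_eqI:
  assumes R: "R \<in> bop_on (tensor_space S S')"
    and eq: "\<And>x y. x \<in> S \<Longrightarrow> y \<in> S' \<Longrightarrow> R (x \<otimes>\<^sub>2 y) = T x \<otimes>\<^sub>2 T' y"
    and z: "z \<in> tensor_space S S'"
  shows "tensor_op S S' T T' z = R z"
proof -
  define R0 where "R0 z = (if z \<in> tensor_space S S' then R z else 0)" for z
  have R0: "R0 \<in> bop_on (tensor_space S S')"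
    using R closed_csubspaceD[OF closed_csubspace_tensor_space[of S S']]
    by (auto simp: bop_on_def clinear_on_def R0_def)
  have "tensor_op S S' T T' = R0"
    unfolding tensor_op_def
  proof (rule the_equality)
    fix R' assume R': "R' \<in> bop_on (tensor_space S S') \<and>
     (\<forall>z. z \<notin> tensor_space S S' \<longrightarrow> R' z = 0) \<and> (\<forall>x\<in>S. \<forall>y\<in>S'. R' (x \<otimes>\<^sub>2 y) = T x \<otimes>\<^sub>2 T' y)"
    show "R' = R0"
    proof
      fix z show "R' z = R0 z"
      proof (cases "z \<in> tensor_space S S'")
        case True
        have "R' (x \<otimes>\<^sub>2 y) = R0 (x \<otimes>\<^sub>2 y)" if "x \<in> S" "y \<in> S'" for x y
          using R' eq[OF that] tensor_in_tensor_space[OF that] that by (simp add: R0_def)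
        from bop_on_tensor_space_eqI[OF conjunct1[OF R'] R0 this True] show ?thesis .
      qed (use R' in \<open>simp add: R0_def\<close>)
    qed
  qed (use R0 eq in \<open>auto simp: R0_def tensor_in_tensor_space\<close>)
  thus ?thesis using z by (simp add: R0_def)
qed


section \<open>The Lorentz group and the extended symmetry group\<close>

lemma mink_form_commute: "mink_form x y = mink_form y x"
  by (simp add: mink_form_def mult.commute)

lemma mink_form_axis_None: "mink_form (axis None 1) y = y $ None"
  by (simp add: mink_form_def axis_def)

lemma matrix_vector_axis_None: "(\<Lambda> *v axis None 1) $ None = \<Lambda> $ None $ None"
  for \<Lambda> :: "real ^ 's::finite option ^ 's option"
  by (simp add: matrix_vector_mul_component inner_axis)

text \<open>The reversed Cauchy-Schwarz inequality in the forward cone: each time component exceeds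
  the Euclidean norm of its space part, so the product of the times beats the ordinary
  Cauchy-Schwarz bound for the space parts.\<close>

lemma mink_form_pos_of_timelike:
  assumes "mink_form x x > 0" "x $ None > 0" "mink_form y y > 0" "y $ None > 0"
  shows "mink_form x y > 0"
proof -
  let ?X = "\<Sum>i\<in>UNIV. (x $ Some i)\<^sup>2" and ?Y = "\<Sum>i\<in>UNIV. (y $ Some i)\<^sup>2"
  have "?X < (x $ None)\<^sup>2" "?Y < (y $ None)\<^sup>2" using assms by (simp_all add: mink_form_def power2_eq_square)
  hence X: "sqrt ?X < x $ None" and Y: "sqrt ?Y < y $ None"
    using assms by (simp_all add: real_less_lsqrt)
  have "(\<Sum>i\<in>UNIV. x $ Some i * y $ Some i) \<le> (\<Sum>i\<in>UNIV. \<bar>x $ Some i\<bar> * \<bar>y $ Some i\<bar>)"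
    by (intro sum_mono) (simp flip: abs_mult)
  also have "\<dots> \<le> sqrt ?X * sqrt ?Y"
    using L2_set_mult_ineq[of "\<lambda>i. x $ Some i" "\<lambda>i. y $ Some i" UNIV] by (simp add: L2_set_def)
  also have "\<dots> < x $ None * y $ None"
    using X Y by (intro mult_strict_mono') (auto intro: sum_nonneg)
  finally show ?thesis by (simp add: mink_form_def)
qed

text \<open>Orthochronicity, the sign of one matrix entry, becomes the sign of a Minkowski product
  of the time axis with its image. In this form it can be moved around by Lorentz
  invariance.\<close>

lemma lorentz_group_iff_timelike:
  "\<Lambda> \<in> lorentz_group \<longleftrightarrow> (\<forall>x y. mink_form (\<Lambda> *v x) (\<Lambda> *v y) = mink_form x y) \<and> det \<Lambda> = 1 \<and>
    mink_form (axis None 1) (\<Lambda> *v axis None 1) > 0"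
  by (auto simp: lorentz_group_def mink_form_axis_None matrix_vector_axis_None)

lemma mat_1_lorentz: "(mat 1 :: real ^ 's::finite option ^ 's option) \<in> lorentz_group"
proof -
  have "(mat 1 :: real ^ 's option ^ 's option) $ None $ None = 1" by (simp add: mat_def)
  thus ?thesis by (simp add: lorentz_group_def)
qed

lemma lorentz_inverse:
  assumes "\<Lambda> \<in> lorentz_group"
  obtains \<Lambda>' where "\<Lambda>' \<in> lorentz_group" "\<Lambda> ** \<Lambda>' = mat 1" "\<Lambda>' ** \<Lambda> = mat 1"
proof -
  have L: "\<And>x y. mink_form (\<Lambda> *v x) (\<Lambda> *v y) = mink_form x y" "det \<Lambda> = 1"
      "mink_form (axis None 1) (\<Lambda> *v axis None 1) > 0"
    using assms by (simp_all add: lorentz_group_iff_timelike)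
  have "invertible \<Lambda>" using L(2) by (simp add: invertible_det_nz)
  then obtain \<Lambda>' where inv: "\<Lambda> ** \<Lambda>' = mat 1" "\<Lambda>' ** \<Lambda> = mat 1" by (auto simp: invertible_def)
  have v: "\<Lambda> *v (\<Lambda>' *v x) = x" for x by (simp add: matrix_vector_mul_assoc inv)
  have form: "mink_form (\<Lambda>' *v x) (\<Lambda>' *v y) = mink_form x y" for x y
    using L(1)[of "\<Lambda>' *v x" "\<Lambda>' *v y"] by (simp add: v)
  have "det \<Lambda>' = 1" using arg_cong[OF inv(1), of det] by (simp add: det_mul L(2))
  \<comment> \<open>By invariance under \<Lambda> and symmetry of the form, this is the
    corresponding product for \<Lambda> itself.\<close>
  moreover have "mink_form (axis None 1) (\<Lambda>' *v axis None 1) > 0"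
    using L(3) L(1)[of "axis None 1" "\<Lambda>' *v axis None 1"] by (simp add: v mink_form_commute)
  ultimately have "\<Lambda>' \<in> lorentz_group" by (simp add: lorentz_group_iff_timelike form)
  with inv show thesis using that by blast
qed

text \<open>Orthochronicity is the nontrivial point. With e the time axis, invariance turns the
  product of e and \<Lambda>Me into that of \<Lambda>'e and Me, where \<Lambda>' is the inverse of
  \<Lambda>; both are forward timelike vectors.\<close>

lemma lorentz_mult:
  assumes "\<Lambda> \<in> lorentz_group" "M \<in> lorentz_group"
  shows "\<Lambda> ** M \<in> lorentz_group"
proof -
  obtain \<Lambda>' where \<Lambda>': "\<Lambda>' \<in> lorentz_group" "\<Lambda> ** \<Lambda>' = mat 1" using lorentz_inverse[OF assms(1)] by metis
  let ?e = "axis None 1 :: real ^ 'a option"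
  have L: "\<And>x y. mink_form (\<Lambda> *v x) (\<Lambda> *v y) = mink_form x y" "det \<Lambda> = 1"
    and M: "\<And>x y. mink_form (M *v x) (M *v y) = mink_form x y" "det M = 1"
    using assms by (simp_all add: lorentz_group_def)
  have tl: "mink_form (N *v ?e) (N *v ?e) > 0" "(N *v ?e) $ None > 0" if "N \<in> lorentz_group" for N
    using that by (simp_all add: lorentz_group_def matrix_vector_axis_None mink_form_axis_None)
  have "mink_form ?e ((\<Lambda> ** M) *v ?e) = mink_form (\<Lambda> *v (\<Lambda>' *v ?e)) (\<Lambda> *v (M *v ?e))"
    by (simp add: matrix_vector_mul_assoc \<Lambda>'(2))
  also have "\<dots> > 0" unfolding L(1) by (rule mink_form_pos_of_timelike) (intro tl \<Lambda>'(1) assms(2))+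
  finally show ?thesis
    by (simp add: lorentz_group_iff_timelike det_mul L M matrix_vector_mul_assoc[symmetric])
qed

lemma symm_mult_extended:
  "g \<in> extended_group \<Longrightarrow> h \<in> extended_group \<Longrightarrow> symm_mult g h \<in> extended_group"
  by (cases g; cases h) (auto simp: extended_group_def lorentz_mult)

lemma poincare_subset_extended: "poincare_group \<subseteq> extended_group"
  by (auto simp: poincare_group_def extended_group_def)

lemma dilation_extended: "\<mu> > 0 \<Longrightarrow> dilation \<mu> \<in> extended_group"
  by (simp add: dilation_def extended_group_def mat_1_lorentz)

lemma extended_group_inverse:
  fixes g :: "'s::finite symm"
  assumes "g \<in> extended_group"
  obtains g' where "g' \<in> extended_group" "symm_mult g g' = dilation 1" "symm_mult g' g = dilation 1"
proof -
  obtain \<mu> x \<Lambda> where g: "g = (\<mu>, x, \<Lambda>)" by (cases g)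
  have \<mu>: "\<mu> > 0" and "\<Lambda> \<in> lorentz_group" using assms by (auto simp: extended_group_def g)
  from this(2) obtain \<Lambda>' where \<Lambda>': "\<Lambda>' \<in> lorentz_group" "\<Lambda> ** \<Lambda>' = mat 1" "\<Lambda>' ** \<Lambda> = mat 1"
    by (rule lorentz_inverse)
  have v: "\<Lambda> *v (\<Lambda>' *v y) = y" for y by (simp add: matrix_vector_mul_assoc \<Lambda>')
  \<comment> \<open>The translation part solves
    \<open>\<mu> *\<^sub>R x + \<Lambda> *v x' = 0\<close>, the condition that the translation
    component of the product with a factor of scale \<open>inverse \<mu>\<close> vanishes.\<close>
  let ?g = "(inverse \<mu>, - (\<mu> *\<^sub>R (\<Lambda>' *v x)), \<Lambda>')"
  have "\<Lambda> *v (- (\<mu> *\<^sub>R (\<Lambda>' *v x))) = - (\<mu> *\<^sub>R x)"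
    by (metis matrix_vector_mult_scaleR scaleR_minus_left v)
  hence "symm_mult g ?g = dilation 1" "symm_mult ?g g = dilation 1"
    using \<mu> \<Lambda>' by (simp_all add: g dilation_def)
  moreover have "?g \<in> extended_group" using \<mu> \<Lambda>' by (simp add: extended_group_def)
  ultimately show thesis using that by blast
qed

lemma continuous_on_symm_mult_left:
  "continuous_on A (\<lambda>h. symm_mult h (g :: 's::finite symm))"
proof -
  obtain \<mu> x \<Lambda> where g: "g = (\<mu>, x, \<Lambda>)" by (cases g)
  have "continuous_on A (\<lambda>h::'s symm. (fst h * \<mu>, fst (snd h) /\<^sub>R \<mu> + snd (snd h) *v x, snd (snd h) ** \<Lambda>))"
    unfolding matrix_vector_mult_def matrix_matrix_mult_def by (intro continuous_intros)
  moreover have "(\<lambda>h::'s symm. (fst h * \<mu>, fst (snd h) /\<^sub>R \<mu> + snd (snd h) *v x, snd (snd h) ** \<Lambda>))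
      = (\<lambda>h. symm_mult h g)"
    by (auto simp: g)
  ultimately show ?thesis by (simp only:)
qed

lemma region_scaleR: "region \<O> \<Longrightarrow> l > 0 \<Longrightarrow> region ((*\<^sub>R) l ` \<O>)"
  by (auto simp: region_def open_scaling bounded_scaling)

lemma region_Un: "region \<O>1 \<Longrightarrow> region \<O>2 \<Longrightarrow> region (\<O>1 \<union> \<O>2)"
  by (auto simp: region_def)

lemma symm_apply_dilation_1: "symm_apply (dilation 1) z = z"
  by (simp add: dilation_def)

text \<open>The image is open as the preimage under the inverse transformation, and bounded because
  it lies in the image of a compact closure.\<close>

lemma region_symm_apply:
  fixes g :: "'s::finite symm"
  assumes g: "g \<in> extended_group" and \<O>: "region \<O>"
  shows "region (symm_apply g ` \<O>)"
proof -
  obtain g' where g': "g' \<in> extended_group" "symm_mult g g' = dilation 1" "symm_mult g' g = dilation 1"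
    using extended_group_inverse[OF g] .
  have cont: "continuous_on UNIV (symm_apply h)" for h :: "'s symm"
    by (cases h) (simp, intro continuous_intros linear_continuous_on matrix_vector_mul_bounded_linear)
  have i: "symm_apply g (symm_apply g' z) = z" "symm_apply g' (symm_apply g z) = z" for z
    by (simp_all add: symm_apply_mult[symmetric] g g' symm_apply_dilation_1)
  have "symm_apply g ` \<O> = symm_apply g' -` \<O>"
    using i by (auto simp: image_iff) metis
  hence "open (symm_apply g ` \<O>)"
    using open_vimage[OF _ cont] \<O> by (simp add: region_def)
  moreover have "compact (symm_apply g ` closure \<O>)"
    using \<O> by (intro compact_continuous_image continuous_on_subset[OF cont]) (auto simp: region_def compact_closure)
  hence "bounded (symm_apply g ` \<O>)"
    by (rule bounded_subset[OF compact_imp_bounded]) (rule image_mono[OF closure_subset])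
  ultimately show ?thesis using \<O> by (simp add: region_def)
qed


section \<open>Elements of the scaling algebra\<close>

lemma sc_bounded_neg: "A \<in> sc_bounded \<Longrightarrow> l \<le> 0 \<Longrightarrow> A l = 0"
  by (simp add: sc_bounded_def)

lemma sc_bounded_bop: "A \<in> sc_bounded \<Longrightarrow> A l \<in> bop_on UNIV"
  by (cases "l > 0") (auto simp: sc_bounded_def not_less intro!: bop_UNIVI[where K = 0])

lemma norm_le_sc_norm:
  assumes A: "A \<in> sc_bounded"
  shows "norm (A l x) \<le> sc_norm A * norm x"
proof -
  have bdd: "bdd_above ((\<lambda>l. onorm (A l)) ` {0<..})" using A by (simp add: sc_bounded_def)
  have le: "onorm (A l) \<le> sc_norm A" if "l > 0" for l
    unfolding sc_norm_def using that by (intro cSUP_upper bdd) auto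
  show ?thesis
  proof (cases "l > 0")
    case True
    have "norm (A l x) \<le> onorm (A l) * norm x"
      by (intro onorm bop_UNIV_bounded_linear sc_bounded_bop A)
    also have "\<dots> \<le> sc_norm A * norm x" by (intro mult_right_mono le True) simp
    finally show ?thesis .
  next
    case False
    \<comment> \<open>At a nonpositive scale the operator vanishes and only the sign of
      \<open>sc_norm A\<close> matters; the scale 1 is a sample point that reveals it.\<close>
    have "0 \<le> onorm (A 1)" by (intro onorm_pos_le bop_UNIV_bounded_linear sc_bounded_bop A)
    hence "0 \<le> sc_norm A" using le[of 1] by simp
    thus ?thesis using False sc_bounded_neg[OF A] by simp
  qed
qed

lemma sc_norm_nonneg: "A \<in> sc_bounded \<Longrightarrow> 0 \<le> sc_norm A"
proof -
  assume A: "A \<in> sc_bounded"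
  have "0 \<le> onorm (A 1)" by (intro onorm_pos_le bop_UNIV_bounded_linear sc_bounded_bop A)
  also have "\<dots> \<le> sc_norm A"
    unfolding sc_norm_def using A by (intro cSUP_upper) (auto simp: sc_bounded_def)
  finally show ?thesis .
qed

lemma sc_norm_leI:
  assumes "\<And>l x. norm (A l x) \<le> K * norm x" "0 \<le> K"
  shows "sc_norm A \<le> K"
  unfolding sc_norm_def using assms by (intro cSUP_least onorm_bound) auto

lemma sc_boundedI:
  assumes "\<And>l. l > 0 \<Longrightarrow> A l \<in> bop_on UNIV" "\<And>l. l \<le> 0 \<Longrightarrow> A l = 0"
    and K: "\<And>l x. l > 0 \<Longrightarrow> norm (A l x) \<le> K * norm x"
  shows "A \<in> sc_bounded"
proof -
  have "onorm (A l) \<le> max K 0" if "l > 0" for l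
  proof (rule onorm_bound)
    show "norm (A l x) \<le> max K 0 * norm x" for x
      by (rule order_trans[OF K[OF that]]) (intro mult_right_mono, auto)
  qed simp
  hence "bdd_above ((\<lambda>l. onorm (A l)) ` {0<..})" by (intro bdd_aboveI[of _ "max K 0"]) auto
  thus ?thesis using assms(1,2) by (simp add: sc_bounded_def)
qed

lemma norm_sc_diff_le:
  assumes "A \<in> sc_bounded" "B \<in> sc_bounded"
  shows "norm ((A - B) l x) \<le> (sc_norm A + sc_norm B) * norm x"
  using norm_le_sc_norm[OF assms(1), of l x] norm_le_sc_norm[OF assms(2), of l x]
    norm_triangle_ineq4[of "A l x" "B l x"] by (simp add: distrib_right)

lemma sc_diff_bounded: "A \<in> sc_bounded \<Longrightarrow> B \<in> sc_bounded \<Longrightarrow> A - B \<in> sc_bounded"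
proof (rule sc_boundedI)
  assume AB: "A \<in> sc_bounded" "B \<in> sc_bounded"
  show "norm ((A - B) l x) \<le> (sc_norm A + sc_norm B) * norm x" for l x
    by (rule norm_sc_diff_le[OF AB])
  show "(A - B) l \<in> bop_on UNIV" for l
    by (rule bop_UNIVI[OF _ _ norm_sc_diff_le[OF AB]])
      (simp_all add: bop_UNIV_add bop_UNIV_scale sc_bounded_bop AB scaleC_diff_right)
qed (simp add: sc_bounded_neg)

lemma sc_norm_diff_le: "A \<in> sc_bounded \<Longrightarrow> B \<in> sc_bounded \<Longrightarrow> sc_norm (A - B) \<le> sc_norm A + sc_norm B"
  by (intro sc_norm_leI norm_sc_diff_le add_nonneg_nonneg sc_norm_nonneg)

lemma sc_norm_triangle:
  assumes "A \<in> sc_bounded" "B \<in> sc_bounded" "C \<in> sc_bounded"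
  shows "sc_norm (A - C) \<le> sc_norm (A - B) + sc_norm (B - C)"
proof (rule sc_norm_leI)
  fix l x
  have "norm ((A - C) l x) \<le> norm ((A - B) l x) + norm ((B - C) l x)"
    using norm_triangle_ineq[of "(A - B) l x" "(B - C) l x"] by simp
  thus "norm ((A - C) l x) \<le> (sc_norm (A - B) + sc_norm (B - C)) * norm x"
    using norm_le_sc_norm[of "A - B" l x] norm_le_sc_norm[of "B - C" l x] assms
    by (simp add: sc_diff_bounded distrib_right)
qed (intro add_nonneg_nonneg sc_norm_nonneg sc_diff_bounded assms)

lemma sc_norm_diff_commute: "sc_norm (A - B) = sc_norm (B - A)"
proof -
  have "onorm ((A - B) l) = onorm ((B - A) l)" for l
    using onorm_neg[of "(A - B) l"] by (simp add: fun_diff_def)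
  thus ?thesis by (simp add: sc_norm_def)
qed

lemma sc_norm_zero [simp]: "sc_norm 0 = 0"
  by (simp add: sc_norm_def zero_fun_def onorm_zero)

lemma norm_sc_mult_le:
  assumes "A \<in> sc_bounded" "B \<in> sc_bounded"
  shows "norm (sc_mult A B l x) \<le> (sc_norm A * sc_norm B) * norm x"
proof -
  have "norm (A l (B l x)) \<le> sc_norm A * norm (B l x)" by (rule norm_le_sc_norm[OF assms(1)])
  also have "\<dots> \<le> sc_norm A * (sc_norm B * norm x)"
    by (intro mult_left_mono norm_le_sc_norm sc_norm_nonneg assms)
  finally show ?thesis by (simp add: sc_mult_def mult.assoc)
qed

lemma sc_mult_bounded: "A \<in> sc_bounded \<Longrightarrow> B \<in> sc_bounded \<Longrightarrow> sc_mult A B \<in> sc_bounded"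
proof (rule sc_boundedI)
  assume AB: "A \<in> sc_bounded" "B \<in> sc_bounded"
  show "norm (sc_mult A B l x) \<le> (sc_norm A * sc_norm B) * norm x" for l x
    by (rule norm_sc_mult_le[OF AB])
  show "sc_mult A B l \<in> bop_on UNIV" for l
    unfolding sc_mult_def by (intro bop_UNIV_comp sc_bounded_bop AB)
qed (simp add: sc_bounded_neg sc_mult_def fun_eq_iff)

lemma sc_norm_mult_le: "A \<in> sc_bounded \<Longrightarrow> B \<in> sc_bounded \<Longrightarrow> sc_norm (sc_mult A B) \<le> sc_norm A * sc_norm B"
  by (intro sc_norm_leI norm_sc_mult_le mult_nonneg_nonneg sc_norm_nonneg)

text \<open>Arranged as a difference, with \<open>A' - A\<close> reversed, because differences are
  the operation for which the boundedness and norm estimates are set up.\<close>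

lemma sc_mult_diff:
  assumes "A \<in> sc_bounded"
  shows "sc_mult A B - sc_mult A' B' = sc_mult A (B - B') - sc_mult (A' - A) B'"
  by (simp add: fun_eq_iff sc_mult_def bop_UNIV_diff[OF sc_bounded_bop[OF assms]])

lemma sc_norm_mult_diff_le:
  assumes "A \<in> sc_bounded" "A' \<in> sc_bounded" "B \<in> sc_bounded" "B' \<in> sc_bounded"
  shows "sc_norm (sc_mult A B - sc_mult A' B')
    \<le> sc_norm A * sc_norm (B - B') + sc_norm (A - A') * sc_norm B'"
proof -
  have "sc_norm (sc_mult A B - sc_mult A' B')
      \<le> sc_norm (sc_mult A (B - B')) + sc_norm (sc_mult (A' - A) B')"
    by (subst sc_mult_diff[OF assms(1)]) (intro sc_norm_diff_le sc_mult_bounded sc_diff_bounded assms)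
  also have "\<dots> \<le> sc_norm A * sc_norm (B - B') + sc_norm (A' - A) * sc_norm B'"
    by (intro add_mono sc_norm_mult_le sc_diff_bounded assms)
  finally show ?thesis by (simp add: sc_norm_diff_commute)
qed

lemma sc_star_bounded: "A \<in> sc_bounded \<Longrightarrow> sc_star A \<in> sc_bounded"
proof (rule sc_boundedI)
  assume A: "A \<in> sc_bounded"
  show "norm (sc_star A l x) \<le> sc_norm A * norm x" for l x
    unfolding sc_star_def by (rule norm_cadj_le[OF sc_bounded_bop[OF A] norm_le_sc_norm[OF A]])
  show "sc_star A l \<in> bop_on UNIV" for l
    unfolding sc_star_def by (intro bop_UNIV_cadj sc_bounded_bop A)
qed (simp add: sc_bounded_neg sc_star_def cadj_zero[unfolded zero_fun_def] zero_fun_def)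

lemma sc_norm_star_le: "A \<in> sc_bounded \<Longrightarrow> sc_norm (sc_star A) \<le> sc_norm A"
  unfolding sc_star_def
  by (intro sc_norm_leI norm_cadj_le sc_bounded_bop norm_le_sc_norm sc_norm_nonneg)

lemma sc_star_diff: "A \<in> sc_bounded \<Longrightarrow> B \<in> sc_bounded \<Longrightarrow> sc_star (A - B) = sc_star A - sc_star B"
  by (rule ext) (simp add: sc_star_def cadj_diff sc_bounded_bop)


section \<open>The action of the extended symmetry group on the scaling algebra\<close>

locale vacuum_net =
  fixes \<AA> :: "'s::finite minkowski set \<Rightarrow> ('h::chilbert_space \<Rightarrow> 'h) set"
    and U :: "'s symm \<Rightarrow> 'h \<Rightarrow> 'h" and \<Omega> :: 'h
  assumes vacuum: "vacuum_sector_net \<AA> U \<Omega>"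
begin

lemma von_neumann: "region \<O> \<Longrightarrow> von_neumann_algebra (\<AA> \<O>)"
  and isotony: "region \<O>1 \<Longrightarrow> region \<O>2 \<Longrightarrow> \<O>1 \<subseteq> \<O>2 \<Longrightarrow> \<AA> \<O>1 \<subseteq> \<AA> \<O>2"
  and covariance: "g \<in> poincare_group \<Longrightarrow> region \<O> \<Longrightarrow> ad (U g) ` \<AA> \<O> = \<AA> (symm_apply g ` \<O>)"
  and unitary: "g \<in> poincare_group \<Longrightarrow> unitary_between UNIV UNIV (U g)"
  and U_mult: "g \<in> poincare_group \<Longrightarrow> h \<in> poincare_group \<Longrightarrow> U (symm_mult g h) = U g \<circ> U h"
  and U_vacuum: "g \<in> poincare_group \<Longrightarrow> U g \<Omega> = \<Omega>"
  and norm_vacuum: "norm \<Omega> = 1"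
  using vacuum by (simp_all add: vacuum_sector_net_def unitary_rep_def fun_eq_iff)

lemma U_bop: "g \<in> poincare_group \<Longrightarrow> U g \<in> bop_on UNIV"
  by (rule unitary_UNIV_bop(1)[OF unitary])

lemma cadj_U_vacuum: "g \<in> poincare_group \<Longrightarrow> cadj (U g) \<Omega> = \<Omega>"
  using unitary_UNIV_cadj(2)[OF unitary, of g \<Omega>] by (simp add: U_vacuum)

lemma ad_U_mult:
  assumes "g \<in> poincare_group" "h \<in> poincare_group"
  shows "ad (U (symm_mult g h)) T = ad (U g) (ad (U h) T)"
  by (simp add: ad_def U_mult assms cadj_comp U_bop comp_assoc)

text \<open>At each scale the action is conjugation by one Poincare unitary, which itself depends on
  the scale, after a change of scale by \<mu>. Properties of \<open>sc_act\<close> are reduced to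
  those of \<open>ad\<close> through this form.\<close>

lemma sc_act_eq:
  assumes "g \<in> extended_group"
  obtains \<mu> p where "\<mu> > 0" "\<mu> = fst g" "\<And>l. p l \<in> poincare_group"
    "\<And>B l. sc_act U g B l = ad (U (p l)) (B (l * \<mu>))"
proof -
  obtain \<mu> x \<Lambda> where g: "g = (\<mu>, x, \<Lambda>)" by (cases g)
  show thesis
    using assms by (intro that[of \<mu> "\<lambda>l. (1, (l * \<mu>) *\<^sub>R x, \<Lambda>)"])
      (auto simp: g extended_group_def poincare_group_def)
qed

lemma norm_sc_act_le:
  assumes g: "g \<in> extended_group" and A: "A \<in> sc_bounded"
  shows "norm (sc_act U g A l x) \<le> sc_norm A * norm x"
proof -
  obtain \<mu> p where p: "\<And>l. p l \<in> poincare_group" "\<And>B l. sc_act U g B l = ad (U (p l)) (B (l * \<mu>))"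
    using sc_act_eq[OF g] by metis
  show ?thesis unfolding p(2) by (intro norm_ad_le unitary p norm_le_sc_norm A)
qed

lemma sc_act_bounded:
  assumes g: "g \<in> extended_group" and A: "A \<in> sc_bounded"
  shows "sc_act U g A \<in> sc_bounded"
proof -
  obtain \<mu> p where p: "\<mu> > 0" "\<And>l. p l \<in> poincare_group"
      "\<And>B l. sc_act U g B l = ad (U (p l)) (B (l * \<mu>))"
    using sc_act_eq[OF g] by metis
  show ?thesis
  proof (rule sc_boundedI)
    show "norm (sc_act U g A l x) \<le> sc_norm A * norm x" for l x by (rule norm_sc_act_le[OF g A])
    show "sc_act U g A l \<in> bop_on UNIV" for l
      unfolding p by (intro ad_bop U_bop p sc_bounded_bop A)
    show "sc_act U g A l = 0" if "l \<le> 0" for l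
    proof -
      have "A (l * \<mu>) = 0" using that p(1) by (intro sc_bounded_neg[OF A]) (simp add: mult_le_0_iff)
      thus ?thesis by (simp add: p fun_eq_iff ad_def bop_UNIV_zero[OF U_bop[OF p(2)]])
    qed
  qed
qed

lemma sc_norm_act_le: "g \<in> extended_group \<Longrightarrow> A \<in> sc_bounded \<Longrightarrow> sc_norm (sc_act U g A) \<le> sc_norm A"
  by (intro sc_norm_leI norm_sc_act_le sc_norm_nonneg)

lemma
  assumes g: "g \<in> extended_group"
  shows sc_act_diff: "sc_act U g (A - B) = sc_act U g A - sc_act U g B"
    and sc_act_mult: "sc_act U g (sc_mult A B) = sc_mult (sc_act U g A) (sc_act U g B)"
    and sc_act_star: "A \<in> sc_bounded \<Longrightarrow> sc_act U g (sc_star A) = sc_star (sc_act U g A)"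
proof -
  obtain \<mu> p where p: "\<And>l. p l \<in> poincare_group" "\<And>B l. sc_act U g B l = ad (U (p l)) (B (l * \<mu>))"
    using sc_act_eq[OF g] by metis
  show "sc_act U g (A - B) = sc_act U g A - sc_act U g B"
    by (rule ext) (simp add: p ad_diff[OF U_bop])
  show "sc_act U g (sc_mult A B) = sc_mult (sc_act U g A) (sc_act U g B)"
    by (rule ext) (simp add: p sc_mult_def ad_comp unitary)
  show "sc_act U g (sc_star A) = sc_star (sc_act U g A)" if "A \<in> sc_bounded"
    by (rule ext) (simp add: p sc_star_def ad_cadj U_bop sc_bounded_bop that)
qed

text \<open>The composition law of \<open>symm_mult\<close> fits this computation: translations are
  stretched in proportion to the scale, and factoring \<open>l * (\<mu> * \<mu>')\<close> out of the
  combined translation leaves \<open>x /\<^sub>R \<mu>' + \<Lambda> *v x'\<close>.\<close>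

lemma sc_act_symm_mult:
  assumes "g \<in> extended_group" "h \<in> extended_group"
  shows "sc_act U (symm_mult g h) A = sc_act U g (sc_act U h A)"
proof
  fix l
  obtain \<mu> x \<Lambda> \<mu>' x' \<Lambda>' where g: "g = (\<mu>, x, \<Lambda>)" and h: "h = (\<mu>', x', \<Lambda>')" by (cases g; cases h)
  have pos: "\<mu> > 0" "\<mu>' > 0" "\<Lambda> \<in> lorentz_group" "\<Lambda>' \<in> lorentz_group"
    using assms by (auto simp: g h extended_group_def)
  let ?p = "(1, (l * \<mu>) *\<^sub>R x, \<Lambda>)" and ?q = "(1, (l * \<mu> * \<mu>') *\<^sub>R x', \<Lambda>')"
  have "symm_mult ?p ?q = (1, (l * (\<mu> * \<mu>')) *\<^sub>R (x /\<^sub>R \<mu>' + \<Lambda> *v x'), \<Lambda> ** \<Lambda>')"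
    using pos by (simp add: scaleR_add_right matrix_vector_mult_scaleR mult.assoc)
  moreover have "ad (U (symm_mult ?p ?q)) T = ad (U ?p) (ad (U ?q) T)" for T
    using pos by (intro ad_U_mult) (auto simp: poincare_group_def)
  ultimately show "sc_act U (symm_mult g h) A l = sc_act U g (sc_act U h A) l"
    by (simp add: g h mult.assoc)
qed

text \<open>\<open>unitary_rep\<close> does not list that the identity acts as \<open>id\<close>.
  This follows from idempotence, since a unitary can be cancelled by its adjoint.\<close>

lemma sc_act_1:
  assumes A: "A \<in> sc_bounded"
  shows "sc_act U (dilation 1) A = A"
proof -
  have mem: "(1, 0, mat 1) \<in> poincare_group" by (simp add: poincare_group_def mat_1_lorentz)
  have "U (1, 0, mat 1) x = x" for x
  proof -
    have "U (1, 0, mat 1) (U (1, 0, mat 1) x) = U (1, 0, mat 1) x"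
      using fun_cong[OF U_mult[OF mem mem], of x] by simp
    hence "cadj (U (1, 0, mat 1)) (U (1, 0, mat 1) (U (1, 0, mat 1) x))
        = cadj (U (1, 0, mat 1)) (U (1, 0, mat 1) x)" by simp
    thus ?thesis by (simp only: unitary_UNIV_cadj(2)[OF unitary[OF mem]])
  qed
  hence 1: "U (1, 0, mat 1) = id" by auto
  have "cadj id = (id :: 'h \<Rightarrow> 'h)" by (rule cadj_eqI) simp
  thus ?thesis by (simp add: dilation_def fun_eq_iff ad_def 1)
qed

text \<open>The continuity clause of \<open>scaling_local\<close>, detached from localization.
  \<open>scaling_algebra\<close> demands it only of the local approximants, so its validity for
  quasilocal elements is a matter of passing to norm limits.\<close>

definition norm_cont :: "'h sc \<Rightarrow> bool" where
  "norm_cont A \<longleftrightarrow> (\<forall>g\<in>extended_group.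
     ((\<lambda>h. sc_norm (sc_act U h A - sc_act U g A)) \<longlongrightarrow> 0) (at g within extended_group))"

lemma act_tendsto_0I:
  assumes "\<And>h. h \<in> extended_group \<Longrightarrow> B h \<in> sc_bounded"
    and "\<And>h. h \<in> extended_group \<Longrightarrow> sc_norm (B h) \<le> F h"
    and F: "(F \<longlongrightarrow> 0) (at g within extended_group)"
  shows "((\<lambda>h. sc_norm (B h)) \<longlongrightarrow> 0) (at g within extended_group)"
proof (rule tendsto_sandwich[OF _ _ tendsto_const F])
  show "\<forall>\<^sub>F h in at g within extended_group. 0 \<le> sc_norm (B h)"
    using assms(1) by (auto simp: eventually_at_filter sc_norm_nonneg intro!: always_eventually)
  show "\<forall>\<^sub>F h in at g within extended_group. sc_norm (B h) \<le> F h"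
    using assms(2) by (auto simp: eventually_at_filter intro!: always_eventually)
qed

lemma norm_contD:
  assumes "norm_cont A" "g \<in> extended_group"
  shows "((\<lambda>h. sc_norm (sc_act U h A - sc_act U g A)) \<longlongrightarrow> 0) (at g within extended_group)"
  using assms by (simp add: norm_cont_def)

lemma norm_cont_diff:
  assumes A: "A \<in> sc_bounded" "norm_cont A" and B: "B \<in> sc_bounded" "norm_cont B"
  shows "norm_cont (A - B)"
  unfolding norm_cont_def
proof (intro ballI act_tendsto_0I)
  fix g :: "'s symm" assume g: "g \<in> extended_group"
  show "((\<lambda>h. sc_norm (sc_act U h A - sc_act U g A) + sc_norm (sc_act U h B - sc_act U g B)) \<longlongrightarrow> 0)
      (at g within extended_group)"
    using tendsto_add[OF norm_contD[OF A(2) g] norm_contD[OF B(2) g]] by simp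
  fix h :: "'s symm" assume h: "h \<in> extended_group"
  show "sc_act U h (A - B) - sc_act U g (A - B) \<in> sc_bounded"
    by (intro sc_diff_bounded sc_act_bounded A B g h)
  have eq: "sc_act U h (A - B) - sc_act U g (A - B)
      = (sc_act U h A - sc_act U g A) - (sc_act U h B - sc_act U g B)"
    by (simp add: sc_act_diff g h)
  show "sc_norm (sc_act U h (A - B) - sc_act U g (A - B))
      \<le> sc_norm (sc_act U h A - sc_act U g A) + sc_norm (sc_act U h B - sc_act U g B)"
    unfolding eq by (intro sc_norm_diff_le sc_diff_bounded sc_act_bounded A B g h)
qed

lemma norm_cont_mult:
  assumes A: "A \<in> sc_bounded" "norm_cont A" and B: "B \<in> sc_bounded" "norm_cont B"
  shows "norm_cont (sc_mult A B)"
  unfolding norm_cont_def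
proof (intro ballI act_tendsto_0I)
  fix g :: "'s symm" assume g: "g \<in> extended_group"
  show "((\<lambda>h. sc_norm A * sc_norm (sc_act U h B - sc_act U g B)
      + sc_norm (sc_act U h A - sc_act U g A) * sc_norm B) \<longlongrightarrow> 0) (at g within extended_group)"
    using tendsto_add[OF tendsto_mult[OF tendsto_const norm_contD[OF B(2) g]]
        tendsto_mult[OF norm_contD[OF A(2) g] tendsto_const]] by simp
  fix h :: "'s symm" assume h: "h \<in> extended_group"
  show "sc_act U h (sc_mult A B) - sc_act U g (sc_mult A B) \<in> sc_bounded"
    by (intro sc_diff_bounded sc_act_bounded sc_mult_bounded A B g h)
  have "sc_norm (sc_act U h (sc_mult A B) - sc_act U g (sc_mult A B))
      \<le> sc_norm (sc_act U h A) * sc_norm (sc_act U h B - sc_act U g B)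
        + sc_norm (sc_act U h A - sc_act U g A) * sc_norm (sc_act U g B)"
    unfolding sc_act_mult[OF g] sc_act_mult[OF h]
    by (intro sc_norm_mult_diff_le sc_act_bounded A B g h)
  also have "\<dots> \<le> sc_norm A * sc_norm (sc_act U h B - sc_act U g B)
      + sc_norm (sc_act U h A - sc_act U g A) * sc_norm B"
    by (intro add_mono mult_mono order_refl sc_norm_act_le sc_norm_nonneg sc_diff_bounded
        sc_act_bounded A B g h)
  finally show "sc_norm (sc_act U h (sc_mult A B) - sc_act U g (sc_mult A B)) \<le> \<dots>" .
qed

lemma norm_cont_star:
  assumes A: "A \<in> sc_bounded" "norm_cont A"
  shows "norm_cont (sc_star A)"
  unfolding norm_cont_def
proof (intro ballI act_tendsto_0I)
  fix g :: "'s symm" assume g: "g \<in> extended_group"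
  show "((\<lambda>h. sc_norm (sc_act U h A - sc_act U g A)) \<longlongrightarrow> 0) (at g within extended_group)"
    by (rule norm_contD[OF A(2) g])
  fix h :: "'s symm" assume h: "h \<in> extended_group"
  show "sc_act U h (sc_star A) - sc_act U g (sc_star A) \<in> sc_bounded"
    by (intro sc_diff_bounded sc_act_bounded sc_star_bounded A g h)
  have "sc_act U h (sc_star A) - sc_act U g (sc_star A) = sc_star (sc_act U h A - sc_act U g A)"
    by (simp add: sc_act_star sc_star_diff sc_act_bounded A g h)
  thus "sc_norm (sc_act U h (sc_star A) - sc_act U g (sc_star A)) \<le> sc_norm (sc_act U h A - sc_act U g A)"
    by (simp add: sc_norm_star_le sc_diff_bounded sc_act_bounded A g h)
qed

text \<open>The orbit of \<open>sc_act U k A\<close> at \<open>h\<close> is the orbit of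
  \<open>A\<close> at \<open>symm_mult h k\<close>, and right translation by \<open>k\<close> is
  continuous and preserves the group.\<close>

lemma norm_cont_act:
  assumes A: "A \<in> sc_bounded" "norm_cont A" and k: "k \<in> extended_group"
  shows "norm_cont (sc_act U k A)"
  unfolding norm_cont_def
proof
  fix g :: "'s symm" assume g: "g \<in> extended_group"
  let ?E = "extended_group :: 's symm set"
  let ?F = "\<lambda>h. sc_norm (sc_act U h A - sc_act U (symm_mult g k) A)"
  have gk: "symm_mult g k \<in> ?E" by (rule symm_mult_extended[OF g k])
  have "continuous (at (symm_mult g k) within ?E) ?F"
    using norm_contD[OF A(2) gk] by (simp add: continuous_within)
  moreover have "(\<lambda>h. symm_mult h k) ` ?E \<subseteq> ?E" using symm_mult_extended k by blast
  ultimately have "continuous (at (symm_mult g k) within (\<lambda>h. symm_mult h k) ` ?E) ?F"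
    by (rule continuous_within_subset)
  moreover have "continuous (at g within ?E) (\<lambda>h. symm_mult h k)"
    using continuous_on_symm_mult_left[of ?E k] g by (simp add: continuous_on_eq_continuous_within)
  ultimately have "continuous (at g within ?E) (?F \<circ> (\<lambda>h. symm_mult h k))"
    by (intro continuous_within_compose)
  hence "((\<lambda>h. ?F (symm_mult h k)) \<longlongrightarrow> 0) (at g within ?E)"
    by (simp add: continuous_within comp_def)
  thus "((\<lambda>h. sc_norm (sc_act U h (sc_act U k A) - sc_act U g (sc_act U k A))) \<longlongrightarrow> 0) (at g within ?E)"
  proof (rule Lim_transform_eventually)
    show "\<forall>\<^sub>F h in at g within ?E. ?F (symm_mult h k)
        = sc_norm (sc_act U h (sc_act U k A) - sc_act U g (sc_act U k A))"
      by (auto simp: eventually_at_filter sc_act_symm_mult g k intro!: always_eventually)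
  qed
qed

text \<open>An e/3 argument. It works because every group element acts as a contraction, so that a
  single approximant serves all \<open>h\<close> at once.\<close>

lemma norm_cont_limit:
  assumes A: "A \<in> sc_bounded"
    and approx: "\<And>\<epsilon>. 0 < \<epsilon> \<Longrightarrow> \<exists>B\<in>sc_bounded. norm_cont B \<and> sc_norm (A - B) < \<epsilon>"
  shows "norm_cont A"
  unfolding norm_cont_def
proof (intro ballI tendstoI)
  fix g :: "'s symm" and e :: real assume g: "g \<in> extended_group" and e: "0 < e"
  obtain B where B: "B \<in> sc_bounded" "norm_cont B" "sc_norm (A - B) < e / 3"
    using approx[of "e / 3"] e by auto
  have "\<forall>\<^sub>F h in at g within extended_group. dist (sc_norm (sc_act U h B - sc_act U g B)) 0 < e / 3"
    using norm_contD[OF B(2) g] e by (intro tendstoD) auto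
  moreover have "\<forall>\<^sub>F h in at g within extended_group. h \<in> extended_group"
    by (simp add: eventually_at_filter)
  ultimately show "\<forall>\<^sub>F h in at g within extended_group. dist (sc_norm (sc_act U h A - sc_act U g A)) 0 < e"
  proof eventually_elim
    case (elim h)
    have AB: "sc_norm (sc_act U k A - sc_act U k B) < e / 3" if "k \<in> extended_group" for k
      using sc_norm_act_le[OF that sc_diff_bounded[OF A B(1)]] B(3) by (simp add: sc_act_diff that)
    note bd = sc_act_bounded[OF g A] sc_act_bounded[OF g B(1)]
      sc_act_bounded[OF elim(2) A] sc_act_bounded[OF elim(2) B(1)]
    have "sc_norm (sc_act U h A - sc_act U g A)
        \<le> sc_norm (sc_act U h A - sc_act U h B) + sc_norm (sc_act U h B - sc_act U g A)"
      by (intro sc_norm_triangle bd)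
    moreover have "sc_norm (sc_act U h B - sc_act U g A)
        \<le> sc_norm (sc_act U h B - sc_act U g B) + sc_norm (sc_act U g B - sc_act U g A)"
      by (intro sc_norm_triangle bd)
    moreover have "sc_norm (sc_act U g B - sc_act U g A) = sc_norm (sc_act U g A - sc_act U g B)"
      by (rule sc_norm_diff_commute)
    ultimately have "sc_norm (sc_act U h A - sc_act U g A) < e"
      using elim(1) AB[OF g] AB[OF elim(2)] unfolding dist_real_def by linarith
    thus ?case using sc_norm_nonneg[OF sc_diff_bounded[OF bd(3,1)]] by simp
  qed
qed


section \<open>Closure properties of the scaling algebra\<close>

lemma scaling_local_iff:
  "A \<in> scaling_local \<AA> U \<O> \<longleftrightarrow> A \<in> sc_bounded \<and> (\<forall>l>0. A l \<in> \<AA> ((*\<^sub>R) l ` \<O>)) \<and> norm_cont A"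
  by (simp add: scaling_local_def norm_cont_def)

lemma scaling_local_mono:
  assumes "region \<O>1" "region \<O>2" "\<O>1 \<subseteq> \<O>2"
  shows "scaling_local \<AA> U \<O>1 \<subseteq> scaling_local \<AA> U \<O>2"
proof -
  have "\<AA> ((*\<^sub>R) l ` \<O>1) \<subseteq> \<AA> ((*\<^sub>R) l ` \<O>2)" if "l > 0" for l
    using assms that by (intro isotony region_scaleR image_mono)
  thus ?thesis unfolding subset_iff scaling_local_iff by simp
qed

lemma
  assumes \<O>: "region \<O>" and A: "A \<in> scaling_local \<AA> U \<O>"
  shows scaling_local_diff: "B \<in> scaling_local \<AA> U \<O> \<Longrightarrow> A - B \<in> scaling_local \<AA> U \<O>"
    and scaling_local_mult: "B \<in> scaling_local \<AA> U \<O> \<Longrightarrow> sc_mult A B \<in> scaling_local \<AA> U \<O>"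
    and scaling_local_star: "sc_star A \<in> scaling_local \<AA> U \<O>"
proof -
  note vN = von_neumann[OF region_scaleR[OF \<O>]]
  show "A - B \<in> scaling_local \<AA> U \<O>" if "B \<in> scaling_local \<AA> U \<O>"
    using A that by (simp add: scaling_local_iff sc_diff_bounded norm_cont_diff von_neumann_algebra_diff[OF vN])
  show "sc_mult A B \<in> scaling_local \<AA> U \<O>" if "B \<in> scaling_local \<AA> U \<O>"
  proof -
    have "sc_mult A B l \<in> \<AA> ((*\<^sub>R) l ` \<O>)" if "l > 0" for l
      using A \<open>B \<in> _\<close> that unfolding sc_mult_def
      by (intro von_neumann_algebra_comp vN) (auto simp: scaling_local_iff)
    thus ?thesis using A that by (simp add: scaling_local_iff sc_mult_bounded norm_cont_mult)
  qed
  show "sc_star A \<in> scaling_local \<AA> U \<O>"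
  proof -
    have "sc_star A l \<in> \<AA> ((*\<^sub>R) l ` \<O>)" if "l > 0" for l
      using A that unfolding sc_star_def
      by (intro von_neumann_algebra_cadj vN) (auto simp: scaling_local_iff)
    thus ?thesis using A by (simp add: scaling_local_iff sc_star_bounded norm_cont_star)
  qed
qed

text \<open>Covariance is applied at each scale separately: stretching a point by
  \<open>l * \<mu>\<close> and then applying the rescaled Poincare transformation gives the same
  point as applying \<open>g\<close> and then stretching by \<open>l\<close>.\<close>

lemma scaling_local_act:
  assumes g: "g \<in> extended_group" and \<O>: "region \<O>" and A: "A \<in> scaling_local \<AA> U \<O>"
  shows "sc_act U g A \<in> scaling_local \<AA> U (symm_apply g ` \<O>)"
proof -
  obtain \<mu> x \<Lambda> where g': "g = (\<mu>, x, \<Lambda>)" by (cases g)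
  have pos: "\<mu> > 0" "\<Lambda> \<in> lorentz_group" using g by (auto simp: g' extended_group_def)
  have "sc_act U g A l \<in> \<AA> ((*\<^sub>R) l ` symm_apply g ` \<O>)" if l: "l > 0" for l
  proof -
    let ?p = "(1, (l * \<mu>) *\<^sub>R x, \<Lambda>)"
    have p: "?p \<in> poincare_group" using pos by (simp add: poincare_group_def)
    have l\<mu>: "l * \<mu> > 0" using l pos by simp
    have "ad (U ?p) (A (l * \<mu>)) \<in> ad (U ?p) ` \<AA> ((*\<^sub>R) (l * \<mu>) ` \<O>)"
      using A l\<mu> by (intro imageI) (simp add: scaling_local_iff)
    also have "\<dots> = \<AA> (symm_apply ?p ` (*\<^sub>R) (l * \<mu>) ` \<O>)"
      by (intro covariance p region_scaleR \<O> l\<mu>)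
    also have "symm_apply ?p ` (*\<^sub>R) (l * \<mu>) ` \<O> = (*\<^sub>R) l ` symm_apply g ` \<O>"
      unfolding image_image by (rule image_cong) (simp_all add: g' matrix_vector_mult_scaleR scaleR_add_right)
    finally show ?thesis by (simp add: g')
  qed
  thus ?thesis using A g by (simp add: scaling_local_iff sc_act_bounded norm_cont_act)
qed

section \<open>The quasilocal scaling algebra and its center\<close>

abbreviation alg :: "'h sc set" where "alg \<equiv> scaling_algebra \<AA> U"
abbreviation center :: "'h sc set" where "center \<equiv> scaling_center \<AA> U"

lemma alg_bounded: "A \<in> alg \<Longrightarrow> A \<in> sc_bounded"
  by (simp add: scaling_algebra_def)

lemma alg_approx:
  assumes "A \<in> alg" "0 < \<epsilon>"
  obtains \<O> B where "region \<O>" "B \<in> scaling_local \<AA> U \<O>" "B \<in> sc_bounded" "sc_norm (A - B) < \<epsilon>"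
proof -
  from assms obtain \<O> B where "region \<O>" "B \<in> scaling_local \<AA> U \<O>" "sc_norm (A - B) < \<epsilon>"
    unfolding scaling_algebra_def by blast
  thus thesis using that[of \<O> B] by (simp add: scaling_local_iff)
qed

text \<open>Regions need not be connected, so the union of two regions localizes both approximants,
  and algebraic operations can be carried out inside one local algebra.\<close>

lemma alg_approx2:
  assumes "A \<in> alg" "B \<in> alg" "0 < \<epsilon>"
  obtains \<O> A' B' where "region \<O>" "A' \<in> scaling_local \<AA> U \<O>" "B' \<in> scaling_local \<AA> U \<O>"
    "A' \<in> sc_bounded" "B' \<in> sc_bounded" "sc_norm (A - A') < \<epsilon>" "sc_norm (B - B') < \<epsilon>"
proof -
  obtain \<O>1 A' where 1: "region \<O>1" "A' \<in> scaling_local \<AA> U \<O>1" "A' \<in> sc_bounded" "sc_norm (A - A') < \<epsilon>"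
    using alg_approx[OF assms(1,3)] .
  obtain \<O>2 B' where 2: "region \<O>2" "B' \<in> scaling_local \<AA> U \<O>2" "B' \<in> sc_bounded" "sc_norm (B - B') < \<epsilon>"
    using alg_approx[OF assms(2,3)] .
  have r: "region (\<O>1 \<union> \<O>2)" by (intro region_Un 1 2)
  have "A' \<in> scaling_local \<AA> U (\<O>1 \<union> \<O>2)" "B' \<in> scaling_local \<AA> U (\<O>1 \<union> \<O>2)"
    using scaling_local_mono[OF 1(1) r] scaling_local_mono[OF 2(1) r] 1(2) 2(2) by auto
  with r 1 2 show thesis using that by blast
qed

lemma algI:
  assumes "A \<in> sc_bounded" "\<And>\<epsilon>. 0 < \<epsilon> \<Longrightarrow> \<exists>\<O> B. region \<O> \<and> B \<in> scaling_local \<AA> U \<O> \<and> sc_norm (A - B) < \<epsilon>"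
  shows "A \<in> alg"
  using assms by (simp add: scaling_algebra_def)

lemma local_subset_alg: "region \<O> \<Longrightarrow> scaling_local \<AA> U \<O> \<subseteq> alg"
  by (auto intro!: algI simp: scaling_local_iff) (metis diff_self scaling_local_iff sc_norm_zero)

lemma alg_norm_cont:
  assumes A: "A \<in> alg"
  shows "norm_cont A"
proof (rule norm_cont_limit[OF alg_bounded[OF A]])
  fix \<epsilon> :: real assume "0 < \<epsilon>"
  then obtain \<O> B where "B \<in> scaling_local \<AA> U \<O>" "sc_norm (A - B) < \<epsilon>"
    using alg_approx[OF A] by metis
  thus "\<exists>B\<in>sc_bounded. norm_cont B \<and> sc_norm (A - B) < \<epsilon>" by (auto simp: scaling_local_iff)
qed

lemma alg_diff:
  assumes A: "A \<in> alg" and B: "B \<in> alg"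
  shows "A - B \<in> alg"
proof (rule algI)
  note AB = alg_bounded[OF A] alg_bounded[OF B]
  show "A - B \<in> sc_bounded" by (intro sc_diff_bounded AB)
  fix \<epsilon> :: real assume "0 < \<epsilon>"
  hence "0 < \<epsilon> / 2" by simp
  then obtain \<O> A' B' where *: "region \<O>" "A' \<in> scaling_local \<AA> U \<O>" "B' \<in> scaling_local \<AA> U \<O>"
    "A' \<in> sc_bounded" "B' \<in> sc_bounded" "sc_norm (A - A') < \<epsilon> / 2" "sc_norm (B - B') < \<epsilon> / 2"
    by (rule alg_approx2[OF A B])
  have eq: "(A - B) - (A' - B') = (A - A') - (B - B')" by (simp add: fun_eq_iff)
  have "sc_norm ((A - B) - (A' - B')) \<le> sc_norm (A - A') + sc_norm (B - B')"
    unfolding eq by (intro sc_norm_diff_le sc_diff_bounded AB *)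
  also have "\<dots> < \<epsilon>" using * by simp
  finally show "\<exists>\<O> D. region \<O> \<and> D \<in> scaling_local \<AA> U \<O> \<and> sc_norm (A - B - D) < \<epsilon>"
    using scaling_local_diff[OF *(1-3)] *(1) by blast
qed

lemma alg_star:
  assumes A: "A \<in> alg"
  shows "sc_star A \<in> alg"
proof (rule algI)
  note Ab = alg_bounded[OF A]
  show "sc_star A \<in> sc_bounded" by (intro sc_star_bounded Ab)
  fix \<epsilon> :: real assume "0 < \<epsilon>"
  then obtain \<O> B where B: "region \<O>" "B \<in> scaling_local \<AA> U \<O>" "B \<in> sc_bounded" "sc_norm (A - B) < \<epsilon>"
    by (rule alg_approx[OF A])
  have "sc_norm (sc_star A - sc_star B) \<le> sc_norm (A - B)"
    unfolding sc_star_diff[OF Ab B(3), symmetric] by (intro sc_norm_star_le sc_diff_bounded Ab B)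
  thus "\<exists>\<O> B. region \<O> \<and> B \<in> scaling_local \<AA> U \<O> \<and> sc_norm (sc_star A - B) < \<epsilon>"
    using scaling_local_star[OF B(1,2)] B(1,4) by (meson le_less_trans)
qed

lemma alg_mult:
  assumes A: "A \<in> alg" and B: "B \<in> alg"
  shows "sc_mult A B \<in> alg"
proof (rule algI)
  note AB = alg_bounded[OF A] alg_bounded[OF B]
  show "sc_mult A B \<in> sc_bounded" by (intro sc_mult_bounded AB)
  fix \<epsilon> :: real assume \<epsilon>: "0 < \<epsilon>"
  \<comment> \<open>\<open>K\<close> dominates the norms of \<open>A\<close>, \<open>B\<close> and
    the approximant \<open>B'\<close>. The last one costs the summand 1, which is the reason for the
    cap at 1 in the tolerance \<open>?d\<close>.\<close>
  define K where "K = sc_norm A + sc_norm B + 1"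
  have K: "K > 0" using sc_norm_nonneg[OF AB(1)] sc_norm_nonneg[OF AB(2)] by (simp add: K_def)
  let ?d = "min 1 (\<epsilon> / (2 * K))"
  have "0 < ?d" using \<epsilon> K by simp
  then obtain \<O> A' B' where *: "region \<O>" "A' \<in> scaling_local \<AA> U \<O>" "B' \<in> scaling_local \<AA> U \<O>"
    "A' \<in> sc_bounded" "B' \<in> sc_bounded" "sc_norm (A - A') < ?d" "sc_norm (B - B') < ?d"
    by (rule alg_approx2[OF A B])
  have z: "(0 :: 'h sc) \<in> sc_bounded" by (intro sc_boundedI[of _ 0] bop_UNIVI[of _ 0]) auto
  have "sc_norm B' \<le> sc_norm (B' - B) + sc_norm B"
    using sc_norm_triangle[OF *(5) AB(2) z] by simp
  hence B': "sc_norm B' \<le> K"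
    using *(7) sc_norm_nonneg[OF AB(1)] by (simp add: K_def sc_norm_diff_commute[of B' B])
  have "sc_norm (sc_mult A B - sc_mult A' B')
      \<le> sc_norm A * sc_norm (B - B') + sc_norm (A - A') * sc_norm B'"
    by (intro sc_norm_mult_diff_le AB *)
  also have "\<dots> \<le> K * sc_norm (B - B') + sc_norm (A - A') * K"
    using B' sc_norm_nonneg[OF AB(1)] sc_norm_nonneg[OF AB(2)]
    by (intro add_mono mult_mono order_refl sc_norm_nonneg sc_diff_bounded AB *) (auto simp: K_def intro: less_imp_le)
  also have "\<dots> = K * (sc_norm (A - A') + sc_norm (B - B'))" by (simp add: algebra_simps)
  also have "\<dots> < K * (\<epsilon> / K)" using * K by (intro mult_strict_left_mono) (auto simp: field_simps)
  finally have "sc_norm (sc_mult A B - sc_mult A' B') < \<epsilon>" using K by simp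
  thus "\<exists>\<O> D. region \<O> \<and> D \<in> scaling_local \<AA> U \<O> \<and> sc_norm (sc_mult A B - D) < \<epsilon>"
    using scaling_local_mult[OF *(1-3)] *(1) by blast
qed

lemma alg_act:
  assumes A: "A \<in> alg" and g: "g \<in> extended_group"
  shows "sc_act U g A \<in> alg"
proof (rule algI)
  note Ab = alg_bounded[OF A]
  show "sc_act U g A \<in> sc_bounded" by (intro sc_act_bounded Ab g)
  fix \<epsilon> :: real assume "0 < \<epsilon>"
  then obtain \<O> B where B: "region \<O>" "B \<in> scaling_local \<AA> U \<O>" "B \<in> sc_bounded" "sc_norm (A - B) < \<epsilon>"
    by (rule alg_approx[OF A])
  have "sc_norm (sc_act U g A - sc_act U g B) \<le> sc_norm (A - B)"
    unfolding sc_act_diff[OF g, symmetric] by (intro sc_norm_act_le sc_diff_bounded Ab B g)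
  thus "\<exists>\<O> B. region \<O> \<and> B \<in> scaling_local \<AA> U \<O> \<and> sc_norm (sc_act U g A - B) < \<epsilon>"
    using scaling_local_act[OF g B(1,2)] region_symm_apply[OF g B(1)] B(4) by (meson le_less_trans)
qed

lemma center_alg: "C \<in> center \<Longrightarrow> C \<in> alg"
  by (simp add: scaling_center_def)

text \<open>To commute the moved central element with \<open>A\<close>, commute \<open>C\<close>
  with \<open>A\<close> moved back by the inverse, then apply the automorphism of
  \<open>g\<close>.\<close>

lemma center_act:
  assumes C: "C \<in> center" and g: "g \<in> extended_group"
  shows "sc_act U g C \<in> center"
  unfolding scaling_center_def
proof (intro CollectI conjI ballI)
  show "sc_act U g C \<in> alg" by (intro alg_act center_alg C g)
  fix A assume A: "A \<in> alg"
  obtain g' where g': "g' \<in> extended_group" "symm_mult g g' = dilation 1"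
    using extended_group_inverse[OF g] by metis
  have eq: "sc_act U g (sc_act U g' A) = A"
    using sc_act_1[OF alg_bounded[OF A]] by (simp add: sc_act_symm_mult[symmetric] g g')
  have "sc_mult C (sc_act U g' A) = sc_mult (sc_act U g' A) C"
    using C alg_act[OF A g'(1)] by (simp add: scaling_center_def)
  from arg_cong[OF this, of "sc_act U g"]
  show "sc_mult (sc_act U g C) A = sc_mult A (sc_act U g C)"
    by (simp add: sc_act_mult[OF g] eq)
qed

end


section \<open>Scalar elements\<close>

text \<open>The exponential turns the multiplicative group of scales into the additive reals, where
  the usual uniform continuity applies. Values in a metric space admit real functions and pairs
  besides complex functions.\<close>

definition mult_ucont :: "(real \<Rightarrow> 'a::metric_space) \<Rightarrow> bool" where
  "mult_ucont f \<longleftrightarrow> bounded (f ` {0<..}) \<and> uniformly_continuous_on UNIV (\<lambda>t. f (exp t))"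

lemma uniformly_continuous_on_mono:
  "uniformly_continuous_on S f \<Longrightarrow> T \<subseteq> S \<Longrightarrow> uniformly_continuous_on T f"
  for f :: "'a::metric_space \<Rightarrow> 'b::metric_space"
  unfolding uniformly_continuous_on_def by (meson subsetD)

lemma mult_ucontD:
  assumes f: "mult_ucont f" and e: "0 < e"
  obtains d where "0 < d" "\<And>a b. 0 < a \<Longrightarrow> 0 < b \<Longrightarrow> \<bar>ln a - ln b\<bar> < d \<Longrightarrow> dist (f a) (f b) < e"
proof -
  obtain d where d: "0 < d" "\<And>s t. dist s t < d \<Longrightarrow> dist (f (exp s)) (f (exp t)) < e"
    using f e unfolding mult_ucont_def uniformly_continuous_on_def by (metis UNIV_I dist_commute)
  show thesis
  proof (rule that[OF d(1)])
    fix a b :: real assume "0 < a" "0 < b" "\<bar>ln a - ln b\<bar> < d"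
    thus "dist (f a) (f b) < e" using d(2)[of "ln a" "ln b"] by (simp add: dist_real_def)
  qed
qed

text \<open>A bounded set in a Heine-Borel space has compact closure, on which a merely continuous
  \<open>k\<close> is uniformly continuous. This covers square roots, moduli, truncations and,
  through pairs, differences.\<close>

lemma mult_ucont_compose:
  fixes f :: "real \<Rightarrow> 'a::heine_borel" and k :: "'a \<Rightarrow> 'b::metric_space"
  assumes f: "mult_ucont f" and k: "continuous_on UNIV k"
  shows "mult_ucont (\<lambda>l. k (f l))"
proof -
  have comp: "compact (closure (f ` {0<..}))" using f by (simp add: mult_ucont_def compact_closure)
  have "compact (k ` closure (f ` {0<..}))"
    by (intro compact_continuous_image comp continuous_on_subset[OF k]) simp
  moreover have "(\<lambda>l. k (f l)) ` {0<..} \<subseteq> k ` closure (f ` {0<..})"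
    using closure_subset[of "f ` {0<..}"] by auto
  ultimately have "bounded ((\<lambda>l. k (f l)) ` {0<..})" by (meson bounded_subset compact_imp_bounded)
  moreover have "uniformly_continuous_on (range (\<lambda>t. f (exp t))) k"
  proof (rule uniformly_continuous_on_mono)
    show "uniformly_continuous_on (closure (f ` {0<..})) k"
      by (intro compact_uniformly_continuous comp continuous_on_subset[OF k]) simp
    show "range (\<lambda>t. f (exp t)) \<subseteq> closure (f ` {0<..})"
      using closure_subset[of "f ` {0<..}"] by auto
  qed
  ultimately show ?thesis
    using f uniformly_continuous_on_compose[of UNIV "\<lambda>t. f (exp t)" k] by (simp add: mult_ucont_def)
qed

lemma mult_ucont_Pair:
  assumes f: "mult_ucont f" and g: "mult_ucont g"
  shows "mult_ucont (\<lambda>l. (f l, g l))"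
proof -
  have "bounded (f ` {0<..} \<times> g ` {0<..})"
    using f g by (intro bounded_Times) (simp_all add: mult_ucont_def)
  hence "bounded ((\<lambda>l. (f l, g l)) ` {0<..})" by (rule bounded_subset) auto
  moreover have "uniformly_continuous_on UNIV (\<lambda>t. (f (exp t), g (exp t)))"
    unfolding uniformly_continuous_on_def
  proof (intro allI impI)
    fix e :: real assume "0 < e"
    hence e: "0 < e / 2" by simp
    obtain d1 where d1: "0 < d1" "\<And>s t. dist s t < d1 \<Longrightarrow> dist (f (exp s)) (f (exp t)) < e / 2"
      using f e unfolding mult_ucont_def uniformly_continuous_on_def by (metis UNIV_I)
    obtain d2 where d2: "0 < d2" "\<And>s t. dist s t < d2 \<Longrightarrow> dist (g (exp s)) (g (exp t)) < e / 2"
      using g e unfolding mult_ucont_def uniformly_continuous_on_def by (metis UNIV_I)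
    have "dist (f (exp s), g (exp s)) (f (exp t), g (exp t)) < e" if "dist s t < min d1 d2" for s t
    proof -
      have "dist (f (exp s), g (exp s)) (f (exp t), g (exp t))
          \<le> dist (f (exp s)) (f (exp t)) + dist (g (exp s)) (g (exp t))"
        unfolding dist_Pair_Pair by (rule sqrt_sum_squares_le_sum) simp_all
      thus ?thesis using d1(2)[of s t] d2(2)[of s t] that by simp
    qed
    thus "\<exists>d>0. \<forall>x\<in>UNIV. \<forall>x'\<in>UNIV. dist x' x < d \<longrightarrow>
        dist (f (exp x'), g (exp x')) (f (exp x), g (exp x)) < e"
      using d1(1) d2(1) by (intro exI[of _ "min d1 d2"]) auto
  qed
  ultimately show ?thesis by (simp add: mult_ucont_def)
qed

lemma mult_ucont_compose2:
  fixes f :: "real \<Rightarrow> 'a::heine_borel" and g :: "real \<Rightarrow> 'b::heine_borel"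
    and k :: "'a \<times> 'b \<Rightarrow> 'c::metric_space"
  assumes "mult_ucont f" "mult_ucont g" and k: "continuous_on UNIV k"
  shows "mult_ucont (\<lambda>l. k (f l, g l))"
  using mult_ucont_compose[OF mult_ucont_Pair[OF assms(1,2)] k] .

lemma mult_ucont_const: "mult_ucont (\<lambda>_. c)"
  by (simp add: mult_ucont_def image_constant_conv uniformly_continuous_on_const)

lemma mult_ucont_diff: "mult_ucont f \<Longrightarrow> mult_ucont g \<Longrightarrow> mult_ucont (\<lambda>l. f l - g l)"
  for f g :: "real \<Rightarrow> 'a::{heine_borel,real_normed_vector}"
  using mult_ucont_compose2[of f g "\<lambda>p. fst p - snd p"] by (simp add: continuous_intros)

text \<open>In the logarithmic coordinate a dilation is a translation by
  \<open>ln \<mu>\<close>.\<close>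

lemma mult_ucont_dilate:
  assumes f: "mult_ucont f" and \<mu>: "\<mu> > 0"
  shows "mult_ucont (\<lambda>l. f (l * \<mu>))"
proof -
  have "(\<lambda>l. f (l * \<mu>)) ` {0<..} \<subseteq> f ` {0<..}" using \<mu> by auto
  moreover have "uniformly_continuous_on (range (\<lambda>t. t + ln \<mu>)) (\<lambda>t. f (exp t))"
    using f uniformly_continuous_on_mono[OF _ subset_UNIV] unfolding mult_ucont_def by blast
  hence "uniformly_continuous_on UNIV (\<lambda>t. f (exp (t + ln \<mu>)))"
    by (rule uniformly_continuous_on_compose[rotated]) (intro continuous_intros)
  ultimately show ?thesis
    using f \<mu> by (auto simp: mult_ucont_def exp_add intro: bounded_subset)
qed

definition sc_scalar :: "(real \<Rightarrow> complex) \<Rightarrow> 'h::chilbert_space sc" where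
  "sc_scalar f = (\<lambda>l x. if l > 0 then f l *\<^sub>C x else 0)"

lemma sc_scalar_add: "sc_scalar f + sc_scalar g = sc_scalar (\<lambda>l. f l + g l)"
  by (simp add: sc_scalar_def fun_eq_iff scaleC_add_left)

lemma sc_scalar_diff: "sc_scalar f - sc_scalar g = sc_scalar (\<lambda>l. f l - g l)"
  by (simp add: sc_scalar_def fun_eq_iff scaleC_diff_left)

lemma sc_scalar_scale: "sc_scale c (sc_scalar f) = sc_scalar (\<lambda>l. c * f l)"
  by (simp add: sc_scalar_def sc_scale_def fun_eq_iff scaleC_scaleC)

lemma sc_scalar_mult: "sc_mult (sc_scalar f) (sc_scalar g) = sc_scalar (\<lambda>l. f l * g l)"
  by (simp add: sc_scalar_def sc_mult_def fun_eq_iff scaleC_scaleC)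

lemma sc_scalar_one: "sc_one = sc_scalar (\<lambda>_. 1)"
  by (simp add: sc_scalar_def sc_one_def fun_eq_iff)

lemma sc_scalar_star: "sc_star (sc_scalar f) = sc_scalar (\<lambda>l. cnj (f l))"
  unfolding sc_star_def
  by (rule ext, rule cadj_eqI) (simp add: sc_scalar_def cinner_scaleC_left cinner_scaleC_right)

lemma sc_scalar_cong: "(\<And>l. l > 0 \<Longrightarrow> f l = g l) \<Longrightarrow> sc_scalar f = sc_scalar g"
  by (auto simp: sc_scalar_def fun_eq_iff)

lemma sc_norm_scalar_le: "(\<And>l. l > 0 \<Longrightarrow> cmod (f l) \<le> K) \<Longrightarrow> 0 \<le> K \<Longrightarrow> sc_norm (sc_scalar f) \<le> K"
  by (rule sc_norm_leI) (auto simp: sc_scalar_def norm_scaleC intro: mult_right_mono)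

lemma sc_scalar_bounded:
  assumes "mult_ucont f"
  shows "sc_scalar f \<in> sc_bounded"
proof -
  obtain K where K: "\<And>l. l > 0 \<Longrightarrow> cmod (f l) \<le> K"
    using assms by (auto simp: mult_ucont_def bounded_iff)
  show ?thesis
  proof (rule sc_boundedI)
    show n: "norm (sc_scalar f l x) \<le> K * norm x" if "l > 0" for l and x :: 'a
      using K[OF that] that by (simp add: sc_scalar_def norm_scaleC mult_right_mono)
    show "sc_scalar f l \<in> bop_on (UNIV :: 'a set)" if "l > 0" for l
      by (rule bop_UNIVI[OF _ _ n[OF that]])
        (simp_all add: sc_scalar_def scaleC_add_right scaleC_scaleC mult.commute)
  qed (simp add: sc_scalar_def fun_eq_iff)
qed

context vacuum_net
begin

lemma sc_act_scalar:
  assumes "g \<in> extended_group"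
  shows "sc_act U g (sc_scalar f) = sc_scalar (\<lambda>l. f (l * fst g))"
proof -
  obtain \<mu> p where p: "\<mu> > 0" "\<mu> = fst g" "\<And>l. p l \<in> poincare_group"
      "\<And>B l. sc_act U g B l = ad (U (p l)) (B (l * \<mu>))"
    using sc_act_eq[OF assms] by metis
  show ?thesis
    using p(1) by (intro ext) (auto simp: p(2)[symmetric] p(4) ad_def sc_scalar_def zero_less_mult_iff
      bop_UNIV_scale[OF U_bop[OF p(3)]] bop_UNIV_zero[OF U_bop[OF p(3)]] unitary_UNIV_cadj[OF unitary[OF p(3)]])
qed

text \<open>Multiplying both arguments by \<open>l\<close> does not change the difference of their
  logarithms, so the modulus of continuity is uniform in the scale, as the supremum norm
  requires.\<close>

lemma sc_scalar_norm_cont: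
  assumes f: "mult_ucont f"
  shows "norm_cont (sc_scalar f)"
  unfolding norm_cont_def
proof (intro ballI tendstoI)
  fix g :: "'s symm" and e :: real assume g: "g \<in> extended_group" and e: "0 < e"
  have pos: "fst h > 0" if "h \<in> extended_group" for h :: "'s symm"
    using that by (auto simp: extended_group_def)
  obtain d where d: "0 < d" "\<And>a b. 0 < a \<Longrightarrow> 0 < b \<Longrightarrow> \<bar>ln a - ln b\<bar> < d \<Longrightarrow> dist (f a) (f b) < e / 2"
    using mult_ucontD[OF f, of "e / 2"] e by auto
  have "((\<lambda>h. ln (fst h)) \<longlongrightarrow> ln (fst g)) (at g within extended_group)"
    using pos[OF g] by (intro tendsto_intros) auto
  hence "\<forall>\<^sub>F h in at g within extended_group. dist (ln (fst h)) (ln (fst g)) < d"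
    using d(1) by (rule tendstoD)
  moreover have "\<forall>\<^sub>F h in at g within extended_group. h \<in> extended_group"
    by (simp add: eventually_at_filter)
  ultimately show "\<forall>\<^sub>F h in at g within extended_group.
      dist (sc_norm (sc_act U h (sc_scalar f) - sc_act U g (sc_scalar f))) 0 < e"
  proof eventually_elim
    case (elim h)
    have eq: "sc_act U h (sc_scalar f) - sc_act U g (sc_scalar f)
        = sc_scalar (\<lambda>l. f (l * fst h) - f (l * fst g))"
      by (simp add: sc_act_scalar elim(2) g sc_scalar_diff)
    have "sc_norm (sc_act U h (sc_scalar f) - sc_act U g (sc_scalar f)) \<le> e / 2"
      unfolding eq
    proof (rule sc_norm_scalar_le)
      fix l :: real assume "l > 0"
      hence "dist (f (l * fst h)) (f (l * fst g)) < e / 2"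
        using pos[OF g] pos[OF elim(2)] elim(1) by (intro d(2)) (auto simp: ln_mult dist_real_def)
      thus "cmod (f (l * fst h) - f (l * fst g)) \<le> e / 2" by (simp add: dist_norm)
    qed (use e in simp)
    moreover have "0 \<le> sc_norm (sc_act U h (sc_scalar f) - sc_act U g (sc_scalar f))"
      by (intro sc_norm_nonneg sc_diff_bounded sc_act_bounded sc_scalar_bounded f g elim(2))
    ultimately show ?case using e by simp
  qed
qed

text \<open>This permits means to be applied to functions of the scale. Scalars belong to every von
  Neumann algebra, so any region localizes them; the unit ball is an arbitrary choice.\<close>

lemma sc_scalar_center:
  assumes f: "mult_ucont f"
  shows "sc_scalar f \<in> center"
proof -
  have r: "region (ball 0 1)" by (simp add: region_def)
  have "sc_scalar f l \<in> \<AA> ((*\<^sub>R) l ` ball 0 1)" if "l > 0" for l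
    using von_neumann_algebra_scalar[OF von_neumann[OF region_scaleR[OF r that]], of "f l"] that
    by (simp add: sc_scalar_def)
  hence "sc_scalar f \<in> scaling_local \<AA> U (ball 0 1)"
    by (simp add: scaling_local_iff sc_scalar_bounded sc_scalar_norm_cont f)
  hence "sc_scalar f \<in> alg" using local_subset_alg[OF r] by blast
  moreover have "sc_mult (sc_scalar f) A = sc_mult A (sc_scalar f)" if "A \<in> alg" for A
    using alg_bounded[OF that]
    by (auto simp: sc_mult_def sc_scalar_def fun_eq_iff bop_UNIV_scale[OF sc_bounded_bop]
        bop_UNIV_zero[OF sc_bounded_bop])
  ultimately show ?thesis by (simp add: scaling_center_def)
qed

section \<open>Vacuum expectation values as functions of the scale\<close>

abbreviation vev :: "'h sc \<Rightarrow> real \<Rightarrow> complex" where "vev A l \<equiv> \<Omega> \<bullet>\<^sub>C A l \<Omega>"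

text \<open>Invariance of the vacuum removes the Poincare part, so only the dilation factor is
  felt.\<close>

lemma vev_act:
  assumes g: "g \<in> extended_group"
  shows "vev (sc_act U g A) l = vev A (l * fst g)"
proof -
  obtain \<mu> p where p: "\<mu> = fst g" "\<And>l. p l \<in> poincare_group"
      "\<And>B l. sc_act U g B l = ad (U (p l)) (B (l * \<mu>))"
    using sc_act_eq[OF g] by metis
  show ?thesis
    by (simp add: p(1)[symmetric] p(3) ad_def cadj_U_vacuum[OF p(2)]
        cinner_cadj_left[OF U_bop[OF p(2)], symmetric])
qed

lemma vev_bound: "A \<in> sc_bounded \<Longrightarrow> cmod (vev A l) \<le> sc_norm A"
  using order_trans[OF cinner_cauchy_schwarz, of \<Omega> "A l \<Omega>" "sc_norm A"] norm_le_sc_norm[of A l \<Omega>]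
  by (simp add: norm_vacuum)

text \<open>Changing the scale by a factor \<mu> changes the expectation value by at most the norm
  of the dilated element minus the element itself, uniformly in the scale. Norm continuity of the
  orbit at the identity thus yields uniform continuity in the logarithm.\<close>

lemma mult_ucont_vev:
  assumes A: "A \<in> alg"
  shows "mult_ucont (vev A)"
  unfolding mult_ucont_def
proof
  note Ab = alg_bounded[OF A]
  show "bounded (vev A ` {0<..})" using vev_bound[OF Ab] by (auto simp: bounded_iff)
  show "uniformly_continuous_on UNIV (\<lambda>t. vev A (exp t))"
    unfolding uniformly_continuous_on_def
  proof (intro allI impI)
    fix e :: real assume e: "0 < e"
    let ?E = "extended_group :: 's symm set"
    have d1: "dilation 1 \<in> ?E" by (simp add: dilation_extended)
    have "\<forall>\<^sub>F h in at (dilation 1) within ?E. dist (sc_norm (sc_act U h A - sc_act U (dilation 1) A)) 0 < e"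
      by (rule tendstoD[OF norm_contD[OF alg_norm_cont[OF A] d1] e])
    then obtain \<delta> where \<delta>: "\<delta> > 0" "\<forall>h\<in>?E. h \<noteq> dilation 1 \<and> dist h (dilation 1) < \<delta> \<longrightarrow>
        dist (sc_norm (sc_act U h A - sc_act U (dilation 1) A)) 0 < e"
      unfolding eventually_at by blast
    have near: "cmod (vev A (l * \<mu>) - vev A l) < e" if "\<mu> > 0" "\<bar>\<mu> - 1\<bar> < \<delta>" for l \<mu>
    \<comment> \<open>The limit filter excludes its own base point, so the factor 1 is treated
      separately.\<close>
    proof (cases "\<mu> = 1")
      case False
      have dd: "dilation \<mu> \<in> ?E" by (rule dilation_extended[OF \<open>\<mu> > 0\<close>])
      have "dist (dilation \<mu> :: 's symm) (dilation 1) = \<bar>\<mu> - 1\<bar>"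
        by (simp add: dilation_def dist_Pair_Pair dist_real_def)
      hence "sc_norm (sc_act U (dilation \<mu>) A - sc_act U (dilation 1) A) < e"
        using that False bspec[OF \<delta>(2) dd] by (simp add: dilation_def)
      moreover have "cmod (vev (sc_act U (dilation \<mu>) A - sc_act U (dilation 1) A) l)
          \<le> sc_norm (sc_act U (dilation \<mu>) A - sc_act U (dilation 1) A)"
        by (intro vev_bound sc_diff_bounded sc_act_bounded dd d1 Ab)
      moreover have "vev (sc_act U (dilation \<mu>) A - sc_act U (dilation 1) A) l = vev A (l * \<mu>) - vev A l"
        using vev_act[OF dd, of A l] vev_act[OF d1, of A l] by (simp add: cinner_diff_right dilation_def)
      ultimately show ?thesis by simp
    qed (use e in simp)
    have "(exp \<longlongrightarrow> (1::real)) (at 0)" using isCont_exp[of "0::real"] by (simp add: isCont_def)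
    from LIM_D[OF this \<delta>(1)] obtain \<eta> where \<eta>: "\<eta> > 0" "\<And>t::real. t \<noteq> 0 \<Longrightarrow> \<bar>t\<bar> < \<eta> \<Longrightarrow> \<bar>exp t - 1\<bar> < \<delta>"
      by auto
    have "dist (vev A (exp s)) (vev A (exp t)) < e" if "dist s t < \<eta>" for s t
    proof (cases "s = t")
      case False
      hence "\<bar>exp (s - t) - 1\<bar> < \<delta>" using that by (intro \<eta>(2)) (auto simp: dist_real_def)
      from near[OF _ this, of "exp t"] show ?thesis by (simp add: dist_norm exp_add[symmetric])
    qed (use e in simp)
    thus "\<exists>d>0. \<forall>x\<in>UNIV. \<forall>x'\<in>UNIV. dist x' x < d \<longrightarrow> dist (vev A (exp x')) (vev A (exp x)) < e"
      using \<eta>(1) by blast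
  qed
qed

lemma sc_expect_eq: "A \<in> sc_bounded \<Longrightarrow> sc_expect \<Omega> A = sc_scalar (vev A)"
  by (auto simp: sc_expect_def sc_scalar_def fun_eq_iff sc_bounded_neg)

lemma vev_scalar: "l > 0 \<Longrightarrow> vev (sc_scalar f) l = f l"
  by (simp add: sc_scalar_def cinner_scaleC_right cinner_self norm_vacuum)

end


section \<open>Limit states\<close>

text \<open>Kept for an arbitrary asymptotic mean because it is interpreted for two kinds of means
  in the end: the multiplicative one and each invariant one.\<close>

locale limit_gns = vacuum_net \<AA> U \<Omega>
  for \<AA> :: "'s::finite minkowski set \<Rightarrow> ('h::chilbert_space \<Rightarrow> 'h) set"
    and U :: "'s symm \<Rightarrow> 'h \<Rightarrow> 'h" and \<Omega> :: 'h +
  fixes m :: "'h sc \<Rightarrow> complex"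
    and H :: "'h gns set" and \<pi> :: "'h sc \<Rightarrow> 'h gns \<Rightarrow> 'h gns" and \<xi> :: "'h gns"
  assumes mean: "asymptotic_mean \<AA> U m"
    and gns: "is_gns (scaling_algebra \<AA> U) (limit_state \<Omega> m) H \<pi> \<xi>"
begin

abbreviation \<phi> :: "'h sc \<Rightarrow> complex" where "\<phi> \<equiv> limit_state \<Omega> m"

lemma phi_eq: "A \<in> alg \<Longrightarrow> \<phi> A = m (sc_scalar (vev A))"
  by (simp add: limit_state_def sc_expect_eq alg_bounded)

lemma mean_add: "C \<in> center \<Longrightarrow> D \<in> center \<Longrightarrow> m (C + D) = m C + m D"
  and mean_scale: "C \<in> center \<Longrightarrow> m (sc_scale c C) = c * m C"
  and mean_nonneg: "C \<in> center \<Longrightarrow> m (sc_mult (sc_star C) C) \<in> \<real>\<^sub>\<ge>\<^sub>0"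
  and mean_one: "m sc_one = 1"
  and mean_asymptotic: "C \<in> center \<Longrightarrow> \<forall>\<^sub>F l in at_right 0. C l = 0 \<Longrightarrow> m C = 0"
  using mean by (simp_all add: asymptotic_mean_def is_state_def)

section \<open>Means of scalar functions\<close>

lemma mean_scalar_diff:
  assumes f: "mult_ucont f" and g: "mult_ucont g"
  shows "m (sc_scalar (\<lambda>l. f l - g l)) = m (sc_scalar f) - m (sc_scalar g)"
proof -
  have "m (sc_scalar (\<lambda>l. f l - g l)) + m (sc_scalar g)
      = m (sc_scalar (\<lambda>l. f l - g l) + sc_scalar g)"
    by (intro mean_add[symmetric] sc_scalar_center mult_ucont_diff f g)
  thus ?thesis by (simp add: sc_scalar_add eq_diff_eq)
qed

lemma mean_scalar_const: "m (sc_scalar (\<lambda>_. c)) = c"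
proof -
  have "m (sc_scale c (sc_scalar (\<lambda>_. 1))) = c * m (sc_scalar (\<lambda>_. 1))"
    by (intro mean_scale sc_scalar_center mult_ucont_const)
  thus ?thesis by (simp add: sc_scalar_scale mean_one[unfolded sc_scalar_one])
qed

lemma mult_ucont_of_real: "mult_ucont f \<Longrightarrow> mult_ucont (\<lambda>l. complex_of_real (f l))"
  by (auto intro!: mult_ucont_compose[where k = complex_of_real] continuous_intros)

text \<open>Positivity of a state concerns products \<open>sc_mult (sc_star C) C\<close>. A
  nonnegative function has this form, with its square root as \<open>C\<close>, and the square root
  is again central.\<close>

lemma mean_scalar_nonneg:
  assumes f: "mult_ucont f" and pos: "\<And>l. l > 0 \<Longrightarrow> 0 \<le> f l"
  shows "0 \<le> Re (m (sc_scalar (\<lambda>l. complex_of_real (f l))))"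
proof -
  let ?s = "sc_scalar (\<lambda>l. complex_of_real (sqrt (f l))) :: 'h sc"
  have "mult_ucont (\<lambda>l. sqrt (f l))" by (rule mult_ucont_compose[OF f]) (intro continuous_intros)
  hence "?s \<in> center" by (intro sc_scalar_center mult_ucont_of_real)
  hence "m (sc_mult (sc_star ?s) ?s) \<in> \<real>\<^sub>\<ge>\<^sub>0" by (rule mean_nonneg)
  also have "sc_mult (sc_star ?s) ?s = sc_scalar (\<lambda>l. complex_of_real (f l))"
    unfolding sc_scalar_star sc_scalar_mult
    by (rule sc_scalar_cong) (simp add: pos flip: of_real_mult)
  finally show ?thesis by (simp add: complex_nonneg_Reals_iff)
qed

section \<open>GNS vectors of a limit state\<close>

lemma H_closed: "closed_csubspace H"
  and pi_bop: "A \<in> alg \<Longrightarrow> \<pi> A \<in> bop_on H"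
  and pi_add: "A \<in> alg \<Longrightarrow> B \<in> alg \<Longrightarrow> x \<in> H \<Longrightarrow> \<pi> (A + B) x = \<pi> A x + \<pi> B x"
  and pi_mult: "A \<in> alg \<Longrightarrow> B \<in> alg \<Longrightarrow> x \<in> H \<Longrightarrow> \<pi> (sc_mult A B) x = \<pi> A (\<pi> B x)"
  and pi_scale: "A \<in> alg \<Longrightarrow> x \<in> H \<Longrightarrow> \<pi> (sc_scale c A) x = c *\<^sub>C \<pi> A x"
  and pi_star: "A \<in> alg \<Longrightarrow> x \<in> H \<Longrightarrow> y \<in> H \<Longrightarrow> \<pi> (sc_star A) x \<bullet>\<^sub>C y = x \<bullet>\<^sub>C \<pi> A y"
  and xi_in: "\<xi> \<in> H"
  and cyclic: "closure {\<pi> A \<xi> |A. A \<in> alg} = H"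
  and gns_state: "A \<in> alg \<Longrightarrow> \<xi> \<bullet>\<^sub>C \<pi> A \<xi> = \<phi> A"
  using gns by (simp_all add: is_gns_def)

lemma pi_xi_in: "A \<in> alg \<Longrightarrow> \<pi> A \<xi> \<in> H"
  by (rule bop_onD(1)[OF pi_bop xi_in])

lemma pi_diff:
  assumes "A \<in> alg" "B \<in> alg" "x \<in> H"
  shows "\<pi> (A - B) x = \<pi> A x - \<pi> B x"
  using pi_add[OF alg_diff[OF assms(1,2)] assms(2,3)] by simp

lemma gns_inner:
  assumes A: "A \<in> alg" and B: "B \<in> alg"
  shows "\<pi> A \<xi> \<bullet>\<^sub>C \<pi> B \<xi> = \<phi> (sc_mult (sc_star A) B)"
proof -
  have "\<pi> A \<xi> \<bullet>\<^sub>C \<pi> B \<xi> = cnj (\<pi> (sc_star A) (\<pi> B \<xi>) \<bullet>\<^sub>C \<xi>)"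
    using pi_star[OF A pi_xi_in[OF B] xi_in] by (metis cinner_commute)
  also have "\<dots> = \<xi> \<bullet>\<^sub>C \<pi> (sc_mult (sc_star A) B) \<xi>"
    by (simp add: pi_mult alg_star A B xi_in cinner_commute[of \<xi>])
  finally show ?thesis by (simp add: gns_state alg_mult alg_star A B)
qed

lemma vev_star_mult: "A \<in> sc_bounded \<Longrightarrow> vev (sc_mult (sc_star A) A) l = complex_of_real ((norm (A l \<Omega>))\<^sup>2)"
  by (simp add: sc_mult_def sc_star_def cinner_cadj sc_bounded_bop cinner_self)

lemma
  assumes A: "A \<in> alg"
  shows gns_norm: "complex_of_real ((norm (\<pi> A \<xi>))\<^sup>2) = m (sc_scalar (\<lambda>l. complex_of_real ((norm (A l \<Omega>))\<^sup>2)))"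
    and mult_ucont_norm: "mult_ucont (\<lambda>l. (norm (A l \<Omega>))\<^sup>2)"
proof -
  have AA: "sc_mult (sc_star A) A \<in> alg" by (intro alg_mult alg_star A)
  have eq: "vev (sc_mult (sc_star A) A) = (\<lambda>l. complex_of_real ((norm (A l \<Omega>))\<^sup>2))"
    by (rule ext) (rule vev_star_mult[OF alg_bounded[OF A]])
  show "complex_of_real ((norm (\<pi> A \<xi>))\<^sup>2) = m (sc_scalar (\<lambda>l. complex_of_real ((norm (A l \<Omega>))\<^sup>2)))"
    unfolding cinner_self[symmetric] gns_inner[OF A A] phi_eq[OF AA] eq ..
  have "mult_ucont (\<lambda>l. Re (vev (sc_mult (sc_star A) A) l))"
    by (rule mult_ucont_compose[OF mult_ucont_vev[OF AA]]) (intro continuous_intros)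
  thus "mult_ucont (\<lambda>l. (norm (A l \<Omega>))\<^sup>2)"
    by (simp only: vev_star_mult[OF alg_bounded[OF A]] Re_complex_of_real)
qed

text \<open>Positivity of the mean on the function
  \<open>(sc_norm A)\<^sup>2 - (norm (A l \<Omega>))\<^sup>2\<close>. The resulting contraction
  carries norm limits in the scaling algebra over to GNS vectors.\<close>

lemma norm_gns_le:
  assumes A: "A \<in> alg"
  shows "norm (\<pi> A \<xi>) \<le> sc_norm A"
proof -
  let ?K = "(sc_norm A)\<^sup>2" and ?N = "\<lambda>l. (norm (A l \<Omega>))\<^sup>2"
  have N: "mult_ucont ?N" by (rule mult_ucont_norm[OF A])
  have "0 \<le> Re (m (sc_scalar (\<lambda>l. complex_of_real (?K - ?N l))))"
  proof (rule mean_scalar_nonneg)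
    show "mult_ucont (\<lambda>l. ?K - ?N l)" by (intro mult_ucont_diff mult_ucont_const N)
    show "0 \<le> ?K - ?N l" for l
      using norm_le_sc_norm[OF alg_bounded[OF A], of l \<Omega>] by (simp add: norm_vacuum power_mono)
  qed
  also have "m (sc_scalar (\<lambda>l. complex_of_real (?K - ?N l)))
      = complex_of_real ?K - complex_of_real ((norm (\<pi> A \<xi>))\<^sup>2)"
    unfolding of_real_diff gns_norm[OF A]
    by (simp only: mean_scalar_diff[OF mult_ucont_const mult_ucont_of_real[OF N]] mean_scalar_const)
  finally have "(norm (\<pi> A \<xi>))\<^sup>2 \<le> (sc_norm A)\<^sup>2" by simp
  thus ?thesis by (rule power2_le_imp_le) (intro sc_norm_nonneg alg_bounded A)
qed

text \<open>An asymptotic mean is known to vanish only on functions that are zero near 0. Lowering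
  the squared modulus of \<open>f\<close> by \<epsilon> and truncating reaches that case, so the
  mean of the squared modulus is at most every \<epsilon>. The GNS representation then plays the
  role of the Cauchy-Schwarz inequality and transfers this to \<open>f\<close>.\<close>

lemma mean_null:
  assumes f: "mult_ucont f" and lim: "(f \<longlongrightarrow> 0) (at_right 0)"
  shows "m (sc_scalar f) = 0"
proof -
  have alg: "sc_scalar f \<in> alg" by (intro center_alg sc_scalar_center f)
  let ?N = "\<lambda>l. (cmod (f l))\<^sup>2"
  have Nu: "mult_ucont ?N" by (rule mult_ucont_compose[OF f]) (intro continuous_intros)
  have "norm (sc_scalar f l \<Omega>) = cmod (f l)" if "l > 0" for l
    using that by (simp add: sc_scalar_def norm_scaleC norm_vacuum)
  hence eq: "sc_scalar (\<lambda>l. complex_of_real ((norm (sc_scalar f l \<Omega>))\<^sup>2)) = (sc_scalar (\<lambda>l. complex_of_real (?N l)) :: 'h sc)"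
    by (intro sc_scalar_cong) simp
  have norm_eq: "complex_of_real ((norm (\<pi> (sc_scalar f) \<xi>))\<^sup>2) = m (sc_scalar (\<lambda>l. complex_of_real (?N l)))"
    unfolding gns_norm[OF alg] eq ..
  have "(norm (\<pi> (sc_scalar f) \<xi>))\<^sup>2 \<le> \<epsilon>" if \<epsilon>: "\<epsilon> > 0" for \<epsilon>
  proof -
    \<comment> \<open>\<open>?P\<close> vanishes near 0, so the mean does not see it, and
      \<open>?Q\<close> is nonnegative. They are linked by Q = \<epsilon> - (N - P), so positivity
      on \<open>?Q\<close> says that the mean of \<open>?N\<close> is at most \<epsilon>.\<close>
    let ?P = "\<lambda>l. max 0 (?N l - \<epsilon>)" and ?Q = "\<lambda>l. max 0 (\<epsilon> - ?N l)"
    have P: "mult_ucont ?P" by (rule mult_ucont_compose[OF f]) (intro continuous_intros)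
    have Q: "mult_ucont ?Q" by (rule mult_ucont_compose[OF f]) (intro continuous_intros)
    have "(?N \<longlongrightarrow> 0\<^sup>2) (at_right 0)" by (intro tendsto_power tendsto_norm_zero lim)
    hence "\<forall>\<^sub>F l in at_right 0. ?N l < \<epsilon>" using \<epsilon> by (intro order_tendstoD(2)) auto
    hence "\<forall>\<^sub>F l in at_right 0. sc_scalar (\<lambda>l. complex_of_real (?P l)) l = (0 :: 'h \<Rightarrow> 'h)"
      by eventually_elim (simp add: sc_scalar_def fun_eq_iff)
    hence 0: "m (sc_scalar (\<lambda>l. complex_of_real (?P l))) = 0"
      by (intro mean_asymptotic sc_scalar_center mult_ucont_of_real P)
    have "?Q l = \<epsilon> - (?N l - ?P l)" for l by simp
    hence "0 \<le> Re (m (sc_scalar (\<lambda>l. complex_of_real (\<epsilon> - (?N l - ?P l)))))"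
      using mean_scalar_nonneg[OF Q] by simp
    also have "m (sc_scalar (\<lambda>l. complex_of_real (\<epsilon> - (?N l - ?P l))))
        = complex_of_real \<epsilon> - (complex_of_real ((norm (\<pi> (sc_scalar f) \<xi>))\<^sup>2) - 0)"
      unfolding of_real_diff norm_eq 0[symmetric]
      by (simp only: mean_scalar_diff mean_scalar_const mult_ucont_const mult_ucont_diff
          mult_ucont_of_real[OF Nu] mult_ucont_of_real[OF P])
    finally show ?thesis by simp
  qed
  hence "(norm (\<pi> (sc_scalar f) \<xi>))\<^sup>2 \<le> 0" by (rule field_le_epsilon[of _ 0, simplified])
  \<comment> \<open>With the vector vanishes its inner product with \<xi>, and that is the mean of
    \<open>f\<close>.\<close>
  hence "\<pi> (sc_scalar f) \<xi> = 0" by simp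
  hence "\<phi> (sc_scalar f) = 0" using gns_state[OF alg] by simp
  moreover have "sc_scalar (vev (sc_scalar f)) = (sc_scalar f :: 'h sc)"
    by (rule sc_scalar_cong) (rule vev_scalar)
  ultimately show ?thesis by (simp add: phi_eq alg)
qed

lemma phi_act_of_convergent:
  assumes A: "A \<in> alg" and g: "g \<in> extended_group" and lim: "(vev A \<longlongrightarrow> L) (at_right 0)"
  shows "\<phi> (sc_act U g A) = \<phi> A"
proof -
  let ?f = "vev A"
  have f: "mult_ucont ?f" by (rule mult_ucont_vev[OF A])
  have pos: "fst g > 0" using g by (auto simp: extended_group_def)
  have df: "mult_ucont (\<lambda>l. ?f (l * fst g))" by (rule mult_ucont_dilate[OF f pos])
  have "filterlim (\<lambda>l. l * fst g) (at_right 0) (at_right 0)"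
    unfolding filterlim_at using pos
    by (auto intro!: tendsto_eq_intros eventually_at_right_less simp: eventually_at_filter)
  hence "((\<lambda>l. ?f (l * fst g) - ?f l) \<longlongrightarrow> L - L) (at_right 0)"
    by (intro tendsto_diff lim filterlim_compose[OF lim])
  hence "m (sc_scalar (\<lambda>l. ?f (l * fst g) - ?f l)) = 0"
    by (intro mean_null mult_ucont_diff df f) simp
  hence "m (sc_scalar (\<lambda>l. ?f (l * fst g))) = m (sc_scalar ?f)"
    by (simp add: mean_scalar_diff df f)
  moreover have "vev (sc_act U g A) = (\<lambda>l. ?f (l * fst g))"
    by (rule ext) (rule vev_act[OF g])
  ultimately show ?thesis by (simp add: phi_eq A alg_act g del: sc_act.simps)
qed

lemma poincare_stabilizer: "poincare_group \<subseteq> state_stabilizer \<AA> U \<phi>"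
proof
  fix g :: "'s symm" assume "g \<in> poincare_group"
  hence g: "g \<in> extended_group" "fst g = 1"
    using poincare_subset_extended by (auto simp: poincare_group_def)
  have "vev (sc_act U g A) = vev A" for A
    using vev_act[OF g(1), of A] by (intro ext) (simp add: g(2) del: sc_act.simps)
  thus "g \<in> state_stabilizer \<AA> U \<phi>"
    by (simp add: state_stabilizer_def g phi_eq alg_act del: sc_act.simps)
qed

lemma dilation_stabilizer:
  assumes "invariant_mean \<AA> U m" and \<mu>: "\<mu> > 0"
  shows "dilation \<mu> \<in> state_stabilizer \<AA> U \<phi>"
proof -
  have d: "(dilation \<mu> :: 's symm) \<in> extended_group" by (rule dilation_extended[OF \<mu>])
  have "\<phi> (sc_act U (dilation \<mu>) A) = \<phi> A" if A: "A \<in> alg" for A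
  proof -
    have "vev (sc_act U (dilation \<mu>) A) = (\<lambda>l. vev A (l * \<mu>))"
      using vev_act[OF d, of A] by (intro ext) (simp add: dilation_def)
    hence "\<phi> (sc_act U (dilation \<mu>) A) = m (sc_scalar (\<lambda>l. vev A (l * \<mu>)))"
      by (simp add: phi_eq alg_act A d)
    \<comment> \<open>This identity covers nonpositive arguments as well, where both sides are 0,
      since a positive factor keeps the sign.\<close>
    also have "sc_scalar (\<lambda>l. vev A (l * \<mu>)) = (\<lambda>l. sc_scalar (vev A) (\<mu> * l))"
      using \<mu> by (simp add: sc_scalar_def fun_eq_iff mult.commute zero_less_mult_iff)
    also have "m \<dots> = m (sc_scalar (vev A))"
      using assms sc_scalar_center[OF mult_ucont_vev[OF A]] by (simp add: invariant_mean_def)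
    finally show ?thesis by (simp add: phi_eq A)
  qed
  thus ?thesis using d by (simp add: state_stabilizer_def)
qed

end


section \<open>Unitary implementation on a convergent subalgebra\<close>

lemma unitary_between_bop: "unitary_between S S V \<Longrightarrow> V \<in> bop_on S"
  by (auto simp: unitary_between_def bop_on_def norm_eq_sqrt_cinner intro!: exI[of _ 1])

locale convergent_limit = limit_gns \<AA> U \<Omega> m H \<pi> \<xi>
  for \<AA> :: "'s::finite minkowski set \<Rightarrow> ('h::chilbert_space \<Rightarrow> 'h) set"
    and U :: "'s symm \<Rightarrow> 'h \<Rightarrow> 'h" and \<Omega> :: 'h and m :: "'h sc \<Rightarrow> complex"
    and H :: "'h gns set" and \<pi> :: "'h sc \<Rightarrow> 'h gns \<Rightarrow> 'h gns" and \<xi> :: "'h gns" +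
  fixes conv :: "'h sc set"
  assumes conv: "convergent_scaling_limit \<AA> U \<Omega> conv" and multiplicative: "multiplicative_mean \<AA> U m"
begin

lemma conv_alg: "A \<in> conv \<Longrightarrow> A \<in> alg"
  and conv_act: "A \<in> conv \<Longrightarrow> g \<in> extended_group \<Longrightarrow> sc_act U g A \<in> conv"
  and conv_add: "A \<in> conv \<Longrightarrow> B \<in> conv \<Longrightarrow> A + B \<in> conv"
  and conv_mult: "A \<in> conv \<Longrightarrow> B \<in> conv \<Longrightarrow> sc_mult A B \<in> conv"
  and conv_scale: "A \<in> conv \<Longrightarrow> sc_scale c A \<in> conv"
  and conv_star: "A \<in> conv \<Longrightarrow> sc_star A \<in> conv"
  and conv_zero: "0 \<in> conv"
  and conv_lim: "A \<in> conv \<Longrightarrow> \<exists>L. (vev A \<longlongrightarrow> L) (at_right 0)"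
  using conv by (auto simp: convergent_scaling_limit_def cstar_subalgebra_def simp del: sc_act.simps)

text \<open>Here multiplicativity of the mean enters, through the density clause of the convergent
  scaling limit.\<close>

lemma local_weak_approx:
  assumes "region \<O>"
  shows "gns_local_algebra \<AA> U H \<pi> \<O> \<subseteq> weak_closure_on H (\<pi> ` (scaling_local \<AA> U \<O> \<inter> conv))"
  using conv mean multiplicative gns assms unfolding convergent_scaling_limit_def by blast

lemma phi_act:
  assumes "A \<in> conv" "g \<in> extended_group"
  shows "\<phi> (sc_act U g A) = \<phi> A"
proof -
  obtain L where "(vev A \<longlongrightarrow> L) (at_right 0)" using conv_lim[OF assms(1)] by blast
  thus ?thesis by (rule phi_act_of_convergent[OF conv_alg[OF assms(1)] assms(2)])
qed

lemma closure_conv_subspace: "closed_csubspace (closure ((\<lambda>A. \<pi> A \<xi>) ` conv))"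
proof (rule closed_csubspace_closure)
  have "\<pi> 0 \<xi> = 0"
    using pi_diff[OF conv_alg[OF conv_zero] conv_alg[OF conv_zero] xi_in] by simp
  thus "0 \<in> (\<lambda>A. \<pi> A \<xi>) ` conv" using conv_zero by (metis imageI)
  show "x + y \<in> (\<lambda>A. \<pi> A \<xi>) ` conv" if xy: "x \<in> (\<lambda>A. \<pi> A \<xi>) ` conv" "y \<in> (\<lambda>A. \<pi> A \<xi>) ` conv" for x y
  proof -
    obtain A B where AB: "A \<in> conv" "B \<in> conv" "x = \<pi> A \<xi>" "y = \<pi> B \<xi>" using xy by blast
    have "x + y = \<pi> (A + B) \<xi>" by (simp add: AB pi_add conv_alg xi_in)
    thus ?thesis using conv_add[OF AB(1,2)] by blast
  qed
  show "c *\<^sub>C x \<in> (\<lambda>A. \<pi> A \<xi>) ` conv" if x: "x \<in> (\<lambda>A. \<pi> A \<xi>) ` conv" for c x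
  proof -
    obtain A where A: "A \<in> conv" "x = \<pi> A \<xi>" using x by blast
    have "c *\<^sub>C x = \<pi> (sc_scale c A) \<xi>" by (simp add: A pi_scale conv_alg xi_in)
    thus ?thesis using conv_scale[OF A(1)] by blast
  qed
qed

text \<open>The hypothesis compares local algebras, so there are two stages: a local element is
  represented inside the bicommutant and hence weakly approximated from the subalgebra; a quasilocal
  one is approximated in norm by local ones, with \<open>norm_gns_le\<close> controlling the
  vectors.\<close>

lemma conv_dense: "closure ((\<lambda>A. \<pi> A \<xi>) ` conv) = H"
proof
  let ?K = "closure ((\<lambda>A. \<pi> A \<xi>) ` conv)"
  show "?K \<subseteq> H"
    using pi_xi_in conv_alg closed_csubspaceD(1)[OF H_closed] by (intro closure_minimal) auto
  have local: "\<pi> A \<xi> \<in> ?K" if \<O>: "region \<O>" and A: "A \<in> scaling_local \<AA> U \<O>" for A \<O>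
  proof (rule closed_csubspace_weak_limit[OF closure_conv_subspace])
    have Aalg: "A \<in> alg" using local_subset_alg[OF \<O>] A by blast
    have "\<pi> A \<in> gns_local_algebra \<AA> U H \<pi> \<O>"
      unfolding gns_local_algebra_def commutant_on_def[of H "commutant_on H _"]
      using A pi_bop[OF Aalg] by (auto simp: commutant_on_def)
    hence wc: "\<pi> A \<in> weak_closure_on H (\<pi> ` (scaling_local \<AA> U \<O> \<inter> conv))"
      using local_weak_approx[OF \<O>] by blast
    fix y :: "'h gns" and \<epsilon> :: real assume \<epsilon>: "0 < \<epsilon>"
    \<comment> \<open>Weak approximation only tests against vectors of \<open>H\<close>, so \<open>y\<close> is first projected.\<close>
    obtain p where p: "p \<in> H" "\<And>z. z \<in> H \<Longrightarrow> z \<bullet>\<^sub>C (y - p) = 0"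
      using orthogonal_projection[OF H_closed, of y] by auto
    \<comment> \<open>One matrix element suffices, because the operators are compared only on the
      cyclic vector.\<close>
    have "finite {(p, \<xi>)} \<and> {(p, \<xi>)} \<subseteq> H \<times> H \<and> 0 < \<epsilon>" using p(1) xi_in \<epsilon> by simp
    hence "\<exists>T'\<in>\<pi> ` (scaling_local \<AA> U \<O> \<inter> conv). \<forall>(x, y)\<in>{(p, \<xi>)}. cmod (x \<bullet>\<^sub>C (\<pi> A y - T' y)) < \<epsilon>"
      using wc unfolding weak_closure_on_def by blast
    then obtain B where B: "B \<in> conv" "cmod (p \<bullet>\<^sub>C (\<pi> A \<xi> - \<pi> B \<xi>)) < \<epsilon>" by auto
    have "\<pi> A \<xi> - \<pi> B \<xi> \<in> H"
      by (intro closed_csubspaceD(5)[OF H_closed] pi_xi_in Aalg conv_alg B)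
    hence "(y - p) \<bullet>\<^sub>C (\<pi> A \<xi> - \<pi> B \<xi>) = 0" using p(2) by (metis cinner_commute complex_cnj_zero)
    hence "y \<bullet>\<^sub>C (\<pi> A \<xi> - \<pi> B \<xi>) = p \<bullet>\<^sub>C (\<pi> A \<xi> - \<pi> B \<xi>)" by (simp add: cinner_diff_left)
    hence "cmod (y \<bullet>\<^sub>C (\<pi> A \<xi> - \<pi> B \<xi>)) < \<epsilon>" using B(2) by simp
    thus "\<exists>z\<in>?K. cmod (y \<bullet>\<^sub>C (\<pi> A \<xi> - z)) < \<epsilon>"
      using B(1) closure_subset[of "(\<lambda>A. \<pi> A \<xi>) ` conv"] by blast
  qed
  have "\<pi> A \<xi> \<in> ?K" if A: "A \<in> alg" for A
  proof -
    have "\<exists>z\<in>?K. dist z (\<pi> A \<xi>) < \<epsilon>" if "0 < \<epsilon>" for \<epsilon>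
    proof -
      obtain \<O> B where B: "region \<O>" "B \<in> scaling_local \<AA> U \<O>" "sc_norm (A - B) < \<epsilon>"
        using alg_approx[OF A \<open>0 < \<epsilon>\<close>] by metis
      have Balg: "B \<in> alg" using local_subset_alg[OF B(1)] B(2) by blast
      have "norm (\<pi> A \<xi> - \<pi> B \<xi>) < \<epsilon>"
        using norm_gns_le[OF alg_diff[OF A Balg]] B(3) by (simp add: pi_diff A Balg xi_in)
      hence "dist (\<pi> B \<xi>) (\<pi> A \<xi>) < \<epsilon>" by (simp add: dist_norm norm_minus_commute)
      thus ?thesis using local[OF B(1,2)] by blast
    qed
    hence "\<pi> A \<xi> \<in> closure ?K" unfolding closure_approachable by blast
    thus ?thesis by simp
  qed
  hence "{\<pi> A \<xi> |A. A \<in> alg} \<subseteq> ?K" by blast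
  hence "closure {\<pi> A \<xi> |A. A \<in> alg} \<subseteq> ?K" by (rule closure_minimal) simp
  thus "H \<subseteq> ?K" by (simp add: cyclic)
qed

text \<open>Inner products of orbit vectors are values of the state on
  \<open>sc_mult (sc_star A) B\<close>, which stays in the subalgebra, so \<open>phi_act\<close>
  applies to them. The group law and the identity hold on the orbit and are inherited by its
  closure.\<close>

lemma extended_symmetry_rep:
  "\<exists>W. unitary_rep extended_group H W \<and> (\<forall>g\<in>extended_group. \<forall>A\<in>conv. W g (\<pi> A \<xi>) = \<pi> (sc_act U g A) \<xi>)"
proof -
  define impl where "impl g T \<longleftrightarrow> T ` H \<subseteq> H \<and> clinear_on H T \<and>
      (\<forall>x\<in>H. \<forall>y\<in>H. T x \<bullet>\<^sub>C T y = x \<bullet>\<^sub>C y) \<and> (\<forall>A\<in>conv. T (\<pi> A \<xi>) = \<pi> (sc_act U g A) \<xi>)"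
    for g T
  have "\<exists>T. impl g T" if g: "g \<in> extended_group" for g
    unfolding impl_def
  proof (rule isometric_extension[OF H_closed conv_dense])
    show "\<pi> (sc_act U g A) \<xi> \<in> H" if "A \<in> conv" for A
      by (intro pi_xi_in alg_act conv_alg that g)
    show "\<pi> (sc_act U g A) \<xi> \<bullet>\<^sub>C \<pi> (sc_act U g B) \<xi> = \<pi> A \<xi> \<bullet>\<^sub>C \<pi> B \<xi>"
      if AB: "A \<in> conv" "B \<in> conv" for A B
    proof -
      have "\<pi> (sc_act U g A) \<xi> \<bullet>\<^sub>C \<pi> (sc_act U g B) \<xi> = \<phi> (sc_mult (sc_star (sc_act U g A)) (sc_act U g B))"
        by (intro gns_inner alg_act conv_alg AB g)
      also have "sc_mult (sc_star (sc_act U g A)) (sc_act U g B) = sc_act U g (sc_mult (sc_star A) B)"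
        by (simp only: sc_act_mult[OF g] sc_act_star[OF g] alg_bounded conv_alg AB)
      also have "\<phi> \<dots> = \<phi> (sc_mult (sc_star A) B)"
        by (intro phi_act conv_mult conv_star AB g)
      also have "\<dots> = \<pi> A \<xi> \<bullet>\<^sub>C \<pi> B \<xi>" by (intro gns_inner[symmetric] conv_alg AB)
      finally show ?thesis .
    qed
  qed
  then obtain W where "\<And>g. g \<in> extended_group \<Longrightarrow> impl g (W g)" by metis
  hence W: "\<And>g. g \<in> extended_group \<Longrightarrow> W g ` H \<subseteq> H" "\<And>g. g \<in> extended_group \<Longrightarrow> clinear_on H (W g)"
      "\<And>g x y. g \<in> extended_group \<Longrightarrow> x \<in> H \<Longrightarrow> y \<in> H \<Longrightarrow> W g x \<bullet>\<^sub>C W g y = x \<bullet>\<^sub>C y"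
      "\<And>g A. g \<in> extended_group \<Longrightarrow> A \<in> conv \<Longrightarrow> W g (\<pi> A \<xi>) = \<pi> (sc_act U g A) \<xi>"
    unfolding impl_def by blast+
  let ?D = "(\<lambda>A. \<pi> A \<xi>) ` conv"
  have norm: "norm (W g x) = norm x" if "g \<in> extended_group" "x \<in> H" for g x
    using W(3)[OF that that(2)] by (simp add: norm_eq_sqrt_cinner)
  have bop: "W g \<in> bop_on H" if "g \<in> extended_group" for g
    using W(1,2)[OF that] norm[OF that] by (auto simp: bop_on_def intro!: exI[of _ 1])
  have comp: "W (symm_mult g h) x = W g (W h x)"
    if g: "g \<in> extended_group" and h: "h \<in> extended_group" and x: "x \<in> H" for g h x
  proof (rule continuous_on_closure_eqI[of ?D "W (symm_mult g h)" "\<lambda>x. W g (W h x)"])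
    show "continuous_on (closure ?D) (W (symm_mult g h))"
      unfolding conv_dense by (intro bop_on_continuous_on bop symm_mult_extended g h H_closed)
    have "W h ` H \<subseteq> H" by (rule W(1)[OF h])
    thus "continuous_on (closure ?D) (\<lambda>x. W g (W h x))"
      unfolding conv_dense
      by (rule continuous_on_compose2[OF bop_on_continuous_on[OF bop[OF g] H_closed]
            bop_on_continuous_on[OF bop[OF h] H_closed]])
    show "x \<in> closure ?D" using x by (simp only: conv_dense)
    fix y assume "y \<in> ?D"
    then obtain A where A: "A \<in> conv" "y = \<pi> A \<xi>" by blast
    show "W (symm_mult g h) y = W g (W h y)"
      by (simp only: A(2) W(4)[OF symm_mult_extended[OF g h] A(1)] W(4)[OF h A(1)]
          W(4)[OF g conv_act[OF A(1) h]] sc_act_symm_mult[OF g h])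
  qed
  have d1: "dilation 1 \<in> (extended_group :: 's symm set)" by (simp add: dilation_extended)
  have id: "W (dilation 1) x = x" if x: "x \<in> H" for x
  proof (rule continuous_on_closure_eqI[of ?D "W (dilation 1)" "\<lambda>x. x"])
    show "continuous_on (closure ?D) (W (dilation 1))"
      unfolding conv_dense by (intro bop_on_continuous_on bop d1 H_closed)
    show "x \<in> closure ?D" using x by (simp only: conv_dense)
    fix y assume "y \<in> ?D"
    then obtain A where A: "A \<in> conv" "y = \<pi> A \<xi>" by blast
    show "W (dilation 1) y = y"
      by (simp only: A(2) W(4)[OF d1 A(1)] sc_act_1[OF alg_bounded[OF conv_alg[OF A(1)]]])
  qed (intro continuous_on_id)
  have "unitary_between H H (W g)" if g: "g \<in> extended_group" for g
  proof -
    obtain g' where g': "g' \<in> extended_group" "symm_mult g g' = dilation 1"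
      using extended_group_inverse[OF g] by metis
    \<comment> \<open>An isometry need not be onto; the operator of the inverse group element
      supplies the preimage.\<close>
    have "H \<subseteq> W g ` H"
    proof
      fix x assume x: "x \<in> H"
      have "x = W g (W g' x)" using comp[OF g g'(1) x] id[OF x] by (simp add: g'(2))
      moreover have "W g' x \<in> H" using W(1)[OF g'(1)] x by blast
      ultimately show "x \<in> W g ` H" by blast
    qed
    thus ?thesis using W(1,2,3)[OF g] by (auto simp: unitary_between_def)
  qed
  \<comment> \<open>Orbit vectors move continuously because orbits in the scaling algebra are norm
    continuous, and isometry makes the approximation of \<open>x\<close> by such a vector uniform in
    the group element.\<close>
  moreover have "continuous_on extended_group (\<lambda>g. W g x)" if x: "x \<in> H" for x
    unfolding continuous_on_def
  proof (intro ballI tendstoI)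
    fix g :: "'s symm" and e :: real assume g: "g \<in> extended_group" and e: "0 < e"
    have "x \<in> closure ?D" using x by (simp only: conv_dense)
    hence "\<exists>y\<in>?D. dist y x < e / 3" using e by (simp only: closure_approachable)
    then obtain A where A: "A \<in> conv" "dist (\<pi> A \<xi>) x < e / 3" by blast
    note Aalg = conv_alg[OF A(1)]
    have "\<forall>\<^sub>F h in at g within extended_group. dist (sc_norm (sc_act U h A - sc_act U g A)) 0 < e / 3"
      using norm_contD[OF alg_norm_cont[OF Aalg] g] e by (intro tendstoD) auto
    moreover have "\<forall>\<^sub>F h in at g within extended_group. h \<in> extended_group"
      by (simp add: eventually_at_filter)
    ultimately show "\<forall>\<^sub>F h in at g within extended_group. dist (W h x) (W g x) < e"
    proof eventually_elim
      case (elim h)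
      have near: "norm (W k x - W k (\<pi> A \<xi>)) < e / 3" if k: "k \<in> extended_group" for k
      proof -
        have "W k x - W k (\<pi> A \<xi>) = W k (x - \<pi> A \<xi>)"
          by (intro clinear_on_diff[symmetric, OF W(2)[OF k] H_closed x pi_xi_in[OF Aalg]])
        thus ?thesis
          using A(2) norm[OF k closed_csubspaceD(5)[OF H_closed x pi_xi_in[OF Aalg]]]
          by (simp add: dist_norm norm_minus_commute)
      qed
      have "norm (W h (\<pi> A \<xi>) - W g (\<pi> A \<xi>)) = norm (\<pi> (sc_act U h A - sc_act U g A) \<xi>)"
        by (simp only: W(4)[OF elim(2) A(1)] W(4)[OF g A(1)]
            pi_diff[OF alg_act[OF Aalg elim(2)] alg_act[OF Aalg g] xi_in])
      also have "\<dots> \<le> sc_norm (sc_act U h A - sc_act U g A)"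
        by (intro norm_gns_le alg_diff alg_act Aalg g elim(2))
      also have "\<dots> < e / 3" using elim(1) unfolding dist_real_def by linarith
      finally have mid: "norm (W h (\<pi> A \<xi>) - W g (\<pi> A \<xi>)) < e / 3" .
      have "W h x - W g x = (W h x - W h (\<pi> A \<xi>)) + (W h (\<pi> A \<xi>) - W g (\<pi> A \<xi>)) - (W g x - W g (\<pi> A \<xi>))"
        by simp
      hence "norm (W h x - W g x) \<le> norm (W h x - W h (\<pi> A \<xi>)) + norm (W h (\<pi> A \<xi>) - W g (\<pi> A \<xi>))
          + norm (W g x - W g (\<pi> A \<xi>))"
        using norm_triangle_ineq4[of "(W h x - W h (\<pi> A \<xi>)) + (W h (\<pi> A \<xi>) - W g (\<pi> A \<xi>))" "W g x - W g (\<pi> A \<xi>)"]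
          norm_triangle_ineq[of "W h x - W h (\<pi> A \<xi>)" "W h (\<pi> A \<xi>) - W g (\<pi> A \<xi>)"] by simp
      thus ?case using near[OF elim(2)] near[OF g] mid by (simp add: dist_norm)
    qed
  qed
  ultimately have "unitary_rep extended_group H W" using comp by (simp add: unitary_rep_def)
  with W(4) show ?thesis by blast
qed

end


section \<open>Factorisation of the dilations\<close>

text \<open>On the range of \<open>V\<close> the adjoint is the inverse, so every claim is checked
  at points \<open>V x\<close>, where the two cancel.\<close>

lemma bop_on_conjugate:
  assumes V: "unitary_between S S' V" and S: "closed_csubspace S" and T: "T \<in> bop_on S"
  shows "(\<lambda>z. V (T (cadjoint_on S V z))) \<in> bop_on S'"
proof -
  note Vadj = cadjoint_on_unitary[OF V S]
  have lin: "clinear_on S V" and img: "V ` S = S'" using V by (auto simp: unitary_between_def)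
  have normV: "norm (V x) = norm x" if "x \<in> S" for x
    using V that by (simp add: unitary_between_def norm_eq_sqrt_cinner)
  obtain K where K: "\<And>x. x \<in> S \<Longrightarrow> norm (T x) \<le> K * norm x" using bop_onD(3)[OF T] by blast
  note TS = bop_onD(1)[OF T] and Tlin = clinear_onD[OF bop_onD(2)[OF T]] and Sd = closed_csubspaceD[OF S]
  have *: "V (T (cadjoint_on S V (V x))) = V (T x)" if "x \<in> S" for x by (simp add: Vadj that)
  show ?thesis
    unfolding bop_on_def clinear_on_def
  proof (intro CollectI conjI ballI allI)
    show "(\<lambda>z. V (T (cadjoint_on S V z))) ` S' \<subseteq> S'" using * TS img by auto
    fix z assume "z \<in> S'"
    then obtain x where x: "x \<in> S" "z = V x" using img by blast
    show "V (T (cadjoint_on S V (z + w))) = V (T (cadjoint_on S V z)) + V (T (cadjoint_on S V w))"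
      if w: "w \<in> S'" for w
    proof -
      obtain y where y: "y \<in> S" "w = V y" using w img by blast
      have zw: "z + w = V (x + y)" by (simp add: x y clinear_onD(1)[OF lin])
      have "V (T (cadjoint_on S V (z + w))) = V (T (x + y))"
        by (simp only: zw Vadj[OF Sd(3)[OF x(1) y(1)]])
      also have "\<dots> = V (T x) + V (T y)"
        using x(1) y(1) by (simp add: Tlin(1) clinear_onD(1)[OF lin] TS)
      finally show ?thesis by (simp only: x y Vadj)
    qed
    show "V (T (cadjoint_on S V (c *\<^sub>C z))) = c *\<^sub>C V (T (cadjoint_on S V z))" for c
    proof -
      have cz: "c *\<^sub>C z = V (c *\<^sub>C x)" by (simp add: x clinear_onD(2)[OF lin])
      have "V (T (cadjoint_on S V (c *\<^sub>C z))) = V (T (c *\<^sub>C x))"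
        by (simp only: cz Vadj[OF Sd(4)[OF x(1)]])
      also have "\<dots> = c *\<^sub>C V (T x)"
        using x(1) by (simp add: Tlin(2) clinear_onD(2)[OF lin] TS)
      finally show ?thesis by (simp only: x Vadj)
    qed
  next
    show "\<exists>K. \<forall>z\<in>S'. norm (V (T (cadjoint_on S V z))) \<le> K * norm z"
      using K img by (intro exI[of _ K]) (auto simp: Vadj normV TS)
  qed
qed

text \<open>One factor is moved to the closure at a time while the other is held fixed, so separate
  continuity of both sides is enough.\<close>

lemma tensor_factor_of_dense:
  assumes R: "R \<in> bop_on (tensor_space (closure D) (closure E))"
    and T: "continuous_on (closure D) T" and T': "continuous_on (closure E) T'"
    and eq: "\<And>x y. x \<in> D \<Longrightarrow> y \<in> E \<Longrightarrow> R (x \<otimes>\<^sub>2 y) = T x \<otimes>\<^sub>2 T' y"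
    and x: "x \<in> closure D" and y: "y \<in> closure E"
  shows "R (x \<otimes>\<^sub>2 y) = T x \<otimes>\<^sub>2 T' y"
proof -
  note cR = bop_on_continuous_on[OF R closed_csubspace_tensor_space]
  have 1: "R (u \<otimes>\<^sub>2 y) = T u \<otimes>\<^sub>2 T' y" if u: "u \<in> D" for u
  proof (rule continuous_on_closure_eqI[of E "\<lambda>y. R (u \<otimes>\<^sub>2 y)" "\<lambda>y. T u \<otimes>\<^sub>2 T' y"])
    have "u \<in> closure D" using u closure_subset by blast
    thus "continuous_on (closure E) (\<lambda>y. R (u \<otimes>\<^sub>2 y))"
      by (intro continuous_on_compose2[OF cR]) (auto intro!: continuous_intros tensor_in_tensor_space)
    show "continuous_on (closure E) (\<lambda>y. T u \<otimes>\<^sub>2 T' y)" by (intro continuous_intros T')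
  qed (use eq u y in auto)
  show ?thesis
  proof (rule continuous_on_closure_eqI[of D "\<lambda>x. R (x \<otimes>\<^sub>2 y)" "\<lambda>x. T x \<otimes>\<^sub>2 T' y"])
    show "continuous_on (closure D) (\<lambda>x. R (x \<otimes>\<^sub>2 y))"
      using y by (intro continuous_on_compose2[OF cR]) (auto intro!: continuous_intros tensor_in_tensor_space)
    show "continuous_on (closure D) (\<lambda>x. T x \<otimes>\<^sub>2 T' y)" by (intro continuous_intros T)
  qed (use 1 x in auto)
qed

text \<open>The given \<open>Uu\<close> is pinned down only on the stabilizer of its state, so the
  extension is a separate family \<open>W\<close>. It is chosen before the invariant limit states
  and their \<open>V\<close> are quantified, hence one family serves all of them.\<close>

theorem proposition5p3:
  fixes \<AA> :: "'s::finite minkowski set \<Rightarrow> ('h::chilbert_space \<Rightarrow> 'h) set"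
    and U :: "'s symm \<Rightarrow> 'h \<Rightarrow> 'h" and \<Omega> :: 'h and \<AA>conv :: "'h sc set"
    and mu :: "'h sc \<Rightarrow> complex"
    and Hu :: "'h gns set" and \<pi>u :: "'h sc \<Rightarrow> 'h gns \<Rightarrow> 'h gns" and \<Omega>u :: "'h gns"
    and Uu :: "'s symm \<Rightarrow> 'h gns \<Rightarrow> 'h gns"
  assumes "vacuum_sector_net \<AA> U \<Omega>"
    and "convergent_scaling_limit \<AA> U \<Omega> \<AA>conv"
    and "asymptotic_mean \<AA> U mu" and "multiplicative_mean \<AA> U mu"
    and "is_gns (scaling_algebra \<AA> U) (limit_state \<Omega> mu) Hu \<pi>u \<Omega>u"
    and "is_gns_symmetry_rep \<AA> U (limit_state \<Omega> mu) Hu \<pi>u \<Omega>u Uu"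
    and "separable_space (top_of_set Hu)"
  shows "\<exists>W :: 's symm \<Rightarrow> 'h gns \<Rightarrow> 'h gns.
    unitary_rep extended_group Hu W \<and>
    (\<forall>g\<in>poincare_group. \<forall>x\<in>Hu. W g x = Uu g x) \<and>
    (\<forall>m0 H0 \<pi>0 \<Omega>0 U0 V.
       asymptotic_mean \<AA> U m0 \<and> invariant_mean \<AA> U m0 \<and>
       is_gns (scaling_algebra \<AA> U) (limit_state \<Omega> m0) H0 \<pi>0 \<Omega>0 \<and>
       is_gns_symmetry_rep \<AA> U (limit_state \<Omega> m0) H0 \<pi>0 \<Omega>0 U0 \<and>
       unitary_between H0 (tensor_space (center_space \<AA> U \<pi>0 \<Omega>0) Hu) V \<and>
       (\<forall>A\<in>\<AA>conv. \<forall>C\<in>scaling_center \<AA> U.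
          V (\<pi>0 (sc_mult A C) \<Omega>0) = \<pi>0 C \<Omega>0 \<otimes>\<^sub>2 \<pi>u A \<Omega>u)
       \<longrightarrow> (\<forall>\<mu>>0. \<forall>x\<in>tensor_space (center_space \<AA> U \<pi>0 \<Omega>0) Hu.
             V (U0 (dilation \<mu>) (cadjoint_on H0 V x)) =
             tensor_op (center_space \<AA> U \<pi>0 \<Omega>0) Hu (U0 (dilation \<mu>)) (W (dilation \<mu>)) x))"
proof -
  interpret u: convergent_limit \<AA> U \<Omega> mu Hu \<pi>u \<Omega>u \<AA>conv
    by unfold_locales (fact assms)+
  let ?D = "(\<lambda>A. \<pi>u A \<Omega>u) ` \<AA>conv"
  obtain W where W: "unitary_rep extended_group Hu W"
      "\<And>g A. g \<in> extended_group \<Longrightarrow> A \<in> \<AA>conv \<Longrightarrow> W g (\<pi>u A \<Omega>u) = \<pi>u (sc_act U g A) \<Omega>u"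
    using u.extended_symmetry_rep by blast
  have Wbop: "W g \<in> bop_on Hu" if "g \<in> extended_group" for g
    using W(1) that by (intro unitary_between_bop) (simp add: unitary_rep_def)
  \<comment> \<open>Both operators are bounded and follow the same formula on the orbit of the
    convergent subalgebra, which is dense.\<close>
  have "W g x = Uu g x" if g: "g \<in> poincare_group" and x: "x \<in> Hu" for g x
  proof -
    have ge: "g \<in> extended_group" using g poincare_subset_extended by blast
    have gs: "g \<in> state_stabilizer \<AA> U (limit_state \<Omega> mu)" using g u.poincare_stabilizer by blast
    have Uu: "Uu g \<in> bop_on Hu"
        "\<And>A. A \<in> scaling_algebra \<AA> U \<Longrightarrow> Uu g (\<pi>u A \<Omega>u) = \<pi>u (sc_act U g A) \<Omega>u"
      using assms(6) gs unfolding is_gns_symmetry_rep_def by blast+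
    show ?thesis
    proof (rule bop_on_eqI[of ?D "W g" "Uu g"])
      show "closed_csubspace (closure ?D)" "W g \<in> bop_on (closure ?D)" "Uu g \<in> bop_on (closure ?D)"
        "x \<in> closure ?D"
        unfolding u.conv_dense by (fact u.H_closed Wbop[OF ge] Uu(1) x)+
      show "W g y = Uu g y" if "y \<in> ?D" for y
        using that by (auto simp only: W(2)[OF ge] Uu(2) u.conv_alg)
    qed
  qed
  moreover have "V (U0 (dilation \<mu>) (cadjoint_on H0 V x)) =
      tensor_op (center_space \<AA> U \<pi>0 \<Omega>0) Hu (U0 (dilation \<mu>)) (W (dilation \<mu>)) x"
    if m0: "asymptotic_mean \<AA> U m0" "invariant_mean \<AA> U m0"
      and gns0: "is_gns (scaling_algebra \<AA> U) (limit_state \<Omega> m0) H0 \<pi>0 \<Omega>0"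
      and U0: "is_gns_symmetry_rep \<AA> U (limit_state \<Omega> m0) H0 \<pi>0 \<Omega>0 U0"
      and V: "unitary_between H0 (tensor_space (center_space \<AA> U \<pi>0 \<Omega>0) Hu) V"
      and V_eq: "\<forall>A\<in>\<AA>conv. \<forall>C\<in>scaling_center \<AA> U.
          V (\<pi>0 (sc_mult A C) \<Omega>0) = \<pi>0 C \<Omega>0 \<otimes>\<^sub>2 \<pi>u A \<Omega>u"
      and \<mu>: "\<mu> > 0" and x: "x \<in> tensor_space (center_space \<AA> U \<pi>0 \<Omega>0) Hu"
    for m0 H0 \<pi>0 \<Omega>0 U0 V \<mu> x
  proof -
    \<comment> \<open>An invariant mean need not be multiplicative, so this side uses the general
      locale; the dilations act on \<open>H0\<close> by invariance of the state instead.\<close>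
    interpret z: limit_gns \<AA> U \<Omega> m0 H0 \<pi>0 \<Omega>0
      by unfold_locales (fact m0 gns0)+
    let ?d = "dilation \<mu> :: 's symm" and ?C = "scaling_center \<AA> U"
    let ?R = "\<lambda>x. V (U0 ?d (cadjoint_on H0 V x))"
    define E where "E = {\<pi>0 C \<Omega>0 |C. C \<in> ?C}"
    have HZ: "center_space \<AA> U \<pi>0 \<Omega>0 = closure E" by (simp add: center_space_def E_def)
    have d: "?d \<in> extended_group" by (rule dilation_extended[OF \<mu>])
    have "?d \<in> state_stabilizer \<AA> U (limit_state \<Omega> m0)" by (rule z.dilation_stabilizer[OF m0(2) \<mu>])
    hence U0d: "U0 ?d \<in> bop_on H0"
        "\<And>A. A \<in> scaling_algebra \<AA> U \<Longrightarrow> U0 ?d (\<pi>0 A \<Omega>0) = \<pi>0 (sc_act U ?d A) \<Omega>0"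
      using U0 unfolding is_gns_symmetry_rep_def by blast+
    have "E \<subseteq> H0" unfolding E_def using z.pi_xi_in u.center_alg by blast
    hence EH: "closure E \<subseteq> H0" using closed_csubspaceD(1)[OF z.H_closed] by (rule closure_minimal)
    have R: "?R \<in> bop_on (tensor_space (closure E) (closure ?D))"
      using bop_on_conjugate[OF V z.H_closed U0d(1)] by (simp only: HZ u.conv_dense)
    have factor: "?R (a \<otimes>\<^sub>2 b) = U0 ?d a \<otimes>\<^sub>2 W ?d b" if ab: "a \<in> E" "b \<in> ?D" for a b
    proof -
      obtain A C where AC: "A \<in> \<AA>conv" "C \<in> ?C" "a = \<pi>0 C \<Omega>0" "b = \<pi>u A \<Omega>u"
        using ab by (auto simp: E_def)
      note alg = u.conv_alg[OF AC(1)] u.center_alg[OF AC(2)]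
      have prod: "sc_mult A C \<in> scaling_algebra \<AA> U" by (intro u.alg_mult alg)
      have "?R (a \<otimes>\<^sub>2 b) = ?R (V (\<pi>0 (sc_mult A C) \<Omega>0))" using V_eq AC by simp
      also have "\<dots> = V (\<pi>0 (sc_act U ?d (sc_mult A C)) \<Omega>0)"
        by (simp only: cadjoint_on_unitary[OF V z.H_closed z.pi_xi_in[OF prod]] U0d(2)[OF prod])
      also have "\<dots> = V (\<pi>0 (sc_mult (sc_act U ?d A) (sc_act U ?d C)) \<Omega>0)"
        by (simp only: u.sc_act_mult[OF d])
      \<comment> \<open>The convergent subalgebra and the center are both stable under dilations, so
        the defining property of \<open>V\<close> applies once more, now to the moved
        factors.\<close>
      also have "\<dots> = \<pi>0 (sc_act U ?d C) \<Omega>0 \<otimes>\<^sub>2 \<pi>u (sc_act U ?d A) \<Omega>u"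
        using V_eq u.conv_act[OF AC(1) d] u.center_act[OF AC(2) d] by blast
      also have "\<dots> = U0 ?d a \<otimes>\<^sub>2 W ?d b"
        by (simp only: AC(3,4) U0d(2)[OF alg(2)] W(2)[OF d AC(1)])
      finally show ?thesis .
    qed
    \<comment> \<open>\<open>tensor_op_eqI\<close> asks for all pairs of vectors of the two spaces,
      in which the orbit vectors are merely dense.\<close>
    have "?R (a \<otimes>\<^sub>2 b) = U0 ?d a \<otimes>\<^sub>2 W ?d b" if ab: "a \<in> closure E" "b \<in> closure ?D" for a b
    proof (rule tensor_factor_of_dense[OF R _ _ factor ab])
      show "continuous_on (closure E) (U0 ?d)"
        by (rule continuous_on_subset[OF bop_on_continuous_on[OF U0d(1) z.H_closed] EH])
      show "continuous_on (closure ?D) (W ?d)"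
        unfolding u.conv_dense by (rule bop_on_continuous_on[OF Wbop[OF d] u.H_closed])
    qed
    from tensor_op_eqI[OF R this, of x] x show ?thesis by (simp only: HZ u.conv_dense)
  qed
  ultimately show ?thesis using W(1) by blast
qed

end
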